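(* Let $n\ge 1$, $T>0$, $p\in(1,+\infty)$, and let $b,\tilde b:[0,T]\times\mathbb{R}^n\to\mathbb{R}^n$ be bounded vector fields belonging to $L^1([0,T];W^{1,p}(\mathbb{R}^n;\mathbb{R}^n))$. Let $X$ and $\tilde X$ be regular Lagrangian flows associated to $b$ and $\tilde b$ respectively, with compressibility constants $L$ and $\tilde L$. Let $\tau\in[0,T]$, $r>0$, and set $R=r+T\|\tilde b\|_\infty$ and $$\delta:=\|b-\tilde b\|_{L^1([0,\tau];L^p(B_R(0)))}=\int_0^\tau\|b(t,\cdot)-\tilde b(t,\cdot)\|_{L^p(B_R(0))}\,dt.$$ Then there exist constants $C>0$ and $\delta_0\in(0,1)$, depending only on $n$, $p$, $\tau$, $r$, $\|b\|_\infty$, $\|\tilde b\|_\infty$, $L$, $\tilde L$ and $\|D_xb\|_{L^1(L^p)}$, such that if $\delta\le\delta_0$ then $$\sup_{0\le t\le\tau}\|X(t,\cdot)-\tilde X(t,\cdot)\|_{L^p(B_r(0))}\le C\,|\log\delta|^{-1},$$ where the right-hand side is understood to be $0$ if $\delta=0$.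
   Context: $\mathscr{L}^n$ is Lebesgue measure on $\mathbb{R}^n$ and $B_\rho(0)$ is the open ball of radius $\rho$ centred at the origin. $\|\cdot\|_\infty$ denotes the norm of $L^\infty([0,T]\times\mathbb{R}^n;\mathbb{R}^n)$. $D_xb$ is the spatial (weak) derivative of $b$, and $\|D_xb\|_{L^1(L^p)}=\int_0^T\|D_xb(t,\cdot)\|_{L^p(\mathbb{R}^n)}\,dt$. Definition (regular Lagrangian flow). Let $b\in L^1_{loc}([0,T]\times\mathbb{R}^n;\mathbb{R}^n)$. A map $X:[0,T]\times\mathbb{R}^n\to\mathbb{R}^n$ is a regular Lagrangian flow for $b$ if: (1) for a.e. $x\in\mathbb{R}^n$ the map $t\mapsto X(t,x)$ is an absolutely continuous integral solution of $\dot\gamma(t)=b(t,\gamma(t))$ for $t\in[0,T]$ with $\gamma(0)=x$, i.e. $X(t,x)=x+\int_0^t b(s,X(s,x))\,ds$ for all $t\in[0,T]$; (2) there exists a positive constant $L$, not dependent on $t$, such that $\mathscr{L}^n(X(t,\cdot)^{-1}(A))\le L\,\mathscr{L}^n(A)$ for every Borel set $A\subset\mathbb{R}^n$ and every $t\in[0,T]$. Such a constant $L$ is called the compressibility constant of $X$. *)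

theory Defs
  imports "HOL-Analysis.Analysis" "HOL-Probability.Essential_Supremum"
begin

section \<open>Lebesgue norms and mixed spaces\<close>

text \<open>
  Functions are used as pointwise representatives of their almost-everywhere classes. All norms
  take values in the extended nonnegative reals, so that a norm is never finite by default.
\<close>

definition eLp_norm ::
  "real \<Rightarrow> 'a::euclidean_space set \<Rightarrow> ('a \<Rightarrow> 'b::euclidean_space) \<Rightarrow> ennreal" where
  "eLp_norm p S f =
     (let I = (\<integral>\<^sup>+ x\<in>S. ennreal (norm (f x) powr p) \<partial>lebesgue)
      in if I = \<infinity> then \<infinity> else ennreal (enn2real I powr (1 / p)))"

definition Linf_norm :: "real \<Rightarrow> (real \<Rightarrow> 'a::euclidean_space \<Rightarrow> 'b::euclidean_space) \<Rightarrow> ennreal" where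
  "Linf_norm T f =
     esssup (lebesgue_on ({0..T} \<times> UNIV)) (\<lambda>(t, x). ennreal (norm (f t x)))"

definition L1_Lp_norm ::
  "real \<Rightarrow> real \<Rightarrow> 'a::euclidean_space set \<Rightarrow> (real \<Rightarrow> 'a \<Rightarrow> 'b::euclidean_space) \<Rightarrow> ennreal" where
  "L1_Lp_norm T p S f = (\<integral>\<^sup>+ t\<in>{0..T}. eLp_norm p S (f t) \<partial>lebesgue)"

text \<open>
  For \<open>1 \<le> p < \<infinity>\<close> the Bochner space \<open>L\<^sup>1([0,T]; L\<^sup>p)\<close> is identified, as usual, with the jointly
  measurable functions of finite mixed norm.
\<close>

definition jointly_measurable ::
  "real \<Rightarrow> (real \<Rightarrow> 'a::euclidean_space \<Rightarrow> 'b::euclidean_space) \<Rightarrow> bool" where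
  "jointly_measurable T f \<longleftrightarrow>
     (\<lambda>(t, x). f t x) \<in> borel_measurable (lebesgue_on ({0..T} \<times> UNIV))"

definition L1_Lp :: "real \<Rightarrow> real \<Rightarrow> (real \<Rightarrow> 'a::euclidean_space \<Rightarrow> 'b::euclidean_space) set" where
  "L1_Lp T p = {f. jointly_measurable T f \<and> L1_Lp_norm T p UNIV f < \<infinity>}"

definition locally_integrable_on ::
  "('a::euclidean_space \<Rightarrow> 'b::euclidean_space) \<Rightarrow> 'a set \<Rightarrow> bool" where
  "locally_integrable_on f S \<longleftrightarrow> (\<forall>K\<subseteq>S. compact K \<longrightarrow> f absolutely_integrable_on K)"

section \<open>Weak derivatives and Sobolev regularity in space\<close>

definition partial_deriv :: "'n::finite \<Rightarrow> (real^'n \<Rightarrow> real) \<Rightarrow> real^'n \<Rightarrow> real" where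
  "partial_deriv j \<phi> x = frechet_derivative \<phi> (at x) (axis j 1)"

primrec C_times :: "nat \<Rightarrow> (real^'n::finite \<Rightarrow> real) \<Rightarrow> bool" where
  "C_times 0 \<phi> \<longleftrightarrow> continuous_on UNIV \<phi>"
| "C_times (Suc k) \<phi> \<longleftrightarrow>
     (\<forall>x. \<phi> differentiable at x) \<and> (\<forall>j. C_times k (partial_deriv j \<phi>))"

definition test_function :: "(real^'n::finite \<Rightarrow> real) \<Rightarrow> bool" where
  "test_function \<phi> \<longleftrightarrow> (\<forall>k. C_times k \<phi>) \<and> compact (closure {x. \<phi> x \<noteq> 0})"

text \<open>
  The weak derivative is the Jacobian matrix, with entry \<open>\<partial>\<^sub>j f\<^sub>i\<close> in row \<open>i\<close> and column \<open>j\<close>;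
  its \<^const>\<open>norm\<close> is the Euclidean (Frobenius) norm.
\<close>

definition has_weak_derivative ::
  "(real^'n::finite \<Rightarrow> real^'m::finite) \<Rightarrow> (real^'n \<Rightarrow> real^'n^'m) \<Rightarrow> bool" where
  "has_weak_derivative f G \<longleftrightarrow>
     locally_integrable_on f UNIV \<and> locally_integrable_on G UNIV \<and>
     (\<forall>\<phi> i j. test_function \<phi> \<longrightarrow>
        (LINT x|lebesgue. f x $ i * partial_deriv j \<phi> x)
        = - (LINT x|lebesgue. G x $ i $ j * \<phi> x))"

definition spatial_weak_derivative ::
  "real \<Rightarrow> (real \<Rightarrow> real^'n::finite \<Rightarrow> real^'m::finite) \<Rightarrow> (real \<Rightarrow> real^'n \<Rightarrow> real^'n^'m) \<Rightarrow> bool" where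
  "spatial_weak_derivative T b D \<longleftrightarrow>
     jointly_measurable T D \<and> (AE t in lebesgue_on {0..T}. has_weak_derivative (b t) (D t))"

definition L1_W1p :: "real \<Rightarrow> real \<Rightarrow> (real \<Rightarrow> real^'n::finite \<Rightarrow> real^'m::finite) set" where
  "L1_W1p T p = {b. b \<in> L1_Lp T p \<and> (\<exists>D\<in>L1_Lp T p. spatial_weak_derivative T b D)}"

section \<open>Regular Lagrangian flows\<close>

text \<open>
  A curve satisfying the integral equation below is automatically absolutely continuous.
\<close>

definition integral_solution ::
  "real \<Rightarrow> (real \<Rightarrow> real^'n::finite \<Rightarrow> real^'n) \<Rightarrow> real^'n \<Rightarrow> (real \<Rightarrow> real^'n) \<Rightarrow> bool" where
  "integral_solution T b x \<gamma> \<longleftrightarrow>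
     (\<lambda>s. b s (\<gamma> s)) absolutely_integrable_on {0..T} \<and>
     (\<forall>t\<in>{0..T}. \<gamma> t = x + integral {0..t} (\<lambda>s. b s (\<gamma> s)))"

text \<open>
  Measurability of the preimages is implicit in speaking of their measure; it has to be required
  here because \<^const>\<open>emeasure\<close> is zero on sets that are not measurable.
\<close>

definition compressibility_constant ::
  "real \<Rightarrow> (real \<Rightarrow> real^'n::finite \<Rightarrow> real^'n) \<Rightarrow> real \<Rightarrow> bool" where
  "compressibility_constant T X L \<longleftrightarrow>
     0 < L \<and>
     (\<forall>t\<in>{0..T}. \<forall>A\<in>sets borel.
        X t -` A \<in> sets lebesgue \<and>
        emeasure lebesgue (X t -` A) \<le> ennreal L * emeasure lebesgue A)"

definition regular_Lagrangian_flow ::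
  "real \<Rightarrow> (real \<Rightarrow> real^'n::finite \<Rightarrow> real^'n) \<Rightarrow> (real \<Rightarrow> real^'n \<Rightarrow> real^'n) \<Rightarrow> bool" where
  "regular_Lagrangian_flow T b X \<longleftrightarrow>
     locally_integrable_on (\<lambda>(t, x). b t x) ({0..T} \<times> UNIV) \<and>
     (AE x in lebesgue. integral_solution T b x (\<lambda>t. X t x)) \<and>
     (\<exists>L. compressibility_constant T X L)"

end

theory Submission
  imports Defs
begin

text \<open>
  The proof is the estimate of Crippa and De Lellis. The trajectories of \<open>X\<close> and \<open>X'\<close> cannot be
  compared by Gronwall's inequality, since a Sobolev field is not Lipschitz. It has, however, a
  Lipschitz estimate with a variable constant: outside a null set
  \<open>|b(x) - b(y)| \<le> C |x - y| (M|Db|(x) + M|Db|(y))\<close>, where \<open>M\<close> is the Hardy-Littlewood maximal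
  operator (\<open>weak_derivative_maximal_function_bound\<close>). Therefore the logarithm
  \<open>ln (1 + |X - X'| / \<epsilon>)\<close> grows along trajectories at a rate of at most
  \<open>C (M|Db|(X) + M|Db|(X')) + |b - b'|(X') / \<epsilon>\<close>, in which the distance has cancelled.

  In \<open>L\<^sup>p\<close> in space, the compressibility constants remove the compositions with the flows, and for
  \<open>p > 1\<close> the maximal operator is bounded (\<open>maximal_function_strong_type\<close>). Minkowski's integral
  inequality then bounds the \<open>L\<^sup>p\<close> norm of the logarithm over the ball by a constant \<open>W\<close> as soon as
  \<open>\<delta> \<le> \<epsilon>\<close>. Where the logarithm is at most \<open>|ln \<epsilon>| / 2\<close>, the distance is at most
  \<open>\<surd>\<epsilon> \<le> 2 / |ln \<epsilon>|\<close>; elsewhere the distance is bounded, because the fields are, and Chebyshev's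
  inequality gains a factor \<open>|ln \<epsilon>|\<^sup>-\<^sup>1\<close> in the norm (\<open>stability_at_scale\<close>). The choice
  \<open>\<epsilon> = \<delta>\<close> proves the theorem for \<open>\<delta> > 0\<close>. For \<open>\<delta> = 0\<close> every \<open>\<epsilon>\<close> is allowed, and \<open>\<epsilon> \<rightarrow> 0\<close>
  shows that the flows coincide.

  The variable Lipschitz estimate is obtained without smoothing \<open>b\<close>: a bump of fixed mass and of radius
  \<open>\<theta>\<close> is moved from the point \<open>x\<close>, at \<open>\<theta> = 0\<close>, to a bump around \<open>y\<close> of radius \<open>|x - y|\<close>. Its
  derivative in \<open>\<theta>\<close> is a divergence, so that the weak derivative of \<open>b\<close> controls the average of
  \<open>b\<close> against it; at every Lebesgue point \<open>x\<close> the average tends to a fixed multiple of \<open>b(x)\<close> as \<open>\<theta> \<rightarrow> 0\<close>.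
\<close>

section \<open>The Hardy-Littlewood maximal function\<close>

definition maximal_function :: "('a::euclidean_space \<Rightarrow> ennreal) \<Rightarrow> 'a \<Rightarrow> ennreal" where
  "maximal_function f x =
     (SUP r\<in>{0<..}. (\<integral>\<^sup>+y\<in>ball x r. f y \<partial>lborel) / emeasure lborel (ball x r))"

lemma ball_in_sets_borel [measurable, simp]: "ball (x::'a::metric_space) r \<in> sets borel"
  by (simp add: borel_open)

lemma emeasure_ball_pos_finite:
  fixes x :: "'a::euclidean_space"
  assumes "0 < r"
  shows "emeasure lborel (ball x r) \<noteq> 0" "emeasure lborel (ball x r) \<noteq> \<infinity>"
  using assms by (simp_all add: emeasure_ball ennreal_mult_eq_top_iff unit_ball_vol_pos less_imp_le
      mult_pos_pos ennreal_eq_0_iff not_le)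

text \<open>
  The working form of the definition: it avoids quotients of extended reals.
\<close>

lemma maximal_function_le_iff:
  "maximal_function f x \<le> c \<longleftrightarrow>
     (\<forall>r>0. (\<integral>\<^sup>+y\<in>ball x r. f y \<partial>lborel) \<le> c * emeasure lborel (ball x r))"
proof -
  have "(\<integral>\<^sup>+y\<in>ball x r. f y \<partial>lborel) / emeasure lborel (ball x r) \<le> c \<longleftrightarrow>
        (\<integral>\<^sup>+y\<in>ball x r. f y \<partial>lborel) \<le> c * emeasure lborel (ball x r)" if "0 < r" for r
  proof -
    let ?e = "emeasure lborel (ball x r)" and ?a = "\<integral>\<^sup>+y\<in>ball x r. f y \<partial>lborel"
    have e: "?e \<noteq> 0" "?e \<noteq> top" using emeasure_ball_pos_finite[OF that, of x] by auto
    have 1: "?a / ?e * ?e = ?a"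
      by (metis e ennreal_mult_divide_eq ennreal_times_divide mult.commute)
    have 2: "c * ?e / ?e = c"
      using e by (simp add: ennreal_mult_divide_eq)
    show ?thesis
      using mult_right_mono[of "?a / ?e" c ?e] divide_right_mono_ennreal[of ?a "c * ?e" ?e]
      unfolding 1 2 by auto
  qed
  then show ?thesis
    unfolding maximal_function_def by (auto simp: SUP_le_iff)
qed

lemma integral_ball_le_maximal_function:
  assumes "0 < r"
  shows "(\<integral>\<^sup>+y\<in>ball x r. f y \<partial>lborel) \<le> maximal_function f x * emeasure lborel (ball x r)"
  using assms maximal_function_le_iff[of f x "maximal_function f x"] by auto

lemma less_maximal_function_iff:
  "c < maximal_function f x \<longleftrightarrow>
     (\<exists>r>0. c * emeasure lborel (ball x r) < (\<integral>\<^sup>+y\<in>ball x r. f y \<partial>lborel))"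
  using maximal_function_le_iff[of f x c] by (auto simp: not_le[symmetric])

text \<open>
  The integral over the ball of radius \<open>r\<close> is lower semicontinuous in the centre: by monotone
  convergence a slightly smaller ball already has a large integral, and it is contained in the balls
  of radius \<open>r\<close> around all nearby centres. This gives Borel measurability of the maximal function.
\<close>

lemma open_integral_ball_greater:
  fixes f :: "'a::euclidean_space \<Rightarrow> ennreal"
  assumes [measurable]: "f \<in> borel_measurable borel"
  shows "open {x. c < (\<integral>\<^sup>+y\<in>ball x r. f y \<partial>lborel)}"
proof (rule Topological_Spaces.openI)
  fix x assume "x \<in> {x. c < (\<integral>\<^sup>+y\<in>ball x r. f y \<partial>lborel)}"
  then have c: "c < (\<integral>\<^sup>+y\<in>ball x r. f y \<partial>lborel)" by simp
  let ?s = "\<lambda>k::nat. r - 1 / Suc k"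
  have U: "ball x r = (\<Union>k. ball x (?s k))"
  proof (intro equalityI subsetI)
    fix y assume "y \<in> ball x r"
    then have "0 < r - dist x y" by simp
    then obtain k where "1 / Suc k < r - dist x y" using nat_approx_posE by blast
    then show "y \<in> (\<Union>k. ball x (?s k))" by (auto intro!: exI[of _ k])
  next
    fix y assume "y \<in> (\<Union>k. ball x (?s k))"
    then obtain k where "dist x y < ?s k" by auto
    moreover have "?s k \<le> r" by simp
    ultimately show "y \<in> ball x r" by (simp only: mem_ball)
  qed
  have "(\<integral>\<^sup>+y\<in>ball x r. f y \<partial>lborel) = (\<integral>\<^sup>+y. (SUP k. f y * indicator (ball x (?s k)) y) \<partial>lborel)"
  proof (rule nn_integral_cong)
    fix y
    show "f y * indicator (ball x r) y = (SUP k. f y * indicator (ball x (?s k)) y)"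
    proof (cases "y \<in> ball x r")
      case True
      then obtain k where k: "y \<in> ball x (?s k)" using U by blast
      show ?thesis
        using True k by (intro antisym SUP_upper2[of k] SUP_least) (auto split: split_indicator)
    next
      case False
      then have "\<And>k. y \<notin> ball x (?s k)" using U by blast
      then show ?thesis using False by (simp add: indicator_def)
    qed
  qed
  also have "\<dots> = (SUP k. (\<integral>\<^sup>+y\<in>ball x (?s k). f y \<partial>lborel))"
  proof (rule nn_integral_monotone_convergence_SUP)
    have sub: "ball x (?s i) \<subseteq> ball x (?s j)" if "i \<le> j" for i j
    proof -
      have "?s i \<le> ?s j" using that by (simp add: frac_le)
      then show ?thesis by (rule subset_ball)
    qed
    show "incseq (\<lambda>k y. f y * indicator (ball x (?s k)) y)"
      unfolding incseq_def le_fun_def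
    proof (intro allI impI mult_left_mono)
      fix i j :: nat and y assume "i \<le> j"
      then show "indicator (ball x (?s i)) y \<le> (indicator (ball x (?s j)) y :: ennreal)"
        by (rule indicator_leI[OF subsetD[OF sub]])
    qed simp
  qed (intro borel_measurable_times_ennreal borel_measurable_indicator; simp)
  finally obtain k where k: "c < (\<integral>\<^sup>+y\<in>ball x (?s k). f y \<partial>lborel)"
    using c by (auto simp: less_SUP_iff)
  show "\<exists>T. open T \<and> x \<in> T \<and> T \<subseteq> {x. c < (\<integral>\<^sup>+y\<in>ball x r. f y \<partial>lborel)}"
  proof (intro exI[of _ "ball x (1 / Suc k)"] conjI subsetI)
    fix z assume z: "z \<in> ball x (1 / Suc k)"
    have "ball x (?s k) \<subseteq> ball z r"
    proof
      fix y assume "y \<in> ball x (?s k)"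
      then show "y \<in> ball z r" using z dist_triangle[of z y x] by (simp add: dist_commute)
    qed
    then have "(\<integral>\<^sup>+y\<in>ball x (?s k). f y \<partial>lborel) \<le> (\<integral>\<^sup>+y\<in>ball z r. f y \<partial>lborel)"
      by (intro nn_integral_mono mult_left_mono indicator_leI) auto
    with k show "z \<in> {x. c < (\<integral>\<^sup>+y\<in>ball x r. f y \<partial>lborel)}" by simp
  qed auto
qed

abbreviation norm_maximal :: "('a::euclidean_space \<Rightarrow> 'b::real_normed_vector) \<Rightarrow> 'a \<Rightarrow> ennreal" where
  "norm_maximal g \<equiv> maximal_function (\<lambda>z. ennreal (norm (g z)))"

lemma emeasure_ball_center: 
  "emeasure lborel (ball (x::'a::euclidean_space) r) = emeasure lborel (ball (0::'a) r)"
  by (cases "0 \<le> r") (simp_all add: emeasure_ball ball_empty not_le)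

lemma open_less_maximal_function:
  fixes f :: "'a::euclidean_space \<Rightarrow> ennreal"
  assumes "f \<in> borel_measurable borel"
  shows "open {x. c < maximal_function f x}"
proof -
  have "c < maximal_function f x \<longleftrightarrow>
      (\<exists>r>0. c * emeasure lborel (ball (0::'a) r) < (\<integral>\<^sup>+y\<in>ball x r. f y \<partial>lborel))" for x
    unfolding less_maximal_function_iff emeasure_ball_center[of x] ..
  then have "{x. c < maximal_function f x} =
      (\<Union>r\<in>{0<..}. {x. c * emeasure lborel (ball (0::'a) r) < (\<integral>\<^sup>+y\<in>ball x r. f y \<partial>lborel)})"
    by auto
  then show ?thesis using open_integral_ball_greater[OF assms] by auto
qed

lemma borel_measurable_maximal_function [measurable]:
  fixes f :: "'a::euclidean_space \<Rightarrow> ennreal"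
  assumes "f \<in> borel_measurable borel"
  shows "maximal_function f \<in> borel_measurable borel"
  by (rule borel_measurableI_greater) (simp add: open_less_maximal_function[OF assms])

lemma maximal_function_cong_AE:
  assumes "AE y in lborel. f y = g y"
  shows "maximal_function f = maximal_function g"
proof -
  have "(\<integral>\<^sup>+y\<in>ball x r. f y \<partial>lborel) = (\<integral>\<^sup>+y\<in>ball x r. g y \<partial>lborel)" for x r
    using assms by (intro nn_integral_cong_AE) (auto elim: eventually_mono)
  then show ?thesis unfolding maximal_function_def by auto
qed

lemma maximal_function_le_add_const:
  assumes [measurable]: "g \<in> borel_measurable borel" and le: "\<And>y. f y \<le> g y + c"
  shows "maximal_function f x \<le> maximal_function g x + c"
  unfolding maximal_function_le_iff
proof (intro allI impI)
  fix r :: real assume r: "0 < r"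
  have "(\<integral>\<^sup>+y\<in>ball x r. f y \<partial>lborel) \<le>
      (\<integral>\<^sup>+y. g y * indicator (ball x r) y + c * indicator (ball x r) y \<partial>lborel)"
    using le by (intro nn_integral_mono) (auto split: split_indicator)
  also have "\<dots> = (\<integral>\<^sup>+y\<in>ball x r. g y \<partial>lborel) + c * emeasure lborel (ball x r)"
    by (subst nn_integral_add) (auto simp: nn_integral_cmult_indicator)
  also have "\<dots> \<le> (maximal_function g x + c) * emeasure lborel (ball x r)"
    using integral_ball_le_maximal_function[OF r, of g x] by (simp add: distrib_right add_right_mono)
  finally show "(\<integral>\<^sup>+y\<in>ball x r. f y \<partial>lborel) \<le> (maximal_function g x + c) * emeasure lborel (ball x r)" .
qed

text \<open>
  Every point where the maximal function exceeds \<open>l\<close> is the centre of a ball on which the average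
  exceeds \<open>l\<close>. By Vitali's covering lemma the fivefold enlargements of disjoint balls among these
  cover the set, and \<open>l\<close> times the volume of each ball is less than the integral over it. Only when the
  integral is finite are the radii bounded, as the covering lemma requires.
\<close>

lemma maximal_function_weak_type:
  fixes f :: "'a::euclidean_space \<Rightarrow> ennreal"
  assumes [measurable]: "f \<in> borel_measurable borel" and l: "0 < l"
  shows "ennreal l * emeasure lborel {x. ennreal l < maximal_function f x}
           \<le> 5 ^ DIM('a) * (\<integral>\<^sup>+y. f y \<partial>lborel)"
proof (cases "(\<integral>\<^sup>+y. f y \<partial>lborel) = \<infinity>")
  case True
  then show ?thesis by (simp add: ennreal_mult_eq_top_iff)
next
  case False
  define I where "I = enn2real (\<integral>\<^sup>+y. f y \<partial>lborel)"
  have I: "(\<integral>\<^sup>+y. f y \<partial>lborel) = ennreal I" "0 \<le> I"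
    using False unfolding I_def by (auto simp: less_top)
  define E where "E = {x. ennreal l < maximal_function f x}"
  have [measurable]: "E \<in> sets borel"
    unfolding E_def using open_less_maximal_function by (simp add: borel_open)
  have "\<forall>x\<in>E. \<exists>r>0. ennreal l * emeasure lborel (ball x r) < (\<integral>\<^sup>+y\<in>ball x r. f y \<partial>lborel)"
    unfolding E_def less_maximal_function_iff by auto
  then obtain \<rho> where \<rho>: "\<And>x. x \<in> E \<Longrightarrow> 0 < \<rho> x"
    "\<And>x. x \<in> E \<Longrightarrow> ennreal l * emeasure lborel (ball x (\<rho> x)) < (\<integral>\<^sup>+y\<in>ball x (\<rho> x). f y \<partial>lborel)"
    by metis
  define B where "B = max 1 (I / (l * unit_ball_vol (real DIM('a))))"
  have bound: "\<rho> x \<le> B" if x: "x \<in> E" for x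
  proof (rule ccontr)
    assume "\<not> \<rho> x \<le> B"
    then have B: "1 < \<rho> x" "I / (l * unit_ball_vol (real DIM('a))) < \<rho> x" unfolding B_def by auto
    have "ennreal (l * (unit_ball_vol (real DIM('a)) * \<rho> x ^ DIM('a))) = ennreal l * emeasure lborel (ball x (\<rho> x))"
      using l B by (simp add: emeasure_ball ennreal_mult)
    also have "\<dots> < (\<integral>\<^sup>+y\<in>ball x (\<rho> x). f y \<partial>lborel)" by (rule \<rho>(2)[OF x])
    also have "\<dots> \<le> (\<integral>\<^sup>+y. f y \<partial>lborel)"
      by (intro nn_integral_mono) (auto split: split_indicator)
    finally have "l * (unit_ball_vol (real DIM('a)) * \<rho> x ^ DIM('a)) < I"
      using I l B by (simp add: ennreal_less_iff)
    moreover have "\<rho> x \<le> \<rho> x ^ DIM('a)" using B(1) by (intro self_le_power) auto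
    then have "l * unit_ball_vol (real DIM('a)) * \<rho> x \<le> l * unit_ball_vol (real DIM('a)) * \<rho> x ^ DIM('a)"
      using l by (intro mult_left_mono) auto
    moreover have "I < l * unit_ball_vol (real DIM('a)) * \<rho> x"
      using B(2) l by (simp add: field_simps)
    ultimately show False by (simp add: mult.assoc)
  qed
  have "E \<subseteq> (\<Union>x\<in>E. ball x (\<rho> x))" using \<rho>(1) by force
  then have "\<exists>C. countable C \<and> C \<subseteq> E \<and>
    pairwise (\<lambda>i j. disjnt (ball i (\<rho> i)) (ball j (\<rho> j))) C \<and> E \<subseteq> (\<Union>i\<in>C. ball i (5 * \<rho> i))"
  proof (rule Vitali_covering_lemma_balls[where a="\<lambda>x. x" and B=B])
    show "0 < \<rho> i \<and> \<rho> i \<le> B" if "i \<in> E" for i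
      using that \<rho>(1) bound by simp
  qed (intro exI conjI)
  then obtain C where C: "countable C" "C \<subseteq> E"
    "pairwise (\<lambda>i j. disjnt (ball i (\<rho> i)) (ball j (\<rho> j))) C" "E \<subseteq> (\<Union>i\<in>C. ball i (5 * \<rho> i))"
    by blast
  have disj: "disjoint_family_on (\<lambda>i. ball i (\<rho> i)) C"
    using C(3) unfolding disjoint_family_on_def pairwise_def disjnt_def by blast
  have "emeasure lborel E \<le> emeasure lborel (\<Union>i\<in>C. ball i (5 * \<rho> i))"
    by (rule emeasure_mono) (use C in auto)
  also have "\<dots> = (\<integral>\<^sup>+y. indicator (\<Union>i\<in>C. ball i (5 * \<rho> i)) y \<partial>lborel)"
    by (rule nn_integral_indicator[symmetric]) (use C in auto)
  also have "\<dots> \<le> (\<integral>\<^sup>+y. (\<integral>\<^sup>+i. indicator (ball i (5 * \<rho> i)) y \<partial>count_space C) \<partial>lborel)"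
  proof (rule nn_integral_mono)
    fix y
    have "(1::ennreal) \<le> (\<integral>\<^sup>+i. indicator (ball i (5 * \<rho> i)) y \<partial>count_space C)"
      if "j \<in> C" "y \<in> ball j (5 * \<rho> j)" for j
      using nn_integral_ge_point[OF that(1), of "\<lambda>i. indicator (ball i (5 * \<rho> i)) y"] that(2) by simp
    then show "indicator (\<Union>i\<in>C. ball i (5 * \<rho> i)) y \<le> (\<integral>\<^sup>+i. indicator (ball i (5 * \<rho> i)) y \<partial>count_space C :: ennreal)"
      by (auto split: split_indicator)
  qed
  also have "\<dots> = (\<integral>\<^sup>+i. emeasure lborel (ball i (5 * \<rho> i)) \<partial>count_space C)"
    by (subst nn_integral_count_space_nn_integral[OF C(1)]) auto
  finally have "ennreal l * emeasure lborel E \<le> ennreal l * (\<integral>\<^sup>+i. emeasure lborel (ball i (5 * \<rho> i)) \<partial>count_space C)"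
    by (rule mult_left_mono) simp
  also have "\<dots> = (\<integral>\<^sup>+i. ennreal l * emeasure lborel (ball i (5 * \<rho> i)) \<partial>count_space C)"
    by (rule nn_integral_cmult[symmetric]) simp
  also have "\<dots> \<le> (\<integral>\<^sup>+i. 5 ^ DIM('a) * (\<integral>\<^sup>+y\<in>ball i (\<rho> i). f y \<partial>lborel) \<partial>count_space C)"
  proof (rule nn_integral_mono)
    fix i assume "i \<in> space (count_space C)"
    then have i: "i \<in> E" using C by auto
    have "emeasure lborel (ball i (5 * \<rho> i)) = 5 ^ DIM('a) * emeasure lborel (ball i (\<rho> i))"
      using \<rho>(1)[OF i] by (simp add: emeasure_ball power_mult_distrib ennreal_mult mult_ac flip: ennreal_power)
    then show "ennreal l * emeasure lborel (ball i (5 * \<rho> i)) \<le> 5 ^ DIM('a) * (\<integral>\<^sup>+y\<in>ball i (\<rho> i). f y \<partial>lborel)"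
      using mult_left_mono[OF less_imp_le[OF \<rho>(2)[OF i]], of "5 ^ DIM('a)"] by (simp add: mult_ac)
  qed
  also have "\<dots> = 5 ^ DIM('a) * (\<integral>\<^sup>+i. (\<integral>\<^sup>+y\<in>ball i (\<rho> i). f y \<partial>lborel) \<partial>count_space C)"
    by (rule nn_integral_cmult) simp
  also have "(\<integral>\<^sup>+i. (\<integral>\<^sup>+y\<in>ball i (\<rho> i). f y \<partial>lborel) \<partial>count_space C)
      = (\<integral>\<^sup>+y\<in>(\<Union>i\<in>C. ball i (\<rho> i)). f y \<partial>lborel)"
    using emeasure_UN_countable[of C "\<lambda>i. ball i (\<rho> i)" "density lborel f"] C(1) disj
    by (simp add: emeasure_density borel_open open_UN)
  also have "\<dots> \<le> (\<integral>\<^sup>+y. f y \<partial>lborel)"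
    by (intro nn_integral_mono) (auto split: split_indicator)
  finally show ?thesis unfolding E_def by (simp add: mult_left_mono)
qed

text \<open>
  The layer-cake representation of a power.
\<close>

lemma nn_integral_powr_interval:
  assumes "0 < p" "0 \<le> a"
  shows "(\<integral>\<^sup>+l. (if 0 < l \<and> l < a then ennreal (p * l powr (p - 1)) else 0) \<partial>lborel) = ennreal (a powr p)"
proof -
  have "((\<lambda>x. p * x powr (p - 1)) has_integral p * (a powr (p - 1 + 1) / (p - 1 + 1))) {0..a}"
    by (intro has_integral_mult_right has_integral_powr_from_0) (use assms in auto)
  then have "((\<lambda>x. p * x powr (p - 1)) has_integral a powr p) {0..a}"
    using assms by simp
  then have "((\<lambda>x. if x \<in> {0..a} then p * x powr (p - 1) else 0) has_integral a powr p) UNIV"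
    by (simp only: has_integral_restrict_UNIV)
  then have "(\<integral>\<^sup>+x. ennreal (if x \<in> {0..a} then p * x powr (p - 1) else 0) \<partial>lborel) = ennreal (a powr p)"
    by (intro nn_integral_has_integral_lborel) (use assms in \<open>auto intro: measurable_If\<close>)
  moreover have "(\<integral>\<^sup>+l. (if 0 < l \<and> l < a then ennreal (p * l powr (p - 1)) else 0) \<partial>lborel) =
      (\<integral>\<^sup>+x. ennreal (if x \<in> {0..a} then p * x powr (p - 1) else 0) \<partial>lborel)"
  proof (rule nn_integral_cong_AE)
    show "AE l in lborel. (if 0 < l \<and> l < a then ennreal (p * l powr (p - 1)) else 0) =
        ennreal (if l \<in> {0..a} then p * l powr (p - 1) else 0)"
      using AE_lborel_singleton[of "0::real"] AE_lborel_singleton[of a] by eventually_elim auto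
  qed
  ultimately show ?thesis by simp
qed

text \<open>
  Marcinkiewicz interpolation with the trivial bound for bounded functions. At height \<open>l\<close> the part
  of \<open>f\<close> below \<open>l / 2\<close> contributes at most \<open>l / 2\<close> to the maximal function, so the weak type
  estimate is applied to the part of \<open>f\<close> above \<open>l / 2\<close> only. Integrating over \<open>l\<close> leaves
  \<open>l powr (p - 2)\<close> on \<open>0 < l < 2 * f y\<close>, which is integrable because \<open>p > 1\<close>. The left-hand side is the
  \<open>p\<close>-th power integral of the maximal function written in layers, which makes sense even where
  the maximal function is infinite.
\<close>

lemma maximal_function_strong_type_layers:
  fixes f :: "'a::euclidean_space \<Rightarrow> real"
  assumes [measurable]: "f \<in> borel_measurable borel" and f0: "\<And>x. 0 \<le> f x" and p: "1 < p"
  shows "(\<integral>\<^sup>+x. (\<integral>\<^sup>+l. (if 0 < l \<and> ennreal l < maximal_function (\<lambda>y. ennreal (f y)) x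
              then ennreal (p * l powr (p - 1)) else 0) \<partial>lborel) \<partial>lborel)
       \<le> ennreal (2 powr p * p * 5 ^ DIM('a) / (p - 1)) * (\<integral>\<^sup>+x. ennreal (f x powr p) \<partial>lborel)"
    (is "?lhs \<le> ?rhs")
proof -
  let ?M = "maximal_function (\<lambda>y. ennreal (f y))"
  let ?c = "2 * 5 ^ DIM('a) * p :: real"
  have "?lhs = (\<integral>\<^sup>+l. (\<integral>\<^sup>+x. (if 0 < l \<and> ennreal l < ?M x then ennreal (p * l powr (p - 1)) else 0) \<partial>lborel) \<partial>lborel)"
    by (rule lborel_pair.Fubini') measurable
  also have "\<dots> \<le> (\<integral>\<^sup>+l. (\<integral>\<^sup>+y. (if 0 < l \<and> l < 2 * f y then ennreal (?c * l powr (p - 2) * f y) else 0) \<partial>lborel) \<partial>lborel)"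
  proof (rule nn_integral_mono)
    fix l :: real
    show "(\<integral>\<^sup>+x. (if 0 < l \<and> ennreal l < ?M x then ennreal (p * l powr (p - 1)) else 0) \<partial>lborel) \<le>
        (\<integral>\<^sup>+y. (if 0 < l \<and> l < 2 * f y then ennreal (?c * l powr (p - 2) * f y) else 0) \<partial>lborel)"
    proof (cases "0 < l")
      case True
      define g where "g y = (if l < 2 * f y then ennreal (f y) else 0)" for y
      have [measurable]: "g \<in> borel_measurable borel" unfolding g_def by measurable
      have Mg: "?M x \<le> maximal_function g x + ennreal (l / 2)" for x
        by (rule maximal_function_le_add_const) (auto simp: g_def intro!: ennreal_leI)
      have "{x. ennreal l < ?M x} \<subseteq> {x. ennreal (l / 2) < maximal_function g x}"
      proof
        fix x assume x: "x \<in> {x. ennreal l < ?M x}"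
        have "ennreal l < maximal_function g x + ennreal (l / 2)"
          using x Mg[of x] by auto
        moreover have "ennreal l = ennreal (l / 2) + ennreal (l / 2)"
          using True by (simp flip: ennreal_plus)
        ultimately show "x \<in> {x. ennreal (l / 2) < maximal_function g x}"
          by (metis (no_types, lifting) add_right_mono mem_Collect_eq not_le)
      qed
      then have "emeasure lborel {x. ennreal l < ?M x} \<le> emeasure lborel {x. ennreal (l / 2) < maximal_function g x}"
        by (intro emeasure_mono) measurable
      then have "ennreal (l / 2) * emeasure lborel {x. ennreal l < ?M x} \<le> ennreal (l / 2) * emeasure lborel {x. ennreal (l / 2) < maximal_function g x}"
        by (rule mult_left_mono) simp
      also have "\<dots> \<le> 5 ^ DIM('a) * (\<integral>\<^sup>+y. g y \<partial>lborel)"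
        by (rule maximal_function_weak_type) (use True in auto)
      finally have weak: "ennreal (l / 2) * emeasure lborel {x. ennreal l < ?M x} \<le> 5 ^ DIM('a) * (\<integral>\<^sup>+y. g y \<partial>lborel)" .
      have "(\<integral>\<^sup>+x. (if 0 < l \<and> ennreal l < ?M x then ennreal (p * l powr (p - 1)) else 0) \<partial>lborel)
          = (\<integral>\<^sup>+x. ennreal (p * l powr (p - 1)) * indicator {x. ennreal l < ?M x} x \<partial>lborel)"
        using True by (intro nn_integral_cong) (auto split: split_indicator)
      also have "\<dots> = ennreal (p * l powr (p - 1)) * emeasure lborel {x. ennreal l < ?M x}"
        by (rule nn_integral_cmult_indicator) measurable
      also have "\<dots> = ennreal (2 * p * l powr (p - 2)) * (ennreal (l / 2) * emeasure lborel {x. ennreal l < ?M x})"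
      proof -
        have "p * l powr (p - 1) = (2 * p * l powr (p - 2)) * (l / 2)"
          using True powr_add[of l "p - 2" 1] by simp
        then have "ennreal (p * l powr (p - 1)) = ennreal (2 * p * l powr (p - 2)) * ennreal (l / 2)"
          using True p by (simp only:) (intro ennreal_mult, auto)
        then show ?thesis by (simp only: mult.assoc)
      qed
      also have "\<dots> \<le> ennreal (2 * p * l powr (p - 2)) * (5 ^ DIM('a) * (\<integral>\<^sup>+y. g y \<partial>lborel))"
        by (intro mult_left_mono weak) simp
      also have "\<dots> = ennreal (?c * l powr (p - 2)) * (\<integral>\<^sup>+y. g y \<partial>lborel)"
        using p by (simp add: ennreal_mult mult_ac flip: ennreal_power)
      also have "\<dots> = (\<integral>\<^sup>+y. ennreal (?c * l powr (p - 2)) * g y \<partial>lborel)"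
        by (rule nn_integral_cmult[symmetric]) measurable
      also have "\<dots> = (\<integral>\<^sup>+y. (if 0 < l \<and> l < 2 * f y then ennreal (?c * l powr (p - 2) * f y) else 0) \<partial>lborel)"
        using True p f0 by (intro nn_integral_cong) (auto simp: g_def ennreal_mult)
      finally show ?thesis .
    qed simp
  qed
  also have "\<dots> = (\<integral>\<^sup>+y. (\<integral>\<^sup>+l. (if 0 < l \<and> l < 2 * f y then ennreal (?c * l powr (p - 2) * f y) else 0) \<partial>lborel) \<partial>lborel)"
    by (rule lborel_pair.Fubini') measurable
  also have "\<dots> = (\<integral>\<^sup>+y. ennreal (2 powr p * p * 5 ^ DIM('a) / (p - 1)) * ennreal (f y powr p) \<partial>lborel)"
  proof (rule nn_integral_cong)
    fix y
    have "(\<integral>\<^sup>+l. (if 0 < l \<and> l < 2 * f y then ennreal (?c * l powr (p - 2) * f y) else 0) \<partial>lborel)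
       = (\<integral>\<^sup>+l. ennreal (?c / (p - 1) * f y) * (if 0 < l \<and> l < 2 * f y then ennreal ((p - 1) * l powr (p - 1 - 1)) else 0) \<partial>lborel)"
      using p f0[of y] by (intro nn_integral_cong) (auto simp flip: ennreal_mult)
    also have "\<dots> = ennreal (?c / (p - 1) * f y) * ennreal ((2 * f y) powr (p - 1))"
      using p f0[of y] by (subst nn_integral_cmult) (auto simp: nn_integral_powr_interval)
    also have "\<dots> = ennreal (?c / (p - 1) * f y * (2 * f y) powr (p - 1))"
      using p f0[of y] by (intro ennreal_mult[symmetric]) auto
    also have "\<dots> = ennreal (2 powr p * p * 5 ^ DIM('a) / (p - 1) * (f y powr p))"
      using p f0[of y] by (cases "f y = 0") (auto simp: powr_mult powr_diff)
    also have "\<dots> = ennreal (2 powr p * p * 5 ^ DIM('a) / (p - 1)) * ennreal (f y powr p)"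
      using p by (intro ennreal_mult) auto
    finally show "(\<integral>\<^sup>+l. (if 0 < l \<and> l < 2 * f y then ennreal (?c * l powr (p - 2) * f y) else 0) \<partial>lborel) =
       ennreal (2 powr p * p * 5 ^ DIM('a) / (p - 1)) * ennreal (f y powr p)" .
  qed
  also have "\<dots> = ?rhs"
    by (rule nn_integral_cmult) measurable
  finally show ?thesis .
qed

theorem maximal_function_strong_type:
  fixes f :: "'a::euclidean_space \<Rightarrow> real"
  assumes [measurable]: "f \<in> borel_measurable borel" and f0: "\<And>x. 0 \<le> f x" and p: "1 < p"
    and fin: "(\<integral>\<^sup>+x. ennreal (f x powr p) \<partial>lborel) < \<infinity>"
  defines "M \<equiv> maximal_function (\<lambda>y. ennreal (f y))"
  shows "AE x in lborel. M x < \<infinity>"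
    and "(\<integral>\<^sup>+x. ennreal (enn2real (M x) powr p) \<partial>lborel)
       \<le> ennreal (2 powr p * p * 5 ^ DIM('a) / (p - 1)) * (\<integral>\<^sup>+x. ennreal (f x powr p) \<partial>lborel)"
proof -
  define J where "J x = (\<integral>\<^sup>+l. (if 0 < l \<and> ennreal l < M x then ennreal (p * l powr (p - 1)) else 0) \<partial>lborel)" for x
  have [measurable]: "M \<in> borel_measurable borel" unfolding M_def by measurable
  have [measurable]: "J \<in> borel_measurable borel" unfolding J_def by measurable
  have J_le: "(\<integral>\<^sup>+x. J x \<partial>lborel) \<le> ennreal (2 powr p * p * 5 ^ DIM('a) / (p - 1)) * (\<integral>\<^sup>+x. ennreal (f x powr p) \<partial>lborel)"
    unfolding J_def M_def by (rule maximal_function_strong_type_layers) (use assms in auto)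
  have J_ge: "ennreal (a powr p) \<le> J x" if "0 \<le> a" "ennreal a \<le> M x" for a x
  proof -
    have "ennreal l < M x" if "0 < l" "l < a" for l
      using that \<open>ennreal a \<le> M x\<close> by (metis ennreal_lessI less_le_trans order.strict_trans)
    then show ?thesis
      unfolding J_def nn_integral_powr_interval[OF less_trans[OF zero_less_one p] that(1), symmetric]
      by (intro nn_integral_mono) auto
  qed
  have "(\<integral>\<^sup>+x. J x \<partial>lborel) < \<infinity>"
    using J_le fin by (auto simp: ennreal_mult_less_top intro: le_less_trans)
  then have "AE x in lborel. J x \<noteq> \<infinity>"
    by (intro nn_integral_PInf_AE) auto
  then show "AE x in lborel. M x < \<infinity>"
  proof eventually_elim
    case (elim x)
    show ?case
    proof (rule ccontr)
      assume "\<not> M x < \<infinity>"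
      then have "M x = \<infinity>" by (metis infinity_ennreal_def top.not_eq_extremum)
      then have ge: "ennreal (real k powr p) \<le> J x" for k :: nat
        by (intro J_ge) auto
      have "of_nat k \<le> J x" for k :: nat
      proof (cases "k = 0")
        case False
        then have "real k powr 1 \<le> real k powr p" using p by (intro powr_mono) auto
        then have "ennreal (real k) \<le> ennreal (real k powr p)" by (intro ennreal_leI) simp
        then show ?thesis using ge[of k] unfolding ennreal_of_nat_eq_real_of_nat by (rule order_trans)
      qed simp
      then have "J x = \<infinity>"
        by (metis ennreal_Ex_less_of_nat infinity_ennreal_def not_le top.not_eq_extremum)
      with elim show False by simp
    qed
  qed
  have "(\<integral>\<^sup>+x. ennreal (enn2real (M x) powr p) \<partial>lborel) \<le> (\<integral>\<^sup>+x. J x \<partial>lborel)"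
    by (intro nn_integral_mono J_ge) (auto simp: ennreal_enn2real_if)
  with J_le show "(\<integral>\<^sup>+x. ennreal (enn2real (M x) powr p) \<partial>lborel)
       \<le> ennreal (2 powr p * p * 5 ^ DIM('a) / (p - 1)) * (\<integral>\<^sup>+x. ennreal (f x powr p) \<partial>lborel)"
    by (rule order_trans[rotated])
qed

section \<open>Lebesgue points\<close>

text \<open>
  A Vitali argument. Choose an open set \<open>U\<close> around \<open>E\<close> that exceeds \<open>E\<close> only slightly in the
  measure with density \<open>g\<close>. Disjoint balls inside \<open>U\<close> on which the average of \<open>g\<close> exceeds \<open>b\<close> cover
  almost all of \<open>E\<close>, so \<open>b |E|\<close> is at most the integral of \<open>g\<close> over \<open>U\<close>, hence up to an arbitrarily
  small error at most its integral over \<open>E\<close>, which is at most \<open>a |E|\<close>. As \<open>a < b\<close>, \<open>|E| = 0\<close>.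
\<close>

lemma null_set_of_large_averages:
  fixes g :: "'a::euclidean_space \<Rightarrow> ennreal" and a b :: real
  assumes [measurable]: "g \<in> borel_measurable borel"
    and fin: "(\<integral>\<^sup>+y\<in>ball 0 k. g y \<partial>lborel) < \<infinity>"
    and ab: "0 \<le> a" "a < b"
  defines "E \<equiv> {x \<in> ball 0 k. g x \<le> ennreal a \<and>
      (\<forall>m::nat. \<exists>r. 0 < r \<and> r < 1 / Suc m \<and>
         ennreal b * emeasure lborel (ball x r) < (\<integral>\<^sup>+y\<in>ball x r. g y \<partial>lborel))}"
  shows "E \<in> null_sets lborel"
proof -
  have "{x. \<exists>r. 0 < r \<and> r < 1 / Suc m \<and> ennreal b * emeasure lborel (ball x r) < (\<integral>\<^sup>+y\<in>ball x r. g y \<partial>lborel)}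
      = (\<Union>r\<in>{0<..<1 / Suc m}. {x. ennreal b * emeasure lborel (ball (0::'a) r) < (\<integral>\<^sup>+y\<in>ball x r. g y \<partial>lborel)})" for m :: nat
    by (subst emeasure_ball_center) auto
  then have "open {x. \<exists>r. 0 < r \<and> r < 1 / Suc m \<and> ennreal b * emeasure lborel (ball x r) < (\<integral>\<^sup>+y\<in>ball x r. g y \<partial>lborel)}" for m :: nat
    using open_integral_ball_greater[of g] by auto
  then have [measurable]: "Measurable.pred borel (\<lambda>x. \<exists>r. 0 < r \<and> r < 1 / Suc m \<and> ennreal b * emeasure lborel (ball x r) < (\<integral>\<^sup>+y\<in>ball x r. g y \<partial>lborel))" for m :: nat
    by (simp add: pred_def borel_open)
  have E [measurable]: "E \<in> sets borel"
    unfolding E_def by measurable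
  have E_sub: "E \<subseteq> ball 0 k" unfolding E_def by auto
  have "emeasure lborel E \<le> emeasure lborel (ball (0::'a) k)"
    using E_sub by (intro emeasure_mono) auto
  also have "\<dots> < \<infinity>"
    using emeasure_bounded_finite[of "ball (0::'a) k"] by simp
  finally have E_fin: "emeasure lborel E < \<infinity>" .
  define N where "N = density lborel (\<lambda>y. g y * indicator (ball 0 k) y)"
  have N: "emeasure N A = (\<integral>\<^sup>+y\<in>A. g y * indicator (ball 0 k) y \<partial>lborel)" if "A \<in> sets borel" for A
    unfolding N_def using that by (subst emeasure_density) auto
  have N_sub: "emeasure N A = (\<integral>\<^sup>+y\<in>A. g y \<partial>lborel)" if "A \<in> sets borel" "A \<subseteq> ball 0 k" for A
    unfolding N[OF that(1)] using that(2) by (intro nn_integral_cong) (auto split: split_indicator)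
  have N_E: "emeasure N E \<le> ennreal a * emeasure lborel E"
  proof -
    have "emeasure N E \<le> (\<integral>\<^sup>+y. ennreal a * indicator E y \<partial>lborel)"
      unfolding N_sub[OF E E_sub] by (intro nn_integral_mono) (auto simp: E_def split: split_indicator)
    then show ?thesis by (simp add: nn_integral_cmult_indicator)
  qed
  have le: "ennreal b * emeasure lborel E \<le> ennreal a * emeasure lborel E + ennreal e" if e: "0 < e" for e
  proof -
    have "emeasure N E = (INF U\<in>{U. E \<subseteq> U \<and> open U}. emeasure N U)"
    proof (rule outer_regular)
      show "sets N = sets borel" by (simp add: N_def)
      show "emeasure N (space N) \<noteq> \<infinity>" using fin N[of UNIV] by (simp add: N_def)
    qed (rule E)
    moreover have "emeasure N E < emeasure N E + ennreal e"
    proof -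
      have "emeasure N E < \<infinity>"
        using N_E E_fin by (auto intro: le_less_trans simp: ennreal_mult_less_top)
      then show ?thesis
        using e by (cases "emeasure N E") (auto simp: ennreal_less_iff simp flip: ennreal_plus)
    qed
    ultimately obtain U where U: "E \<subseteq> U" "open U" "emeasure N U < emeasure N E + ennreal e"
      by (auto simp: INF_less_iff)
    define K where "K = {(x, r). x \<in> E \<and> 0 < r \<and> ball x r \<subseteq> U \<inter> ball 0 k \<and>
        ennreal b * emeasure lborel (ball x r) < (\<integral>\<^sup>+y\<in>ball x r. g y \<partial>lborel)}"
    have "\<exists>C. countable C \<and> C \<subseteq> K \<and>
       pairwise (\<lambda>i j. disjnt (ball (fst i) (snd i)) (ball (fst j) (snd j))) C \<and>
       negligible (E - (\<Union>i\<in>C. ball (fst i) (snd i)))"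
    proof (rule Vitali_covering_theorem_balls[where S=E and K=K and a=fst and r=snd])
      fix x and d :: real assume x: "x \<in> E" and d: "0 < d"
      have "open (U \<inter> ball 0 k)" using U(2) by auto
      moreover have "x \<in> U \<inter> ball 0 k" using x U(1) E_sub by auto
      ultimately obtain d' where d': "0 < d'" "ball x d' \<subseteq> U \<inter> ball 0 k"
        by (rule openE)
      obtain m where m: "1 / Suc m < min d d'" using d d'(1) nat_approx_posE[of "min d d'"] by auto
      have "\<exists>r. 0 < r \<and> r < 1 / Suc m \<and> ennreal b * emeasure lborel (ball x r) < (\<integral>\<^sup>+y\<in>ball x r. g y \<partial>lborel)"
        using x unfolding E_def by blast
      then obtain r where r: "0 < r" "r < 1 / Suc m" "ennreal b * emeasure lborel (ball x r) < (\<integral>\<^sup>+y\<in>ball x r. g y \<partial>lborel)"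
        by blast
      have "ball x r \<subseteq> ball x d'" using r m by (intro subset_ball) auto
      then have "(x, r) \<in> K" unfolding K_def using x r d' by auto
      then show "\<exists>i. i \<in> K \<and> x \<in> ball (fst i) (snd i) \<and> snd i < d"
        using r m by (intro exI[of _ "(x, r)"]) auto
    qed (intro exI conjI)
    then obtain C where C: "countable C" "C \<subseteq> K"
       "pairwise (\<lambda>i j. disjnt (ball (fst i) (snd i)) (ball (fst j) (snd j))) C"
       "negligible (E - (\<Union>i\<in>C. ball (fst i) (snd i)))" by blast
    let ?V = "\<Union>i\<in>C. ball (fst i) (snd i)"
    have [measurable]: "?V \<in> sets borel" by (intro borel_open open_UN) auto
    have disj: "disjoint_family_on (\<lambda>i. ball (fst i) (snd i)) C"
      using C(3) unfolding disjoint_family_on_def pairwise_def disjnt_def by blast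
    have "E - ?V \<in> null_sets lborel"
      using C(4) by (simp add: negligible_iff_null_sets null_sets_completion_iff)
    then have "emeasure lborel (E - ?V) = 0" by auto
    moreover have "emeasure lborel E \<le> emeasure lborel ((E - ?V) \<union> ?V)"
      by (intro emeasure_mono) auto
    moreover have "emeasure lborel ((E - ?V) \<union> ?V) \<le> emeasure lborel (E - ?V) + emeasure lborel ?V"
      by (intro emeasure_subadditive) auto
    ultimately have "emeasure lborel E \<le> emeasure lborel ?V" by (auto intro: order_trans)
    then have "ennreal b * emeasure lborel E \<le> ennreal b * emeasure lborel ?V"
      by (rule mult_left_mono) simp
    also have "\<dots> = ennreal b * (\<integral>\<^sup>+i. emeasure lborel (ball (fst i) (snd i)) \<partial>count_space C)"
      using C(1) disj by (subst emeasure_UN_countable) auto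
    also have "\<dots> = (\<integral>\<^sup>+i. ennreal b * emeasure lborel (ball (fst i) (snd i)) \<partial>count_space C)"
      by (rule nn_integral_cmult[symmetric]) simp
    also have "\<dots> \<le> (\<integral>\<^sup>+i. emeasure N (ball (fst i) (snd i)) \<partial>count_space C)"
    proof (rule nn_integral_mono)
      fix i assume "i \<in> space (count_space C)"
      then have "i \<in> K" using C(2) by auto
      then show "ennreal b * emeasure lborel (ball (fst i) (snd i)) \<le> emeasure N (ball (fst i) (snd i))"
        unfolding K_def by (subst N_sub) (auto intro: less_imp_le)
    qed
    also have "\<dots> = emeasure N ?V"
      using C(1) disj by (subst emeasure_UN_countable) (auto simp: N_def)
    also have "\<dots> \<le> emeasure N U"
    proof (rule emeasure_mono)
      have "ball (fst i) (snd i) \<subseteq> U" if "i \<in> C" for i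
      proof -
        have "i \<in> K" using that C(2) by blast
        then show ?thesis by (simp add: K_def case_prod_beta)
      qed
      then show "?V \<subseteq> U" by blast
    qed (use U(2) in \<open>simp add: N_def borel_open\<close>)
    also have "\<dots> \<le> emeasure N E + ennreal e" using U(3) by simp
    also have "\<dots> \<le> ennreal a * emeasure lborel E + ennreal e" using N_E by (rule add_right_mono)
    finally show ?thesis .
  qed
  define m where "m = enn2real (emeasure lborel E)"
  have m: "emeasure lborel E = ennreal m" "0 \<le> m" using E_fin unfolding m_def by auto
  have "b * m \<le> a * m + e" if "0 < e" for e
    using le[OF that] ab m that by (simp add: ennreal_le_iff flip: ennreal_mult ennreal_plus)
  then have "b * m \<le> a * m" by (rule field_le_epsilon)
  then have "m = 0" using ab m(2) by (metis mult_le_cancel_right not_le order_antisym)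
  then show ?thesis using m E by (auto simp: null_sets_def)
qed

text \<open>
  If the averages at \<open>x\<close> exceeded some \<open>c > g x\<close> at arbitrarily small radii, then \<open>x\<close> would lie in
  one of the countably many null sets above that belong to rational \<open>a < b\<close> between \<open>g x\<close> and
  \<open>c\<close>.
\<close>

lemma AE_limsup_average_le:
  fixes g :: "'a::euclidean_space \<Rightarrow> ennreal"
  assumes [measurable]: "g \<in> borel_measurable borel"
    and fin: "\<And>k. (\<integral>\<^sup>+y\<in>ball 0 k. g y \<partial>lborel) < \<infinity>"
  shows "AE x in lborel. \<forall>c>g x. \<exists>d>0. \<forall>r. 0 < r \<and> r < d \<longrightarrow>
           (\<integral>\<^sup>+y\<in>ball x r. g y \<partial>lborel) \<le> c * emeasure lborel (ball x r)"
proof -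
  let ?E = "\<lambda>(a::rat) (b::rat) (k::nat). {x \<in> ball 0 (real k). g x \<le> ennreal (real_of_rat a) \<and>
      (\<forall>m::nat. \<exists>r. 0 < r \<and> r < 1 / Suc m \<and>
         ennreal (real_of_rat b) * emeasure lborel (ball x r) < (\<integral>\<^sup>+y\<in>ball x r. g y \<partial>lborel))}"
  have "AE x in lborel. \<forall>a b k. 0 \<le> a \<and> a < b \<longrightarrow> x \<notin> ?E a b k"
  proof (unfold AE_all_countable, intro allI)
    fix a b k
    show "AE x in lborel. 0 \<le> a \<and> a < b \<longrightarrow> x \<notin> ?E a b k"
    proof (cases "0 \<le> a \<and> a < b")
      case True
      then have "?E a b k \<in> null_sets lborel"
        by (intro null_set_of_large_averages fin) (auto simp: of_rat_less)
      then have "AE x in lborel. x \<notin> ?E a b k" by (rule AE_not_in)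
      then show ?thesis by eventually_elim simp
    next
      case False
      then show ?thesis by (intro AE_I2) blast
    qed
  qed
  then show ?thesis
  proof eventually_elim
    case (elim x)
    show ?case
    proof (intro allI impI)
      fix c assume "g x < c"
      then obtain b :: rat where b: "g x < ennreal (real_of_rat b)" "ennreal (real_of_rat b) < c"
        using ennreal_rat_dense by blast
      then obtain a :: rat where a: "g x < ennreal (real_of_rat a)" "ennreal (real_of_rat a) < ennreal (real_of_rat b)"
        using ennreal_rat_dense by blast
      have "0 < real_of_rat a" using a(1) by (metis ennreal_neg leD linorder_not_less zero_le)
      moreover have "real_of_rat a < real_of_rat b" using a(2) by (metis ennreal_leI not_le)
      ultimately have ab: "0 \<le> a \<and> a < b" by (simp add: of_rat_less less_imp_le)
      obtain k :: nat where "norm x < real k" using reals_Archimedean2 by blast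
      then have k: "x \<in> ball 0 (real k)" by simp
      have "x \<notin> ?E a b k" using elim ab by blast
      then obtain m :: nat where m: "\<not> (\<exists>r. 0 < r \<and> r < 1 / Suc m \<and>
         ennreal (real_of_rat b) * emeasure lborel (ball x r) < (\<integral>\<^sup>+y\<in>ball x r. g y \<partial>lborel))"
        using k less_imp_le[OF a(1)] by blast
      show "\<exists>d>0. \<forall>r. 0 < r \<and> r < d \<longrightarrow> (\<integral>\<^sup>+y\<in>ball x r. g y \<partial>lborel) \<le> c * emeasure lborel (ball x r)"
      proof (intro exI[of _ "1 / Suc m"] conjI allI impI)
        fix r :: real assume "0 < r \<and> r < 1 / Suc m"
        then have "(\<integral>\<^sup>+y\<in>ball x r. g y \<partial>lborel) \<le> ennreal (real_of_rat b) * emeasure lborel (ball x r)"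
          using m by (metis not_le)
        also have "\<dots> \<le> c * emeasure lborel (ball x r)"
          using b(2) by (intro mult_right_mono) auto
        finally show "(\<integral>\<^sup>+y\<in>ball x r. g y \<partial>lborel) \<le> c * emeasure lborel (ball x r)" .
      qed simp
    qed
  qed
qed

text \<open>
  The previous lemma is applied to \<open>|f - q|\<close> for all rational \<open>q\<close> at once; at a given point \<open>q\<close> is then
  chosen close to the value of \<open>f\<close>.
\<close>

theorem AE_Lebesgue_point:
  fixes f :: "'a::euclidean_space \<Rightarrow> real"
  assumes [measurable]: "f \<in> borel_measurable borel"
    and fin: "\<And>k. (\<integral>\<^sup>+y\<in>ball 0 k. ennreal \<bar>f y\<bar> \<partial>lborel) < \<infinity>"
  shows "AE x in lborel. \<forall>e>0. \<exists>d>0. \<forall>r. 0 < r \<and> r < d \<longrightarrow>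
           (\<integral>\<^sup>+y\<in>ball x r. ennreal \<bar>f y - f x\<bar> \<partial>lborel) \<le> ennreal e * emeasure lborel (ball x r)"
proof -
  have shift_fin: "(\<integral>\<^sup>+y\<in>ball 0 k. ennreal \<bar>f y - c\<bar> \<partial>lborel) < \<infinity>" for c k
  proof -
    have "(\<integral>\<^sup>+y\<in>ball 0 k. ennreal \<bar>f y - c\<bar> \<partial>lborel) \<le>
        (\<integral>\<^sup>+y. ennreal \<bar>f y\<bar> * indicator (ball 0 k) y + ennreal \<bar>c\<bar> * indicator (ball 0 k) y \<partial>lborel)"
      by (intro nn_integral_mono) (auto split: split_indicator simp flip: ennreal_plus intro!: ennreal_leI)
    also have "\<dots> = (\<integral>\<^sup>+y\<in>ball 0 k. ennreal \<bar>f y\<bar> \<partial>lborel) + ennreal \<bar>c\<bar> * emeasure lborel (ball (0::'a) k)"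
      by (subst nn_integral_add) (auto simp: nn_integral_cmult_indicator)
    also have "\<dots> < \<infinity>"
      using fin[of k] emeasure_bounded_finite[of "ball (0::'a) k"] by (simp add: ennreal_mult_less_top)
    finally show ?thesis .
  qed
  have "AE x in lborel. \<forall>q::rat. \<forall>c>ennreal \<bar>f x - of_rat q\<bar>. \<exists>d>0. \<forall>r. 0 < r \<and> r < d \<longrightarrow>
           (\<integral>\<^sup>+y\<in>ball x r. ennreal \<bar>f y - of_rat q\<bar> \<partial>lborel) \<le> c * emeasure lborel (ball x r)"
    unfolding AE_all_countable by (intro allI AE_limsup_average_le shift_fin) measurable
  then show ?thesis
  proof eventually_elim
    case (elim x)
    show ?case
    proof (intro allI impI)
      fix e :: real assume e: "0 < e"
      then obtain q :: rat where q: "f x - e / 2 < of_rat q" "of_rat q < f x"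
        using of_rat_dense[of "f x - e / 2" "f x"] by auto
      have "ennreal \<bar>f x - of_rat q\<bar> < ennreal (e / 2)" using q e by (intro ennreal_lessI) auto
      then obtain d where d: "0 < d" "\<And>r. 0 < r \<and> r < d \<Longrightarrow>
           (\<integral>\<^sup>+y\<in>ball x r. ennreal \<bar>f y - of_rat q\<bar> \<partial>lborel) \<le> ennreal (e / 2) * emeasure lborel (ball x r)"
        using elim by blast
      show "\<exists>d>0. \<forall>r. 0 < r \<and> r < d \<longrightarrow>
           (\<integral>\<^sup>+y\<in>ball x r. ennreal \<bar>f y - f x\<bar> \<partial>lborel) \<le> ennreal e * emeasure lborel (ball x r)"
      proof (intro exI[of _ d] conjI allI impI)
        fix r :: real assume r: "0 < r \<and> r < d"
        have "(\<integral>\<^sup>+y\<in>ball x r. ennreal \<bar>f y - f x\<bar> \<partial>lborel) \<le>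
          (\<integral>\<^sup>+y. ennreal \<bar>f y - of_rat q\<bar> * indicator (ball x r) y + ennreal (e / 2) * indicator (ball x r) y \<partial>lborel)"
          using q e by (intro nn_integral_mono) (auto split: split_indicator simp flip: ennreal_plus intro!: ennreal_leI)
        also have "\<dots> = (\<integral>\<^sup>+y\<in>ball x r. ennreal \<bar>f y - of_rat q\<bar> \<partial>lborel) + ennreal (e / 2) * emeasure lborel (ball x r)"
          by (subst nn_integral_add) (auto simp: nn_integral_cmult_indicator)
        also have "\<dots> \<le> ennreal (e / 2) * emeasure lborel (ball x r) + ennreal (e / 2) * emeasure lborel (ball x r)"
          by (intro add_right_mono d(2)[OF r])
        also have "\<dots> = ennreal e * emeasure lborel (ball x r)"
          using e by (simp flip: distrib_right ennreal_plus)
        finally show "(\<integral>\<^sup>+y\<in>ball x r. ennreal \<bar>f y - f x\<bar> \<partial>lborel) \<le> ennreal e * emeasure lborel (ball x r)" .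
      qed (rule d(1))
    qed
  qed
qed

section \<open>Smooth bump functions and their dilations\<close>

text \<open>
  The exponent \<open>m\<close> is needed because the family \<open>bump m\<close> is closed under differentiation up to
  linear combinations; this is how smoothness to all orders is proved.
\<close>

definition bump :: "nat \<Rightarrow> real \<Rightarrow> real" where
  "bump m s = (if s \<le> 0 then 0 else exp (- inverse s) * inverse s ^ m)"

lemma bump_nonneg: "0 \<le> bump m s"
  by (simp add: bump_def)

lemma bump_eq_0_iff: "bump m s = 0 \<longleftrightarrow> s \<le> 0"
  by (simp add: bump_def)

lemma bump_Suc: "bump m s = s * bump (Suc m) s"
  by (simp add: bump_def)

text \<open>
  A single term of the exponential series at \<open>inverse s\<close> dominates the power.
\<close>

lemma bump_le_fact: "bump m s \<le> fact m"
proof (cases "s \<le> 0")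
  case False
  define y where "y = inverse s"
  have y: "0 < y" using False by (simp add: y_def)
  have "sum (\<lambda>n. y ^ n /\<^sub>R fact n) {m} \<le> (\<Sum>n. y ^ n /\<^sub>R fact n)"
    using y by (intro sum_le_suminf summable_exp_generic) auto
  then have "y ^ m / fact m \<le> exp y"
    by (simp add: exp_def divide_inverse mult.commute)
  then have "exp (- y) * y ^ m \<le> fact m"
    by (simp add: exp_minus field_simps)
  then show ?thesis using False by (simp add: bump_def y_def)
qed (simp add: bump_def)

lemma DERIV_inverse_power:
  assumes "s \<noteq> (0::real)"
  shows "((\<lambda>s. inverse s ^ m) has_real_derivative - (real m * inverse s ^ Suc m)) (at s)"
proof (cases m)
  case (Suc k)
  show ?thesis
    unfolding Suc using DERIV_power_Suc[OF DERIV_inverse'[OF DERIV_ident assms], of k]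
    by (simp add: algebra_simps)
qed simp

text \<open>
  At \<open>s = 0\<close> the difference quotient is \<open>h * bump (m + 2) h\<close>, which tends to \<open>0\<close> because every
  \<open>bump\<close> is bounded.
\<close>

lemma bump_has_real_derivative:
  "(bump m has_real_derivative bump (m + 2) s - m * bump (m + 1) s) (at s)"
proof -
  consider "s < 0" | "s = 0" | "0 < s" by linarith
  then show ?thesis
  proof cases
    case 1
    have "((\<lambda>_. 0) has_real_derivative 0) (at s)" by simp
    then have "(bump m has_real_derivative 0) (at s)"
      by (rule has_field_derivative_transform_within_open[where S="{..<0}"]) (use 1 in \<open>auto simp: bump_def\<close>)
    then show ?thesis using 1 by (simp add: bump_def)
  next
    case 2
    have "((\<lambda>h. bump m h / h) \<longlongrightarrow> 0) (at 0)"
    proof (rule Lim_null_comparison)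
      show "eventually (\<lambda>h. norm (bump m h / h) \<le> fact (m + 2) * \<bar>h\<bar>) (at 0)"
      proof (rule always_eventually, rule allI)
        fix h :: real
        have "bump m h = h * (h * bump (m + 2) h)"
          using bump_Suc[of m h] bump_Suc[of "Suc m" h] by simp
        then have "bump m h / h = h * bump (m + 2) h" by simp
        then show "norm (bump m h / h) \<le> fact (m + 2) * \<bar>h\<bar>"
          using bump_le_fact[of "m + 2" h] bump_nonneg[of "m + 2" h]
          by (simp add: abs_mult mult.commute mult_left_mono)
      qed
      show "((\<lambda>h. fact (m + 2) * \<bar>h\<bar>) \<longlongrightarrow> (0::real)) (at 0)"
        by (auto intro!: tendsto_eq_intros)
    qed
    then show ?thesis using 2 by (simp add: DERIV_def bump_def)
  next
    case 3
    have "((\<lambda>s. exp (- inverse s) * inverse s ^ m) has_real_derivative bump (m + 2) s - m * bump (m + 1) s) (at s)"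
    proof -
      have "((\<lambda>s. exp (- inverse s)) has_real_derivative exp (- inverse s) * inverse s ^ 2) (at s)"
        using 3 by (auto intro!: derivative_eq_intros simp: power2_eq_square)
      from DERIV_mult[OF this DERIV_inverse_power[of s m]] 3
      show ?thesis by (simp add: bump_def power_add power2_eq_square algebra_simps)
    qed
    then show ?thesis
      by (rule has_field_derivative_transform_within_open[where S="{0<..}"]) (use 3 in \<open>auto simp: bump_def\<close>)
  qed
qed

lemma bump_0_has_real_derivative: "(bump 0 has_real_derivative bump 2 s) (at s)"
  using bump_has_real_derivative[of 0 s] by (simp add: numeral_2_eq_2)

lemma borel_measurable_bump [measurable]: "bump m \<in> borel_measurable borel"
  by (intro borel_measurable_continuous_onI continuous_at_imp_continuous_on ballI
      DERIV_isCont[OF bump_has_real_derivative])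

lemma partial_deriv_eq:
  assumes "(\<phi> has_derivative \<phi>') (at x)"
  shows "partial_deriv j \<phi> x = \<phi>' (axis j 1)"
  unfolding partial_deriv_def by (simp add: frechet_derivative_at[OF assms, symmetric])

lemma has_derivative_frechet:
  "\<phi> differentiable at x \<Longrightarrow> (\<phi> has_derivative frechet_derivative \<phi> (at x)) (at x)"
  by (simp add: frechet_derivative_works)

lemma C_times_const: "C_times k (\<lambda>x::real^'n::finite. c)"
proof (induction k arbitrary: c)
  case (Suc k)
  have "partial_deriv j (\<lambda>x::real^'n. c) = (\<lambda>x. 0)" for j
    by (rule ext) (rule partial_deriv_eq[OF has_derivative_const])
  with Suc show ?case by simp
qed simp

lemma C_times_coord: "C_times k (\<lambda>x::real^'n::finite. x $ i)"
proof (cases k)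
  case (Suc k')
  have D: "((\<lambda>x::real^'n. x $ i) has_derivative (\<lambda>x. x $ i)) (at x)" for x
    by (rule bounded_linear.has_derivative[OF bounded_linear_vec_nth has_derivative_ident])
  have "partial_deriv j (\<lambda>x::real^'n. x $ i) = (\<lambda>x. axis j 1 $ i)" for j
    by (rule ext) (rule partial_deriv_eq[OF D])
  with Suc D show ?thesis by (auto simp: C_times_const differentiable_def)
qed (auto intro: continuous_intros)

lemma C_times_Suc_D: "C_times (Suc k) f \<Longrightarrow> C_times k f"
proof (induction k arbitrary: f)
  case 0
  then show ?case
    by (auto intro!: continuous_at_imp_continuous_on differentiable_imp_continuous_within)
qed (metis C_times.simps(2))

lemma C_times_add: "C_times k f \<Longrightarrow> C_times k g \<Longrightarrow> C_times k (\<lambda>x. f x + g x)"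
proof (induction k arbitrary: f g)
  case (Suc k)
  then have d: "f differentiable at x" "g differentiable at x" for x by auto
  have "partial_deriv j (\<lambda>x. f x + g x) = (\<lambda>x. partial_deriv j f x + partial_deriv j g x)" for j
    by (rule ext, subst partial_deriv_eq[OF has_derivative_add[OF has_derivative_frechet has_derivative_frechet]])
      (simp_all add: d partial_deriv_def)
  with Suc d show ?case by auto
qed (auto intro: continuous_intros)

lemma C_times_mult: "C_times k f \<Longrightarrow> C_times k g \<Longrightarrow> C_times k (\<lambda>x. f x * g x)"
proof (induction k arbitrary: f g)
  case (Suc k)
  then have d: "f differentiable at x" "g differentiable at x" for x by auto
  have "partial_deriv j (\<lambda>x. f x * g x) = (\<lambda>x. f x * partial_deriv j g x + partial_deriv j f x * g x)" for j
    by (rule ext, subst partial_deriv_eq[OF has_derivative_mult[OF has_derivative_frechet has_derivative_frechet]])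
      (simp_all add: d partial_deriv_def)
  moreover have "C_times k f" "C_times k g" by (rule C_times_Suc_D, fact)+
  ultimately show ?case using Suc d by (auto intro!: C_times_add Suc.IH)
qed (auto intro: continuous_intros)

lemma C_times_sum: "(\<And>i. i \<in> A \<Longrightarrow> C_times k (f i)) \<Longrightarrow> C_times k (\<lambda>x. \<Sum>i\<in>A. f i x)"
  by (induction A rule: infinite_finite_induct) (auto simp: C_times_const intro!: C_times_add)

text \<open>
  Induction on the order with \<open>m\<close> arbitrary: the derivative of \<open>bump m\<close> is a combination of functions
  of the same family.
\<close>

lemma C_times_bump:
  assumes q: "\<And>k. C_times k q"
  shows "C_times k (\<lambda>x. bump m (q x))"
proof (induction k arbitrary: m)
  case 0
  have "continuous_on UNIV (bump m)"
    by (intro continuous_at_imp_continuous_on ballI DERIV_isCont[OF bump_has_real_derivative])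
  with q[of 0] show ?case by (auto intro: continuous_on_compose2)
next
  case (Suc k)
  have dq: "q differentiable at x" for x using q[of 1] by auto
  have D: "((\<lambda>x. bump m (q x)) has_derivative
      (\<lambda>h. frechet_derivative q (at x) h * (bump (m + 2) (q x) - m * bump (m + 1) (q x)))) (at x)" for x
    using has_derivative_compose[OF has_derivative_frechet[OF dq],
        OF bump_has_real_derivative[unfolded has_field_derivative_def]]
    by (simp add: mult.commute)
  have pd: "partial_deriv j (\<lambda>x. bump m (q x)) =
      (\<lambda>x. partial_deriv j q x * (bump (m + 2) (q x) + (- real m) * bump (m + 1) (q x)))" for j
    by (rule ext, subst partial_deriv_eq[OF D]) (simp add: partial_deriv_def)
  have "C_times k (partial_deriv j q)" for j using q[of "Suc k"] by simp
  then have "C_times k (partial_deriv j (\<lambda>x. bump m (q x)))" for j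
    unfolding pd by (intro C_times_mult C_times_add C_times_const Suc.IH)
  then show ?case using D by (auto simp: differentiable_def)
qed

text \<open>
  With \<open>\<phi>(u) = bump 0 (1 - |u - v|\<^sup>2)\<close> this is the dilation \<open>\<theta>\<^sup>-\<^sup>n \<phi>((z - x) / \<theta>)\<close>. As \<open>\<theta>\<close> decreases
  to \<open>0\<close>, the ball carrying it, of centre \<open>x + \<theta> v\<close> and radius \<open>\<theta>\<close>, shrinks to the point \<open>x\<close>. The shift
  \<open>v\<close>, of norm at most \<open>1\<close>, makes it possible to end at a ball around a different point.
\<close>

definition dilated_bump :: "real \<Rightarrow> real^'n::finite \<Rightarrow> real^'n \<Rightarrow> real^'n \<Rightarrow> real" where
  "dilated_bump \<theta> x v z =
     inverse \<theta> ^ CARD('n) * bump 0 (1 - (norm ((z - x) /\<^sub>R \<theta> - v))\<^sup>2)"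

text \<open>
  The divergence in \<open>z\<close> of the field \<open>((z - x) / \<theta>) * dilated_bump \<theta> x v z\<close>. By
  \<open>dilated_bump_has_real_derivative\<close> it is also the negative derivative of the bump in \<open>\<theta>\<close>: this
  field transports the mass of the bump as \<open>\<theta>\<close> varies.
\<close>

definition dilated_bump_div :: "real \<Rightarrow> real^'n::finite \<Rightarrow> real^'n \<Rightarrow> real^'n \<Rightarrow> real" where
  "dilated_bump_div \<theta> x v z =
     (let u = (z - x) /\<^sub>R \<theta>; s = 1 - (norm (u - v))\<^sup>2
      in inverse \<theta> ^ Suc CARD('n) * (CARD('n) * bump 0 s - 2 * bump 2 s * (u \<bullet> (u - v))))"

lemma C_times_affine_coord: "C_times k (\<lambda>z::real^'n::finite. ((z - x) /\<^sub>R \<theta>) $ j)"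
proof -
  have "C_times k (\<lambda>z::real^'n. inverse \<theta> * (z $ j + - x $ j))"
    by (intro C_times_mult C_times_add C_times_const C_times_coord)
  then show ?thesis by simp
qed

lemma C_times_dilated_bump_arg:
  "C_times k (\<lambda>z::real^'n::finite. 1 - (norm ((z - x) /\<^sub>R \<theta> - v))\<^sup>2)"
proof -
  have "C_times k (\<lambda>z::real^'n. 1 + (- 1) * (\<Sum>i\<in>UNIV. (((z - x) /\<^sub>R \<theta>) $ i + (- v $ i)) * (((z - x) /\<^sub>R \<theta>) $ i + (- v $ i))))"
    by (intro C_times_add C_times_mult C_times_sum C_times_const C_times_affine_coord)
  then show ?thesis by (simp add: power2_norm_eq_inner inner_vec_def)
qed

lemma C_times_dilated_bump: "C_times k (dilated_bump \<theta> x v)"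
  unfolding dilated_bump_def[abs_def]
  by (intro C_times_mult C_times_bump C_times_const C_times_dilated_bump_arg)

text \<open>
  Where the bump does not vanish, \<open>|u| < 2\<close> for \<open>u = (z - x) / \<theta>\<close>, whatever the shift is.
\<close>

lemma dilated_bump_arg_pos:
  assumes "0 < \<theta>" "norm v \<le> 1" "0 < 1 - (norm ((z - x) /\<^sub>R \<theta> - v))\<^sup>2"
  shows "norm ((z - x) /\<^sub>R \<theta> - v) < 1" "norm ((z - x) /\<^sub>R \<theta>) < 2" "z \<in> ball x (2 * \<theta>)"
proof -
  show 1: "norm ((z - x) /\<^sub>R \<theta> - v) < 1"
    using assms(3) by (simp add: power_less_one_iff abs_square_less_1)
  show 2: "norm ((z - x) /\<^sub>R \<theta>) < 2"
    using 1 assms(2) norm_triangle_sub[of "(z - x) /\<^sub>R \<theta>" v] by linarith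
  have "norm ((z - x) /\<^sub>R \<theta>) = norm (z - x) / \<theta>"
    using assms(1) by (simp add: divide_inverse mult.commute)
  with 2 have "norm (z - x) < 2 * \<theta>" using assms(1) by (simp add: pos_divide_less_eq)
  then show "z \<in> ball x (2 * \<theta>)" by (simp add: dist_norm norm_minus_commute)
qed

lemma dilated_bump_outside:
  assumes "0 < \<theta>" "norm v \<le> 1" "z \<notin> ball x (2 * \<theta>)"
  shows "dilated_bump \<theta> x v z = 0" "dilated_bump_div \<theta> x v z = 0"
proof -
  have "1 - (norm ((z - x) /\<^sub>R \<theta> - v))\<^sup>2 \<le> 0"
    using dilated_bump_arg_pos(3)[OF assms(1,2), of z x] assms(3) by linarith
  then show "dilated_bump \<theta> x v z = 0" "dilated_bump_div \<theta> x v z = 0"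
    unfolding dilated_bump_def dilated_bump_div_def Let_def by (simp_all add: bump_def)
qed

lemma dilated_bump_bounds:
  fixes x v z :: "real^'n::finite"
  assumes "0 < \<theta>"
  shows "0 \<le> dilated_bump \<theta> x v z" "dilated_bump \<theta> x v z \<le> inverse \<theta> ^ CARD('n)"
  unfolding dilated_bump_def using bump_le_fact[of 0] bump_nonneg[of 0] assms
  by (auto intro!: mult_nonneg_nonneg mult_left_le)

lemma dilated_bump_div_bound:
  fixes x v z :: "real^'n::finite"
  assumes \<theta>: "0 < \<theta>" and v: "norm v \<le> 1"
  shows "\<bar>dilated_bump_div \<theta> x v z\<bar> \<le> inverse \<theta> ^ Suc CARD('n) * (real CARD('n) + 8)"
proof (cases "z \<in> ball x (2 * \<theta>) \<and> 0 < 1 - (norm ((z - x) /\<^sub>R \<theta> - v))\<^sup>2")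
  case True
  define u where "u = (z - x) /\<^sub>R \<theta>"
  define s where "s = 1 - (norm (u - v))\<^sup>2"
  have uv: "norm (u - v) \<le> 1" "norm u \<le> 2"
    using dilated_bump_arg_pos[OF \<theta> v, of z x] True by (auto simp: u_def less_imp_le)
  have "\<bar>u \<bullet> (u - v)\<bar> \<le> norm u * norm (u - v)" by (rule Cauchy_Schwarz_ineq2)
  also have "\<dots> \<le> 2 * 1" using uv by (intro mult_mono) auto
  finally have 1: "\<bar>u \<bullet> (u - v)\<bar> \<le> 2" by simp
  have b2: "0 \<le> bump 2 s" "bump 2 s \<le> 2" "0 \<le> bump 0 s" "bump 0 s \<le> 1"
    using bump_le_fact[of 2 s] bump_le_fact[of 0 s] by (auto simp: bump_nonneg fact_numeral)
  have "\<bar>bump 2 s * (u \<bullet> (u - v))\<bar> \<le> 2 * 2"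
    unfolding abs_mult using 1 b2 by (intro mult_mono) auto
  moreover have "\<bar>CARD('n) * bump 0 s\<bar> \<le> real CARD('n) * 1"
    unfolding abs_mult using b2 by (intro mult_mono) auto
  ultimately have "\<bar>CARD('n) * bump 0 s - 2 * bump 2 s * (u \<bullet> (u - v))\<bar> \<le> real CARD('n) + 8" by linarith
  then show ?thesis
    unfolding dilated_bump_div_def Let_def u_def[symmetric] s_def[symmetric] abs_mult
    using \<theta> by (simp add: mult_left_mono)
next
  case False
  then have "\<not> 0 < 1 - (norm ((z - x) /\<^sub>R \<theta> - v))\<^sup>2"
    using dilated_bump_arg_pos(3)[OF \<theta> v, of z x] by blast
  then have "bump m (1 - (norm ((z - x) /\<^sub>R \<theta> - v))\<^sup>2) = 0" for m
    by (simp add: bump_eq_0_iff)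
  then show ?thesis using \<theta> unfolding dilated_bump_div_def Let_def by simp
qed

text \<open>
  The components of the transporting field, against which the weak derivative will be tested.
\<close>

lemma test_function_dilated_field:
  assumes "0 < \<theta>" "norm v \<le> 1"
  shows "test_function (\<lambda>z. ((z - x) /\<^sub>R \<theta>) $ j * dilated_bump \<theta> x v z)"
  unfolding test_function_def
proof (intro conjI allI)
  show "C_times k (\<lambda>z. ((z - x) /\<^sub>R \<theta>) $ j * dilated_bump \<theta> x v z)" for k
    by (intro C_times_mult C_times_affine_coord C_times_dilated_bump)
  have "{z. ((z - x) /\<^sub>R \<theta>) $ j * dilated_bump \<theta> x v z \<noteq> 0} \<subseteq> ball x (2 * \<theta>)"
    using dilated_bump_outside(1)[OF assms] by force
  then show "compact (closure {z. ((z - x) /\<^sub>R \<theta>) $ j * dilated_bump \<theta> x v z \<noteq> 0})"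
    unfolding compact_closure by (rule bounded_subset[OF bounded_ball])
qed

lemma has_derivative_dilated_bump:
  fixes x v z :: "real^'n::finite" and \<theta> :: real
  defines "u \<equiv> (z - x) /\<^sub>R \<theta>"
  shows "(dilated_bump \<theta> x v has_derivative (\<lambda>h. inverse \<theta> ^ CARD('n) *
      (bump 2 (1 - (norm (u - v))\<^sup>2) * (- 2 * ((u - v) \<bullet> (h /\<^sub>R \<theta>)))))) (at z)"
proof -
  have "((\<lambda>z. 1 - ((z - x) /\<^sub>R \<theta> - v) \<bullet> ((z - x) /\<^sub>R \<theta> - v)) has_derivative (\<lambda>h. - 2 * ((u - v) \<bullet> (h /\<^sub>R \<theta>)))) (at z)"
    unfolding u_def by (auto intro!: derivative_eq_intros simp: inner_commute algebra_simps)
  then have "((\<lambda>z. 1 - (norm ((z - x) /\<^sub>R \<theta> - v))\<^sup>2) has_derivative (\<lambda>h. - 2 * ((u - v) \<bullet> (h /\<^sub>R \<theta>)))) (at z)"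
    by (simp add: power2_norm_eq_inner)
  from has_derivative_compose[OF this bump_0_has_real_derivative[unfolded has_field_derivative_def]]
  have "((\<lambda>z. bump 0 (1 - (norm ((z - x) /\<^sub>R \<theta> - v))\<^sup>2)) has_derivative
      (\<lambda>h. bump 2 (1 - (norm (u - v))\<^sup>2) * (- 2 * ((u - v) \<bullet> (h /\<^sub>R \<theta>))))) (at z)"
    by (simp add: u_def)
  then show ?thesis
    unfolding dilated_bump_def[abs_def] by (rule has_derivative_mult_right)
qed

lemma partial_deriv_dilated_field:
  fixes x v z :: "real^'n::finite" and \<theta> :: real
  defines "u \<equiv> (z - x) /\<^sub>R \<theta>"
  shows "partial_deriv j (\<lambda>z. ((z - x) /\<^sub>R \<theta>) $ j * dilated_bump \<theta> x v z) z =
     inverse \<theta> * dilated_bump \<theta> x v z + u $ j * (inverse \<theta> ^ CARD('n) *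
      (bump 2 (1 - (norm (u - v))\<^sup>2) * (- 2 * ((u - v) $ j * inverse \<theta>))))"
proof -
  have 1: "((\<lambda>z. ((z - x) /\<^sub>R \<theta>) $ j) has_derivative (\<lambda>h. (h /\<^sub>R \<theta>) $ j)) (at z)"
    by (intro bounded_linear.has_derivative[OF bounded_linear_vec_nth]) (auto intro!: derivative_eq_intros)
  show ?thesis
    unfolding partial_deriv_eq[OF has_derivative_mult[OF 1 has_derivative_dilated_bump]]
    by (simp add: u_def inner_axis)
qed

lemma sum_partial_deriv_dilated_field:
  fixes x v z :: "real^'n::finite"
  assumes "0 < \<theta>"
  shows "(\<Sum>j\<in>UNIV. partial_deriv j (\<lambda>z. ((z - x) /\<^sub>R \<theta>) $ j * dilated_bump \<theta> x v z) z) = dilated_bump_div \<theta> x v z"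
proof -
  define u where "u = (z - x) /\<^sub>R \<theta>"
  define s where "s = 1 - (norm (u - v))\<^sup>2"
  have "(\<Sum>j\<in>UNIV. partial_deriv j (\<lambda>z. ((z - x) /\<^sub>R \<theta>) $ j * dilated_bump \<theta> x v z) z) =
    (\<Sum>j\<in>UNIV. inverse \<theta> * dilated_bump \<theta> x v z - inverse \<theta> ^ Suc CARD('n) * 2 * bump 2 s * (u $ j * (u - v) $ j))"
    unfolding partial_deriv_dilated_field u_def[symmetric] s_def[symmetric]
    by (intro sum.cong) (simp_all add: algebra_simps)
  also have "\<dots> = CARD('n) * (inverse \<theta> * dilated_bump \<theta> x v z) - inverse \<theta> ^ Suc CARD('n) * 2 * bump 2 s * (u \<bullet> (u - v))"
    unfolding sum_subtractf sum_distrib_left[symmetric] by (simp add: inner_vec_def)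
  also have "\<dots> = dilated_bump_div \<theta> x v z"
    unfolding dilated_bump_div_def dilated_bump_def Let_def u_def[symmetric] s_def[symmetric]
    by (simp add: algebra_simps)
  finally show ?thesis .
qed

lemma dilated_bump_has_real_derivative:
  fixes x v z :: "real^'n::finite"
  assumes "0 < \<theta>"
  shows "((\<lambda>\<theta>. dilated_bump \<theta> x v z) has_real_derivative - dilated_bump_div \<theta> x v z) (at \<theta>)"
proof -
  define u where "u = (z - x) /\<^sub>R \<theta>"
  define s where "s = 1 - (norm (u - v))\<^sup>2"
  have "((\<lambda>\<theta>. 1 - ((z - x) /\<^sub>R \<theta> - v) \<bullet> ((z - x) /\<^sub>R \<theta> - v)) has_derivative (\<lambda>h. h * (2 * inverse \<theta> * (u \<bullet> (u - v))))) (at \<theta>)"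
    unfolding u_def using assms
    by (auto intro!: derivative_eq_intros simp: inner_commute algebra_simps)
  then have "((\<lambda>\<theta>. 1 - (norm ((z - x) /\<^sub>R \<theta> - v))\<^sup>2) has_real_derivative 2 * inverse \<theta> * (u \<bullet> (u - v))) (at \<theta>)"
    unfolding power2_norm_eq_inner has_field_derivative_def
    by (rule has_derivative_eq_rhs) (simp add: fun_eq_iff)
  from DERIV_chain2[OF bump_0_has_real_derivative this]
  have 1: "((\<lambda>\<theta>. bump 0 (1 - (norm ((z - x) /\<^sub>R \<theta> - v))\<^sup>2)) has_real_derivative bump 2 s * (2 * inverse \<theta> * (u \<bullet> (u - v)))) (at \<theta>)"
    by (simp add: u_def s_def)
  have 2: "((\<lambda>\<theta>. inverse \<theta> ^ CARD('n)) has_real_derivative - (real CARD('n) * inverse \<theta> ^ Suc CARD('n))) (at \<theta>)"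
    using assms by (intro DERIV_inverse_power) simp
  show ?thesis
    using DERIV_mult[OF 2 1]
    unfolding dilated_bump_div_def dilated_bump_def Let_def u_def[symmetric] s_def[symmetric]
    by (simp add: algebra_simps)
qed

lemma borel_measurable_dilated_bump [measurable]:
  "(\<lambda>w. dilated_bump (f w) x v (g w)) \<in> borel_measurable M"
  "(\<lambda>w. dilated_bump_div (f w) x v (g w)) \<in> borel_measurable M"
  if [measurable]: "f \<in> borel_measurable M" "g \<in> borel_measurable M"
  unfolding dilated_bump_def dilated_bump_div_def Let_def by measurable

section \<open>Weak derivatives and the maximal function\<close>

abbreviation spacetime :: "(real \<times> 'a::euclidean_space) measure" where
  "spacetime \<equiv> lborel \<Otimes>\<^sub>M lborel"

lemma completion_ex_borel_measurable_euclidean: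
  fixes f :: "'a \<Rightarrow> 'b::euclidean_space"
  assumes "f \<in> borel_measurable (completion M)"
  obtains g where "g \<in> borel_measurable M" "AE x in M. f x = g x"
proof -
  have "\<exists>g. g \<in> borel_measurable M \<and> (AE x in M. f x \<bullet> b = g x)" for b
  proof -
    have "(\<lambda>x. f x \<bullet> b) \<in> borel_measurable (completion M)" using assms by measurable
    from completion_ex_borel_measurable_real[OF this] show ?thesis by blast
  qed
  then obtain g where g: "\<And>b. g b \<in> borel_measurable M" "\<And>b. AE x in M. f x \<bullet> b = g b x" by metis
  show ?thesis
  proof
    show "(\<lambda>x. \<Sum>b\<in>Basis. g b x *\<^sub>R b) \<in> borel_measurable M"
      using g(1) by (intro borel_measurable_sum borel_measurable_scaleR) auto
    have "AE x in M. \<forall>b\<in>Basis. f x \<bullet> b = g b x"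
      using g(2) by (intro AE_finite_allI) auto
    then show "AE x in M. f x = (\<Sum>b\<in>Basis. g b x *\<^sub>R b)"
    proof eventually_elim
      case (elim x)
      then show ?case by (subst euclidean_representation[symmetric]) (auto intro: sum.cong)
    qed
  qed
qed

lemma borel_measurable_vec_nth' [measurable (raw)]:
  fixes f :: "'a \<Rightarrow> 'b::euclidean_space^'n"
  assumes "f \<in> borel_measurable M"
  shows "(\<lambda>x. f x $ i) \<in> borel_measurable M"
  using assms
  by (rule measurable_compose) (intro borel_measurable_continuous_onI continuous_intros)

lemma abs_integral_le:
  assumes "(\<integral>\<^sup>+x. ennreal \<bar>h x\<bar> \<partial>M) \<le> ennreal c" "0 \<le> c"
  shows "\<bar>LINT x|M. h x\<bar> \<le> c"
proof (cases "integrable M h")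
  case True
  then have "ennreal \<bar>LINT x|M. h x\<bar> \<le> (\<integral>\<^sup>+x. ennreal \<bar>h x\<bar> \<partial>M)"
    using integral_norm_bound_ennreal[of M h] by simp
  also note assms(1)
  finally have "ennreal \<bar>LINT x|M. h x\<bar> \<le> ennreal c" .
  with assms show ?thesis by (simp add: ennreal_le_iff)
qed (use assms in \<open>simp add: not_integrable_integral_eq\<close>)

lemma nn_integral_ball_finite:
  fixes f :: "'a::euclidean_space \<Rightarrow> ennreal"
  assumes "\<And>k. (\<integral>\<^sup>+y\<in>ball 0 k. f y \<partial>lborel) < \<infinity>"
  shows "(\<integral>\<^sup>+y\<in>ball x r. f y \<partial>lborel) < \<infinity>"
proof -
  have "ball x r \<subseteq> ball 0 (norm x + r)"
  proof
    fix y assume "y \<in> ball x r"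
    then show "y \<in> ball 0 (norm x + r)" using norm_triangle_sub[of y x] by (simp add: dist_norm norm_minus_commute)
  qed
  then have "(\<integral>\<^sup>+y\<in>ball x r. f y \<partial>lborel) \<le> (\<integral>\<^sup>+y\<in>ball 0 (norm x + r). f y \<partial>lborel)"
    by (intro nn_integral_mono mult_left_mono indicator_leI) auto
  with assms show ?thesis by (rule le_less_trans[rotated])
qed

lemma integrable_times_bounded_support:
  fixes f h :: "'a::euclidean_space \<Rightarrow> real"
  assumes [measurable]: "f \<in> borel_measurable borel" "h \<in> borel_measurable borel"
    and fin: "(\<integral>\<^sup>+y\<in>ball x r. ennreal \<bar>f y\<bar> \<partial>lborel) < \<infinity>"
    and h: "\<And>y. \<bar>h y\<bar> \<le> B" "\<And>y. y \<notin> ball x r \<Longrightarrow> h y = 0"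
  shows "integrable lborel (\<lambda>y. f y * h y)"
proof (rule integrableI_bounded)
  have "(\<integral>\<^sup>+y. ennreal (norm (f y * h y)) \<partial>lborel) \<le> (\<integral>\<^sup>+y. ennreal B * (ennreal \<bar>f y\<bar> * indicator (ball x r) y) \<partial>lborel)"
  proof (rule nn_integral_mono)
    fix y
    have "\<bar>f y * h y\<bar> \<le> B * \<bar>f y\<bar>"
      using mult_left_mono[OF h(1)[of y], of "\<bar>f y\<bar>"] by (simp add: abs_mult mult.commute)
    moreover have "0 \<le> B" using h(1)[of y] by linarith
    ultimately show "ennreal (norm (f y * h y)) \<le> ennreal B * (ennreal \<bar>f y\<bar> * indicator (ball x r) y)"
      using h(2)[of y] by (auto split: split_indicator simp flip: ennreal_mult intro!: ennreal_leI)
  qed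
  also have "\<dots> = ennreal B * (\<integral>\<^sup>+y\<in>ball x r. ennreal \<bar>f y\<bar> \<partial>lborel)"
    by (rule nn_integral_cmult) measurable
  also have "\<dots> < \<infinity>" using fin by (simp add: ennreal_mult_less_top)
  finally show "(\<integral>\<^sup>+y. ennreal (norm (f y * h y)) \<partial>lborel) < \<infinity>" .
qed measurable

abbreviation bump_mass :: "'n::finite itself \<Rightarrow> real" where
  "bump_mass _ \<equiv> (LINT z|lborel. dilated_bump 1 0 0 (z::real^'n))"

text \<open>
  The substitution \<open>z = (x + \<theta> v) + \<theta> u\<close>; all dilated bumps have the same mass.
\<close>

lemma integral_dilated_bump:
  fixes x v :: "real^'n::finite"
  assumes \<theta>: "0 < \<theta>"
  shows "(LINT z|lborel. dilated_bump \<theta> x v z) = bump_mass TYPE('n)"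
proof -
  let ?T = "\<lambda>u. (x + \<theta> *\<^sub>R v) + \<theta> *\<^sub>R u"
  have "(LINT z|lborel. dilated_bump \<theta> x v z) =
      (LINT z|density (distr lborel borel ?T) (\<lambda>_. ennreal (\<bar>\<theta>\<bar> ^ DIM(real^'n))). dilated_bump \<theta> x v z)"
    using lborel_affine[of \<theta> "x + \<theta> *\<^sub>R v"] \<theta> by (simp add: ennreal_power)
  also have "\<dots> = (LINT z|distr lborel borel ?T. (\<bar>\<theta>\<bar> ^ DIM(real^'n)) *\<^sub>R dilated_bump \<theta> x v z)"
    by (rule integral_density) (auto simp: \<theta>)
  also have "\<dots> = (LINT u|lborel. (\<bar>\<theta>\<bar> ^ DIM(real^'n)) *\<^sub>R dilated_bump \<theta> x v (?T u))"
    by (rule integral_distr) measurable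
  also have "\<dots> = bump_mass TYPE('n)"
  proof (rule Bochner_Integration.integral_cong[OF refl])
    fix u :: "real^'n"
    have "(?T u - x) /\<^sub>R \<theta> - v = u" using \<theta> by (simp add: algebra_simps)
    then show "(\<bar>\<theta>\<bar> ^ DIM(real^'n)) *\<^sub>R dilated_bump \<theta> x v (?T u) = dilated_bump 1 0 0 u"
      unfolding dilated_bump_def using \<theta> by (simp add: power_inverse)
  qed
  finally show ?thesis .
qed

lemma integrable_dilated_bump:
  fixes x v :: "real^'n::finite"
  assumes \<theta>: "0 < \<theta>" and v: "norm v \<le> 1"
  shows "integrable lborel (dilated_bump \<theta> x v)"
proof -
  have "integrable lborel (\<lambda>y. 1 * dilated_bump \<theta> x v y)"
  proof (rule integrable_times_bounded_support)
    show "\<bar>dilated_bump \<theta> x v y\<bar> \<le> inverse \<theta> ^ CARD('n)" for y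
      using dilated_bump_bounds[OF \<theta>, of x v y] by simp
    show "(\<integral>\<^sup>+y\<in>ball x (2 * \<theta>). ennreal \<bar>1\<bar> \<partial>lborel) < \<infinity>"
      using emeasure_bounded_finite[of "ball x (2 * \<theta>)"] by simp
  qed (use dilated_bump_outside[OF assms] in auto)
  then show ?thesis by simp
qed

lemma integral_bump_pos: "0 < bump_mass TYPE('n::finite)" (is "0 < ?I")
proof -
  have "?I \<noteq> 0"
  proof
    assume "?I = 0"
    then have "AE z in lborel. dilated_bump 1 0 0 (z::real^'n) = 0"
      by (subst (asm) integral_nonneg_eq_0_iff_AE) (auto simp: integrable_dilated_bump dilated_bump_bounds)
    then have "AE z in lborel. (z::real^'n) \<notin> ball 0 1"
    proof eventually_elim
      case (elim z)
      then have "1 \<le> (norm z)\<^sup>2" by (simp add: dilated_bump_def bump_eq_0_iff)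
      then have "1 \<le> norm z" by (metis norm_ge_zero one_le_power one_power2 power2_le_imp_le)
      then show ?case by simp
    qed
    then have "emeasure lborel (ball (0::real^'n) 1) = 0"
      by (subst (asm) AE_iff_measurable[where N="ball 0 1"]) auto
    then show False using emeasure_ball_pos_finite(1)[of 1 "0::real^'n"] by simp
  qed
  moreover have "0 \<le> ?I" by (intro integral_nonneg_AE) (auto simp: dilated_bump_bounds)
  ultimately show ?thesis by simp
qed

text \<open>
  A single component of a field with weak derivative, in Borel versions, so that Fubini's theorem
  applies.
\<close>

locale weakly_differentiable =
  fixes f :: "real^'n::finite \<Rightarrow> real" and g :: "real^'n \<Rightarrow> real^'n"
  assumes f_borel [measurable]: "f \<in> borel_measurable borel"
    and g_borel [measurable]: "g \<in> borel_measurable borel"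
    and f_finite: "\<And>k. (\<integral>\<^sup>+y\<in>ball 0 k. ennreal \<bar>f y\<bar> \<partial>lborel) < \<infinity>"
    and g_finite: "\<And>k. (\<integral>\<^sup>+y\<in>ball 0 k. ennreal (norm (g y)) \<partial>lborel) < \<infinity>"
    and weak: "\<And>\<phi> j. test_function \<phi> \<Longrightarrow>
        (LINT y|lborel. f y * partial_deriv j \<phi> y) = - (LINT y|lborel. g y $ j * \<phi> y)"
begin

lemma f_finite_ball: "(\<integral>\<^sup>+y\<in>ball x r. ennreal \<bar>f y\<bar> \<partial>lborel) < \<infinity>"
  by (rule nn_integral_ball_finite) (rule f_finite)

lemma g_finite_ball: "(\<integral>\<^sup>+y\<in>ball x r. ennreal \<bar>g y $ j\<bar> \<partial>lborel) < \<infinity>"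
proof -
  have "(\<integral>\<^sup>+y\<in>ball x r. ennreal \<bar>g y $ j\<bar> \<partial>lborel) \<le> (\<integral>\<^sup>+y\<in>ball x r. ennreal (norm (g y)) \<partial>lborel)"
    by (intro nn_integral_mono mult_right_mono ennreal_leI) (auto simp: component_le_norm_cart)
  also have "\<dots> < \<infinity>" by (rule nn_integral_ball_finite) (rule g_finite)
  finally show ?thesis .
qed

lemma integrable_times_dilated_bump:
  assumes \<theta>: "0 < \<theta>" and v: "norm v \<le> 1"
  shows "integrable lborel (\<lambda>z. f z * dilated_bump \<theta> x v z)"
proof (rule integrable_times_bounded_support)
  show "\<bar>dilated_bump \<theta> x v y\<bar> \<le> inverse \<theta> ^ CARD('n)" for y
    using dilated_bump_bounds[OF \<theta>, of x v y] by simp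
qed (use dilated_bump_outside[OF assms] f_finite_ball in auto)

definition smoothed :: "real^'n \<Rightarrow> real^'n \<Rightarrow> real \<Rightarrow> real" where
  "smoothed x v \<theta> = (LINT z|lborel. f z * dilated_bump \<theta> x v z)"

text \<open>
  The definition of the weak derivative, summed over the components of the transporting field.
\<close>

lemma integral_dilated_bump_div:
  fixes x v :: "real^'n"
  assumes \<theta>: "0 < \<theta>" and v: "norm v \<le> 1"
  shows "(LINT z|lborel. f z * dilated_bump_div \<theta> x v z) =
     - (LINT z|lborel. (g z \<bullet> ((z - x) /\<^sub>R \<theta>)) * dilated_bump \<theta> x v z)"
proof -
  let ?\<Phi> = "\<lambda>j z. ((z - x) /\<^sub>R \<theta>) $ j * dilated_bump \<theta> x v z"
  have int1: "integrable lborel (\<lambda>z. f z * partial_deriv j (?\<Phi> j) z)" for j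
  proof (rule integrable_times_bounded_support)
    have "C_times 0 (partial_deriv j (?\<Phi> j))"
      using test_function_dilated_field[OF assms, of x j] unfolding test_function_def
      by (metis C_times.simps(2))
    then show "partial_deriv j (?\<Phi> j) \<in> borel_measurable borel"
      by (intro borel_measurable_continuous_onI) simp
    show "(\<integral>\<^sup>+y\<in>ball x (2 * \<theta>). ennreal \<bar>f y\<bar> \<partial>lborel) < \<infinity>" by (rule f_finite_ball)
    fix z
    define u where "u = (z - x) /\<^sub>R \<theta>"
    define s where "s = 1 - (norm (u - v))\<^sup>2"
    have eq: "partial_deriv j (?\<Phi> j) z = inverse \<theta> * dilated_bump \<theta> x v z
        + u $ j * (inverse \<theta> ^ CARD('n) * (bump 2 s * (- 2 * ((u - v) $ j * inverse \<theta>))))"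
      unfolding partial_deriv_dilated_field u_def s_def ..
    show "\<bar>partial_deriv j (?\<Phi> j) z\<bar> \<le> inverse \<theta> * inverse \<theta> ^ CARD('n) + 2 * (inverse \<theta> ^ CARD('n) * (2 * (2 * (1 * inverse \<theta>))))"
    proof (cases "0 < s")
      case True
      then have uv: "norm (u - v) < 1" "norm u < 2"
        using dilated_bump_arg_pos[OF assms, of z x] unfolding u_def s_def by auto
      have c: "\<bar>u $ j\<bar> \<le> 2" "\<bar>(u - v) $ j\<bar> \<le> 1"
        using uv component_le_norm_cart[of u j] component_le_norm_cart[of "u - v" j] by linarith+
      have "\<bar>bump 2 s\<bar> \<le> 2" using bump_le_fact[of 2 s] bump_nonneg[of 2 s] by (simp add: fact_numeral)
      then have "\<bar>u $ j * (inverse \<theta> ^ CARD('n) * (bump 2 s * (- 2 * ((u - v) $ j * inverse \<theta>))))\<bar>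
          \<le> 2 * (inverse \<theta> ^ CARD('n) * (2 * (2 * (1 * inverse \<theta>))))"
        unfolding abs_mult using \<theta> c by (intro mult_mono) auto
      moreover have "\<bar>inverse \<theta> * dilated_bump \<theta> x v z\<bar> \<le> inverse \<theta> * inverse \<theta> ^ CARD('n)"
        unfolding abs_mult using \<theta> dilated_bump_bounds[OF \<theta>, of x v z] by (intro mult_mono) auto
      ultimately show ?thesis unfolding eq by (rule order_trans[OF abs_triangle_ineq add_mono, rotated])
    next
      case False
      then have "bump i s = 0" for i by (simp add: bump_def)
      moreover from this have "dilated_bump \<theta> x v z = 0" by (simp add: dilated_bump_def u_def s_def)
      ultimately have "partial_deriv j (?\<Phi> j) z = 0" unfolding eq by simp
      then show ?thesis using \<theta> by (simp only: abs_zero) (simp add: field_simps)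
    qed
    show "partial_deriv j (?\<Phi> j) z = 0" if "z \<notin> ball x (2 * \<theta>)"
    proof -
      have "\<not> 0 < s" using that dilated_bump_arg_pos(3)[OF assms, of z x] unfolding u_def s_def by blast
      then have "bump i s = 0" for i by (simp add: bump_def)
      moreover from this have "dilated_bump \<theta> x v z = 0" by (simp add: dilated_bump_def u_def s_def)
      ultimately show ?thesis unfolding eq by simp
    qed
  qed measurable
  have int2: "integrable lborel (\<lambda>z. g z $ j * ?\<Phi> j z)" for j
  proof (rule integrable_times_bounded_support)
    show "(\<integral>\<^sup>+y\<in>ball x (2 * \<theta>). ennreal \<bar>g y $ j\<bar> \<partial>lborel) < \<infinity>" by (rule g_finite_ball)
    fix z
    show "?\<Phi> j z = 0" if "z \<notin> ball x (2 * \<theta>)"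
      using that by (simp add: dilated_bump_outside[OF assms])
    show "\<bar>?\<Phi> j z\<bar> \<le> 2 * inverse \<theta> ^ CARD('n)"
    proof (cases "0 < 1 - (norm ((z - x) /\<^sub>R \<theta> - v))\<^sup>2")
      case True
      then have "\<bar>((z - x) /\<^sub>R \<theta>) $ j\<bar> \<le> 2"
        using dilated_bump_arg_pos(2)[OF assms, of z x] component_le_norm_cart[of "(z - x) /\<^sub>R \<theta>" j] by linarith
      then show ?thesis
        unfolding abs_mult using dilated_bump_bounds[OF \<theta>, of x v z] by (intro mult_mono) auto
    next
      case False
      then have "dilated_bump \<theta> x v z = 0" by (simp add: dilated_bump_def bump_def)
      then show ?thesis using \<theta> by simp
    qed
  qed measurable
  have "(LINT z|lborel. f z * dilated_bump_div \<theta> x v z) = (LINT z|lborel. (\<Sum>j\<in>UNIV. f z * partial_deriv j (?\<Phi> j) z))"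
    unfolding sum_partial_deriv_dilated_field[OF \<theta>, symmetric] sum_distrib_left ..
  also have "\<dots> = (\<Sum>j\<in>UNIV. (LINT z|lborel. f z * partial_deriv j (?\<Phi> j) z))"
    by (rule Bochner_Integration.integral_sum) (rule int1)
  also have "\<dots> = (\<Sum>j\<in>UNIV. - (LINT z|lborel. g z $ j * ?\<Phi> j z))"
    by (intro sum.cong refl weak test_function_dilated_field assms)
  also have "\<dots> = - (LINT z|lborel. (\<Sum>j\<in>UNIV. g z $ j * ?\<Phi> j z))"
    unfolding sum_negf Bochner_Integration.integral_sum[OF int2] ..
  also have "(\<lambda>z. \<Sum>j\<in>UNIV. g z $ j * ?\<Phi> j z) = (\<lambda>z. (g z \<bullet> ((z - x) /\<^sub>R \<theta>)) * dilated_bump \<theta> x v z)"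
    by (simp add: inner_vec_def sum_distrib_right mult.assoc fun_eq_iff)
  finally show ?thesis .
qed

text \<open>
  On the support of the bump the transporting field is at most \<open>2 \<theta>\<^sup>-\<^sup>n\<close>, and the support lies in the
  ball of radius \<open>2 \<theta>\<close> around \<open>x\<close>: what remains is an average of \<open>|g|\<close>.
\<close>

lemma abs_integral_dilated_bump_div_le:
  fixes x v :: "real^'n"
  assumes \<theta>: "0 < \<theta>" and v: "norm v \<le> 1" and m: "0 \<le> m"
    and M: "norm_maximal g x \<le> ennreal m"
  shows "\<bar>LINT z|lborel. f z * dilated_bump_div \<theta> x v z\<bar> \<le> 2 ^ Suc CARD('n) * unit_ball_vol CARD('n) * m"
proof -
  let ?h = "\<lambda>z. (g z \<bullet> ((z - x) /\<^sub>R \<theta>)) * dilated_bump \<theta> x v z"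
  have "(\<integral>\<^sup>+z. ennreal \<bar>?h z\<bar> \<partial>lborel) \<le>
      (\<integral>\<^sup>+z. ennreal (2 * inverse \<theta> ^ CARD('n)) * (ennreal (norm (g z)) * indicator (ball x (2 * \<theta>)) z) \<partial>lborel)"
  proof (rule nn_integral_mono)
    fix z
    show "ennreal \<bar>?h z\<bar> \<le> ennreal (2 * inverse \<theta> ^ CARD('n)) * (ennreal (norm (g z)) * indicator (ball x (2 * \<theta>)) z)"
    proof (cases "0 < 1 - (norm ((z - x) /\<^sub>R \<theta> - v))\<^sup>2")
      case True
      note arg = dilated_bump_arg_pos[OF \<theta> v True]
      have "\<bar>g z \<bullet> ((z - x) /\<^sub>R \<theta>)\<bar> \<le> norm (g z) * norm ((z - x) /\<^sub>R \<theta>)" by (rule Cauchy_Schwarz_ineq2)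
      also have "\<dots> \<le> norm (g z) * 2" using arg(2) by (intro mult_left_mono) auto
      finally have "\<bar>?h z\<bar> \<le> (norm (g z) * 2) * inverse \<theta> ^ CARD('n)"
        unfolding abs_mult using dilated_bump_bounds[OF \<theta>, of x v z] by (intro mult_mono) auto
      then show ?thesis
        using arg(3) \<theta> by (auto simp: mult_ac simp flip: ennreal_mult intro!: ennreal_leI)
    next
      case False
      then have "dilated_bump \<theta> x v z = 0" by (simp add: dilated_bump_def bump_def)
      then show ?thesis by simp
    qed
  qed
  also have "\<dots> = ennreal (2 * inverse \<theta> ^ CARD('n)) * (\<integral>\<^sup>+z\<in>ball x (2 * \<theta>). ennreal (norm (g z)) \<partial>lborel)"
    by (rule nn_integral_cmult) measurable
  also have "\<dots> \<le> ennreal (2 * inverse \<theta> ^ CARD('n)) * (ennreal m * emeasure lborel (ball x (2 * \<theta>)))"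
    using M \<theta> unfolding maximal_function_le_iff by (intro mult_left_mono) auto
  also have "\<dots> = ennreal (2 * inverse \<theta> ^ CARD('n) * (m * (unit_ball_vol CARD('n) * (2 * \<theta>) ^ CARD('n))))"
    using \<theta> m by (simp add: emeasure_ball ennreal_mult)
  also have "2 * inverse \<theta> ^ CARD('n) * (m * (unit_ball_vol CARD('n) * (2 * \<theta>) ^ CARD('n))) = 2 ^ Suc CARD('n) * unit_ball_vol CARD('n) * m"
    using \<theta> by (simp add: power_mult_distrib power_inverse field_simps)
  finally show ?thesis
    unfolding integral_dilated_bump_div[OF \<theta> v] abs_minus_cancel using m by (intro abs_integral_le) auto
qed

text \<open>
  The difference of two bumps is the integral of their \<open>\<theta>\<close>-derivative, a divergence for each \<open>\<theta>\<close>.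
  Fubini's theorem exchanges the integral over \<open>\<theta>\<close> with the integral against \<open>f\<close>, and the inner
  integral is bounded by the previous lemma, uniformly in \<open>\<theta>\<close>.
\<close>

lemma smoothed_diff:
  fixes x v :: "real^'n"
  assumes \<theta>: "0 < \<theta>1" "\<theta>1 \<le> \<theta>2" and v: "norm v \<le> 1" and m: "0 \<le> m"
    and M: "norm_maximal g x \<le> ennreal m"
  shows "\<bar>smoothed x v \<theta>2 - smoothed x v \<theta>1\<bar> \<le> 2 ^ Suc CARD('n) * unit_ball_vol CARD('n) * m * (\<theta>2 - \<theta>1)"
proof -
  let ?C = "2 ^ Suc CARD('n) * unit_ball_vol CARD('n) * m"
  let ?k = "\<lambda>\<theta> z. indicator {\<theta>1..\<theta>2} \<theta> *\<^sub>R (f z * - dilated_bump_div \<theta> x v z)"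
  define B where "B = inverse \<theta>1 ^ Suc CARD('n) * (real CARD('n) + 8)"
  have pos: "0 < \<theta>" if "\<theta>1 \<le> \<theta>" for \<theta> using that \<theta> by simp
  have B: "\<bar>dilated_bump_div \<theta> x v z\<bar> \<le> B" if "\<theta>1 \<le> \<theta>" for \<theta> z
  proof -
    have "inverse \<theta> \<le> inverse \<theta>1" using that \<theta> by (intro le_imp_inverse_le) auto
    then have "inverse \<theta> ^ Suc CARD('n) \<le> inverse \<theta>1 ^ Suc CARD('n)" using pos[OF that] by (intro power_mono) auto
    then have "inverse \<theta> ^ Suc CARD('n) * (real CARD('n) + 8) \<le> B" unfolding B_def by (intro mult_right_mono) auto
    with dilated_bump_div_bound[OF pos[OF that] v, of x z] show ?thesis by linarith
  qed
  have B0: "0 \<le> B" using \<theta> by (simp add: B_def)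
  \<comment> \<open>The integrand is dominated by \<open>B |f|\<close> on one fixed ball, which justifies Fubini's theorem;
     \<open>\<theta>1 > 0\<close> makes \<open>B\<close> finite.\<close>
  have supp: "dilated_bump_div \<theta> x v z = 0" if "\<theta>1 \<le> \<theta>" "\<theta> \<le> \<theta>2" "z \<notin> ball x (2 * \<theta>2)" for \<theta> z
    using that by (intro dilated_bump_outside(2)[OF pos v]) auto
  have int: "integrable spacetime (case_prod ?k)"
  proof (rule integrableI_bounded)
    show "case_prod ?k \<in> borel_measurable spacetime" by measurable
    have "(\<integral>\<^sup>+p. ennreal (norm (case_prod ?k p)) \<partial>spacetime) =
        (\<integral>\<^sup>+\<theta>. (\<integral>\<^sup>+z. ennreal (norm (?k \<theta> z)) \<partial>lborel) \<partial>lborel)"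
      by (subst lborel.nn_integral_fst[symmetric]) auto
    also have "\<dots> \<le> (\<integral>\<^sup>+\<theta>. (ennreal B * (\<integral>\<^sup>+z\<in>ball x (2 * \<theta>2). ennreal \<bar>f z\<bar> \<partial>lborel)) * indicator {\<theta>1..\<theta>2} \<theta> \<partial>lborel)"
    proof (rule nn_integral_mono)
      fix \<theta>
      show "(\<integral>\<^sup>+z. ennreal (norm (?k \<theta> z)) \<partial>lborel) \<le> (ennreal B * (\<integral>\<^sup>+z\<in>ball x (2 * \<theta>2). ennreal \<bar>f z\<bar> \<partial>lborel)) * indicator {\<theta>1..\<theta>2} \<theta>"
      proof (cases "\<theta> \<in> {\<theta>1..\<theta>2}")
        case True
        have "(\<integral>\<^sup>+z. ennreal (norm (?k \<theta> z)) \<partial>lborel) \<le> (\<integral>\<^sup>+z. ennreal B * (ennreal \<bar>f z\<bar> * indicator (ball x (2 * \<theta>2)) z) \<partial>lborel)"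
        proof (rule nn_integral_mono)
          fix z
          have "\<bar>f z\<bar> * \<bar>dilated_bump_div \<theta> x v z\<bar> \<le> \<bar>f z\<bar> * B" using B[of \<theta> z] True by (intro mult_left_mono) auto
          then show "ennreal (norm (?k \<theta> z)) \<le> ennreal B * (ennreal \<bar>f z\<bar> * indicator (ball x (2 * \<theta>2)) z)"
            using supp[of \<theta> z] True B0
            by (auto simp: abs_mult mult.commute split: split_indicator simp flip: ennreal_mult intro!: ennreal_leI)
        qed
        also have "\<dots> = ennreal B * (\<integral>\<^sup>+z\<in>ball x (2 * \<theta>2). ennreal \<bar>f z\<bar> \<partial>lborel)"
          by (rule nn_integral_cmult) measurable
        finally show ?thesis using True by simp
      qed simp
    qed
    also have "\<dots> = (ennreal B * (\<integral>\<^sup>+z\<in>ball x (2 * \<theta>2). ennreal \<bar>f z\<bar> \<partial>lborel)) * emeasure lborel {\<theta>1..\<theta>2}"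
      by (rule nn_integral_cmult_indicator) simp
    also have "\<dots> < \<infinity>" using f_finite_ball[of x "2 * \<theta>2"] by (simp add: ennreal_mult_less_top \<theta>)
    finally show "(\<integral>\<^sup>+p. ennreal (norm (case_prod ?k p)) \<partial>spacetime) < \<infinity>" .
  qed
  note int_bump = integrable_times_dilated_bump[OF _ v, of _ x]
  have FTC: "(LINT \<theta>|lborel. ?k \<theta> z) = f z * dilated_bump \<theta>2 x v z - f z * dilated_bump \<theta>1 x v z" for z
  proof (rule integral_FTC_atLeastAtMost[OF \<theta>(2),
        where F="\<lambda>\<theta>. f z * dilated_bump \<theta> x v z" and f="\<lambda>\<theta>. f z * - dilated_bump_div \<theta> x v z"])
    fix \<theta> assume "\<theta>1 \<le> \<theta>"
    from DERIV_cmult[OF dilated_bump_has_real_derivative[OF pos[OF this], of x v z], of "f z"]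
    show "((\<lambda>\<theta>. f z * dilated_bump \<theta> x v z) has_vector_derivative f z * - dilated_bump_div \<theta> x v z) (at \<theta> within {\<theta>1..\<theta>2})"
      unfolding has_real_derivative_iff_has_vector_derivative by (rule has_vector_derivative_at_within)
  next
    have cb: "continuous_on UNIV (bump i)" for i
      by (intro continuous_at_imp_continuous_on ballI DERIV_isCont[OF bump_has_real_derivative])
    have cs: "continuous_on {\<theta>1..\<theta>2} (\<lambda>\<theta>. 1 - (norm ((z - x) /\<^sub>R \<theta> - v))\<^sup>2)"
      using \<theta> by (intro continuous_intros) auto
    show "continuous_on {\<theta>1..\<theta>2} (\<lambda>\<theta>. f z * - dilated_bump_div \<theta> x v z)"
      unfolding dilated_bump_div_def Let_def
      using \<theta> by (intro continuous_intros continuous_on_compose2[OF cb cs]) auto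
  qed
  have "smoothed x v \<theta>2 - smoothed x v \<theta>1 = (LINT z|lborel. f z * dilated_bump \<theta>2 x v z - f z * dilated_bump \<theta>1 x v z)"
    unfolding smoothed_def using \<theta> by (intro Bochner_Integration.integral_diff[symmetric] int_bump) auto
  also have "\<dots> = (LINT z|lborel. (LINT \<theta>|lborel. ?k \<theta> z))" unfolding FTC ..
  also have "\<dots> = (LINT \<theta>|lborel. (LINT z|lborel. ?k \<theta> z))"
    by (rule lborel_pair.Fubini_integral[OF int])
  also have "\<bar>\<dots>\<bar> \<le> ?C * (\<theta>2 - \<theta>1)"
  proof (rule abs_integral_le)
    have "(\<integral>\<^sup>+\<theta>. ennreal \<bar>LINT z|lborel. ?k \<theta> z\<bar> \<partial>lborel) \<le> (\<integral>\<^sup>+\<theta>. ennreal ?C * indicator {\<theta>1..\<theta>2} \<theta> \<partial>lborel)"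
    proof (rule nn_integral_mono)
      fix \<theta>
      show "ennreal \<bar>LINT z|lborel. ?k \<theta> z\<bar> \<le> ennreal ?C * indicator {\<theta>1..\<theta>2} \<theta>"
        using abs_integral_dilated_bump_div_le[OF pos v m M, of \<theta>]
        by (auto split: split_indicator intro!: ennreal_leI)
    qed
    also have "\<dots> = ennreal (?C * (\<theta>2 - \<theta>1))"
      using \<theta> m by (simp add: nn_integral_cmult_indicator ennreal_mult)
    finally show "(\<integral>\<^sup>+\<theta>. ennreal \<bar>LINT z|lborel. ?k \<theta> z\<bar> \<partial>lborel) \<le> ennreal (?C * (\<theta>2 - \<theta>1))" .
    show "0 \<le> ?C * (\<theta>2 - \<theta>1)" using \<theta> m by simp
  qed
  finally show ?thesis .
qed

definition Lebesgue_point :: "real^'n \<Rightarrow> bool" where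
  "Lebesgue_point x \<longleftrightarrow> (\<forall>e>0. \<exists>d>0. \<forall>r. 0 < r \<and> r < d \<longrightarrow>
     (\<integral>\<^sup>+y\<in>ball x r. ennreal \<bar>f y - f x\<bar> \<partial>lborel) \<le> ennreal e * emeasure lborel (ball x r))"

text \<open>
  The bump has fixed mass, is at most \<open>\<theta>\<^sup>-\<^sup>n\<close> and lives in the ball of radius \<open>2 \<theta>\<close>, so the
  difference is bounded by an average of \<open>|f - f x|\<close>.
\<close>

lemma smoothed_near:
  assumes x: "Lebesgue_point x" and e: "0 < e"
  obtains d where "0 < d"
    "\<And>v \<theta>. norm v \<le> 1 \<Longrightarrow> 0 < \<theta> \<Longrightarrow> \<theta> < d \<Longrightarrow>
       \<bar>smoothed x v \<theta> - f x * bump_mass TYPE('n)\<bar> \<le> e"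
proof -
  let ?w = "unit_ball_vol CARD('n) * 2 ^ CARD('n)"
  have u: "0 < unit_ball_vol (real CARD('n))" by (simp add: unit_ball_vol_pos)
  then have w: "0 < ?w" by simp
  then have "0 < e / ?w" using e by simp
  then obtain d where d: "0 < d" "\<And>r. 0 < r \<and> r < d \<Longrightarrow>
      (\<integral>\<^sup>+y\<in>ball x r. ennreal \<bar>f y - f x\<bar> \<partial>lborel) \<le> ennreal (e / ?w) * emeasure lborel (ball x r)"
    using x unfolding Lebesgue_point_def by blast
  show ?thesis
  proof
    show "0 < d / 2" using d by simp
    fix v :: "real^'n" and \<theta> :: real assume v: "norm v \<le> 1" and \<theta>: "0 < \<theta>" "\<theta> < d / 2"
    note int_bump = integrable_times_dilated_bump[OF \<theta>(1) v, of x]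
    have "smoothed x v \<theta> - f x * bump_mass TYPE('n) =
        (LINT z|lborel. f z * dilated_bump \<theta> x v z) - (LINT z|lborel. f x * dilated_bump \<theta> x v z)"
      unfolding smoothed_def integral_dilated_bump[OF \<theta>(1), of x v, symmetric] by simp
    also have "\<dots> = (LINT z|lborel. (f z - f x) * dilated_bump \<theta> x v z)"
      using int_bump integrable_dilated_bump[OF \<theta>(1) v, of x]
      by (subst Bochner_Integration.integral_diff[symmetric]) (auto simp: left_diff_distrib)
    also have "\<bar>\<dots>\<bar> \<le> e"
    proof (rule abs_integral_le)
      have "(\<integral>\<^sup>+z. ennreal \<bar>(f z - f x) * dilated_bump \<theta> x v z\<bar> \<partial>lborel) \<le>
          (\<integral>\<^sup>+z. ennreal (inverse \<theta> ^ CARD('n)) * (ennreal \<bar>f z - f x\<bar> * indicator (ball x (2 * \<theta>)) z) \<partial>lborel)"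
      proof (rule nn_integral_mono)
        fix z
        have "\<bar>(f z - f x) * dilated_bump \<theta> x v z\<bar> \<le> inverse \<theta> ^ CARD('n) * \<bar>f z - f x\<bar>"
          using mult_left_mono[OF dilated_bump_bounds(2)[OF \<theta>(1), of x v z], of "\<bar>f z - f x\<bar>"]
            dilated_bump_bounds(1)[OF \<theta>(1), of x v z] by (simp add: abs_mult mult.commute)
        then show "ennreal \<bar>(f z - f x) * dilated_bump \<theta> x v z\<bar> \<le>
            ennreal (inverse \<theta> ^ CARD('n)) * (ennreal \<bar>f z - f x\<bar> * indicator (ball x (2 * \<theta>)) z)"
          using dilated_bump_outside(1)[OF \<theta>(1) v, of z x] \<theta>(1)
          by (auto split: split_indicator simp flip: ennreal_mult intro!: ennreal_leI)
      qed
      also have "\<dots> = ennreal (inverse \<theta> ^ CARD('n)) * (\<integral>\<^sup>+z\<in>ball x (2 * \<theta>). ennreal \<bar>f z - f x\<bar> \<partial>lborel)"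
        by (rule nn_integral_cmult) measurable
      also have "\<dots> \<le> ennreal (inverse \<theta> ^ CARD('n)) * (ennreal (e / ?w) * emeasure lborel (ball x (2 * \<theta>)))"
        using d(2)[of "2 * \<theta>"] \<theta> by (intro mult_left_mono) auto
      also have "emeasure lborel (ball x (2 * \<theta>)) = ennreal (unit_ball_vol CARD('n) * (2 * \<theta>) ^ CARD('n))"
        using \<theta>(1) by (simp add: emeasure_ball)
      also have "ennreal (e / ?w) * ennreal (unit_ball_vol CARD('n) * (2 * \<theta>) ^ CARD('n)) =
          ennreal (e / ?w * (unit_ball_vol CARD('n) * (2 * \<theta>) ^ CARD('n)))"
        using \<theta>(1) e w u by (intro ennreal_mult[symmetric]) auto
      also have "ennreal (inverse \<theta> ^ CARD('n)) * \<dots> =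
          ennreal (inverse \<theta> ^ CARD('n) * (e / ?w * (unit_ball_vol CARD('n) * (2 * \<theta>) ^ CARD('n))))"
        using \<theta>(1) e w u by (intro ennreal_mult[symmetric]) auto
      also have "inverse \<theta> ^ CARD('n) * (e / ?w * (unit_ball_vol CARD('n) * (2 * \<theta>) ^ CARD('n))) = e"
        using \<theta>(1) less_imp_neq[OF u, symmetric] by (simp add: power_mult_distrib power_inverse field_simps)
      finally show "(\<integral>\<^sup>+z. ennreal \<bar>(f z - f x) * dilated_bump \<theta> x v z\<bar> \<partial>lborel) \<le> ennreal e" .
    qed (use e in simp)
    finally show "\<bar>smoothed x v \<theta> - f x * bump_mass TYPE('n)\<bar> \<le> e" .
  qed
qed

lemma smoothed_minus_value:
  assumes x: "Lebesgue_point x" and v: "norm v \<le> 1" and \<rho>: "0 < \<rho>" and m: "0 \<le> m"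
    and M: "norm_maximal g x \<le> ennreal m"
  shows "\<bar>smoothed x v \<rho> - f x * bump_mass TYPE('n)\<bar>
      \<le> 2 ^ Suc CARD('n) * unit_ball_vol CARD('n) * m * \<rho>"
proof (rule field_le_epsilon)
  let ?C = "2 ^ Suc CARD('n) * unit_ball_vol CARD('n) * m"
  fix e :: real assume "0 < e"
  from smoothed_near[OF x this] obtain d where d: "0 < d"
    "\<And>v \<theta>. norm v \<le> 1 \<Longrightarrow> 0 < \<theta> \<Longrightarrow> \<theta> < d \<Longrightarrow>
       \<bar>smoothed x v \<theta> - f x * bump_mass TYPE('n)\<bar> \<le> e" by blast
  define \<theta> where "\<theta> = min (d / 2) \<rho>"
  have \<theta>: "0 < \<theta>" "\<theta> < d" "\<theta> \<le> \<rho>" using d(1) \<rho> by (auto simp: \<theta>_def)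
  have "\<bar>smoothed x v \<rho> - smoothed x v \<theta>\<bar> \<le> ?C * (\<rho> - \<theta>)"
    by (rule smoothed_diff) (use \<theta> v m M in auto)
  also have "\<dots> \<le> ?C * \<rho>" using \<theta> m by (intro mult_left_mono) auto
  finally show "\<bar>smoothed x v \<rho> - f x * bump_mass TYPE('n)\<bar> \<le> ?C * \<rho> + e"
    using d(2)[OF v \<theta>(1,2)] by linarith
qed

text \<open>
  Both points are compared with the same average. With \<open>\<rho> = |x - y|\<close> and \<open>v = (y - x) / \<rho>\<close>, the bump
  started at \<open>x\<close> with shift \<open>v\<close> reaches at \<open>\<theta> = \<rho>\<close> exactly the bump started at \<open>y\<close> with shift
  \<open>0\<close>.
\<close>

lemma pointwise_difference:
  assumes x: "Lebesgue_point x" and y: "Lebesgue_point y" and m: "0 \<le> m" "0 \<le> m'"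
    and Mx: "norm_maximal g x \<le> ennreal m"
    and My: "norm_maximal g y \<le> ennreal m'"
  shows "\<bar>f x - f y\<bar> \<le> 2 ^ Suc CARD('n) * unit_ball_vol CARD('n) / bump_mass TYPE('n)
      * norm (x - y) * (m + m')"
proof (cases "x = y")
  case False
  let ?I = "bump_mass TYPE('n)" and ?C = "2 ^ Suc CARD('n) * unit_ball_vol CARD('n) :: real"
  define \<rho> where "\<rho> = norm (x - y)"
  have \<rho>: "0 < \<rho>" using False by (simp add: \<rho>_def)
  define v where "v = (y - x) /\<^sub>R \<rho>"
  have v: "norm v \<le> 1" using \<rho> by (simp add: v_def \<rho>_def norm_minus_commute)
  have "dilated_bump \<rho> x v = dilated_bump \<rho> y 0"
    by (simp add: dilated_bump_def v_def fun_eq_iff flip: scaleR_diff_right)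
  then have "smoothed x v \<rho> = smoothed y 0 \<rho>" by (simp add: smoothed_def)
  then have "\<bar>f x * ?I - f y * ?I\<bar> \<le> ?C * m * \<rho> + ?C * m' * \<rho>"
    using smoothed_minus_value[OF x v \<rho> m(1) Mx] smoothed_minus_value[OF y _ \<rho> m(2) My, of 0] by simp
  moreover have "f x * ?I - f y * ?I = (f x - f y) * ?I" by (simp add: left_diff_distrib)
  ultimately have "\<bar>f x - f y\<bar> * ?I \<le> ?C * \<rho> * (m + m')"
    using integral_bump_pos[where 'n='n] by (simp only: abs_mult abs_of_pos) (simp add: algebra_simps)
  then show ?thesis
    using integral_bump_pos[where 'n='n] unfolding \<rho>_def by (simp add: field_simps)
qed (use integral_bump_pos[where 'n='n] m in simp)

lemma AE_Lebesgue_point_f: "AE x in lborel. Lebesgue_point x"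
  unfolding Lebesgue_point_def by (rule AE_Lebesgue_point[OF f_borel f_finite])

end

lemma locally_integrable_on_UNIV_D:
  fixes f :: "'a::euclidean_space \<Rightarrow> 'b::euclidean_space"
  assumes "locally_integrable_on f UNIV"
  shows "f \<in> borel_measurable lebesgue"
    and "(\<integral>\<^sup>+y\<in>ball 0 k. ennreal (norm (f y)) \<partial>lborel) < \<infinity>"
proof -
  have int: "integrable lebesgue (\<lambda>x. indicator (cball 0 k) x *\<^sub>R f x)" for k
  proof -
    have "f absolutely_integrable_on cball 0 k"
      using assms by (simp add: locally_integrable_on_def)
    then show ?thesis by (simp add: set_integrable_def)
  qed
  show "f \<in> borel_measurable lebesgue"
  proof (rule borel_measurable_LIMSEQ_metric)
    show "(\<lambda>x. indicator (cball 0 (real i)) x *\<^sub>R f x) \<in> borel_measurable lebesgue" for i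
      using int by (rule borel_measurable_integrable)
    fix x :: 'a
    obtain i0 :: nat where "norm x < real i0" using reals_Archimedean2 by blast
    then have "eventually (\<lambda>i. indicator (cball 0 (real i)) x *\<^sub>R f x = f x) sequentially"
      unfolding eventually_sequentially by (intro exI[of _ i0]) auto
    then show "(\<lambda>i. indicator (cball 0 (real i)) x *\<^sub>R f x) \<longlonglongrightarrow> f x"
      by (rule tendsto_eventually)
  qed
  have "(\<integral>\<^sup>+y\<in>ball 0 k. ennreal (norm (f y)) \<partial>lborel) \<le> (\<integral>\<^sup>+y. ennreal (norm (indicator (cball 0 k) y *\<^sub>R f y)) \<partial>lborel)"
    by (intro nn_integral_mono) (auto split: split_indicator)
  also have "\<dots> = (\<integral>\<^sup>+y. ennreal (norm (indicator (cball 0 k) y *\<^sub>R f y)) \<partial>lebesgue)"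
    by (rule nn_integral_completion[symmetric])
  also have "\<dots> < \<infinity>" using int[of k] by (simp add: integrable_iff_bounded)
  finally show "(\<integral>\<^sup>+y\<in>ball 0 k. ennreal (norm (f y)) \<partial>lborel) < \<infinity>" .
qed

lemma test_function_borel:
  fixes \<phi> :: "real^'n::finite \<Rightarrow> real"
  assumes "test_function \<phi>"
  shows "\<phi> \<in> borel_measurable borel" "partial_deriv j \<phi> \<in> borel_measurable borel"
proof -
  have "C_times 0 \<phi>" "C_times (Suc 0) \<phi>" using assms unfolding test_function_def by blast+
  then have "continuous_on UNIV \<phi>" "continuous_on UNIV (partial_deriv j \<phi>)" by simp_all
  then show "\<phi> \<in> borel_measurable borel" "partial_deriv j \<phi> \<in> borel_measurable borel"
    by (auto dest: borel_measurable_continuous_onI)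
qed

text \<open>
  Changing \<open>f\<close> and \<open>G\<close> on null sets and replacing the completed measure by Borel measure does not
  affect any of the integrals.
\<close>

lemma weakly_differentiable_component:
  fixes f :: "real^'n::finite \<Rightarrow> real^'m::finite"
  assumes wd: "has_weak_derivative f G"
    and fb [measurable]: "fb \<in> borel_measurable borel" and f_eq: "AE x in lborel. f x = fb x"
    and Gb [measurable]: "Gb \<in> borel_measurable borel" and G_eq: "AE x in lborel. G x = Gb x"
  shows "weakly_differentiable (\<lambda>x. fb x $ i) (\<lambda>x. Gb x $ i)"
proof
  show "(\<lambda>x. fb x $ i) \<in> borel_measurable borel" "(\<lambda>x. Gb x $ i) \<in> borel_measurable borel"
    by measurable
  have loc: "locally_integrable_on f UNIV" "locally_integrable_on G UNIV"
    and weak: "\<And>\<phi> i j. test_function \<phi> \<Longrightarrow>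
        (LINT x|lebesgue. f x $ i * partial_deriv j \<phi> x) = - (LINT x|lebesgue. G x $ i $ j * \<phi> x)"
    using wd unfolding has_weak_derivative_def by auto
  note [measurable] = locally_integrable_on_UNIV_D(1)[OF loc(1)] locally_integrable_on_UNIV_D(1)[OF loc(2)]
  have lebf: "AE x in lebesgue. f x = fb x" and lebG: "AE x in lebesgue. G x = Gb x"
    using f_eq G_eq by (simp_all add: AE_completion)
  show "(\<integral>\<^sup>+y\<in>ball 0 k. ennreal \<bar>fb y $ i\<bar> \<partial>lborel) < \<infinity>" for k
  proof -
    have "(\<integral>\<^sup>+y\<in>ball 0 k. ennreal \<bar>fb y $ i\<bar> \<partial>lborel) \<le> (\<integral>\<^sup>+y\<in>ball 0 k. ennreal (norm (f y)) \<partial>lborel)"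
      using f_eq by (intro nn_integral_mono_AE, eventually_elim)
        (auto intro!: mult_right_mono ennreal_leI component_le_norm_cart)
    then show ?thesis using locally_integrable_on_UNIV_D(2)[OF loc(1), of k] by (rule le_less_trans)
  qed
  show "(\<integral>\<^sup>+y\<in>ball 0 k. ennreal (norm (Gb y $ i)) \<partial>lborel) < \<infinity>" for k
  proof -
    have "(\<integral>\<^sup>+y\<in>ball 0 k. ennreal (norm (Gb y $ i)) \<partial>lborel) \<le> (\<integral>\<^sup>+y\<in>ball 0 k. ennreal (norm (G y)) \<partial>lborel)"
      using G_eq by (intro nn_integral_mono_AE, eventually_elim)
        (auto intro!: mult_right_mono ennreal_leI Finite_Cartesian_Product.norm_nth_le)
    then show ?thesis using locally_integrable_on_UNIV_D(2)[OF loc(2), of k] by (rule le_less_trans)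
  qed
  fix \<phi> :: "real^'n \<Rightarrow> real" and j assume \<phi>: "test_function \<phi>"
  note [measurable] = test_function_borel[OF \<phi>]
  have [measurable]: "\<phi> \<in> borel_measurable lebesgue" "partial_deriv j \<phi> \<in> borel_measurable lebesgue"
    "fb \<in> borel_measurable lebesgue" "Gb \<in> borel_measurable lebesgue"
    by (simp_all add: measurable_completion)
  have "(LINT y|lborel. fb y $ i * partial_deriv j \<phi> y) = (LINT y|lebesgue. fb y $ i * partial_deriv j \<phi> y)"
    by (rule integral_completion[symmetric]) measurable
  also have "\<dots> = (LINT y|lebesgue. f y $ i * partial_deriv j \<phi> y)"
  proof (rule integral_cong_AE)
    show "AE y in lebesgue. fb y $ i * partial_deriv j \<phi> y = f y $ i * partial_deriv j \<phi> y"
      using lebf by eventually_elim simp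
  qed measurable
  also have "\<dots> = - (LINT y|lebesgue. G y $ i $ j * \<phi> y)" by (rule weak[OF \<phi>])
  also have "(LINT y|lebesgue. G y $ i $ j * \<phi> y) = (LINT y|lebesgue. Gb y $ i $ j * \<phi> y)"
  proof (rule integral_cong_AE)
    show "AE y in lebesgue. G y $ i $ j * \<phi> y = Gb y $ i $ j * \<phi> y"
      using lebG by eventually_elim simp
  qed measurable
  also have "\<dots> = (LINT y|lborel. Gb y $ i $ j * \<phi> y)"
    by (rule integral_completion) measurable
  finally show "(LINT y|lborel. fb y $ i * partial_deriv j \<phi> y) = - (LINT y|lborel. Gb y $ i $ j * \<phi> y)" .
qed

lemma maximal_function_mono:
  assumes "\<And>y. f y \<le> g y"
  shows "maximal_function f x \<le> maximal_function g x"
  unfolding maximal_function_def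
proof (rule SUP_mono', rule divide_right_mono_ennreal, rule nn_integral_mono)
  show "f y * indicator (ball x r) y \<le> g y * indicator (ball x r) y" for r y
    by (rule mult_right_mono[OF assms]) simp
qed

text \<open>
  The variable Lipschitz estimate. The bounds \<open>m\<close> and \<open>m'\<close> are real numbers, so that no statement is
  made at points where the maximal function is infinite.
\<close>

abbreviation maximal_Lipschitz ::
  "real \<Rightarrow> (real^'n::finite \<Rightarrow> real^'m::finite) \<Rightarrow> (real^'n \<Rightarrow> real^'n^'m) \<Rightarrow> bool" where
  "maximal_Lipschitz C f G \<equiv>
     \<exists>N\<in>null_sets lborel. \<forall>x y m m'. x \<notin> N \<longrightarrow> y \<notin> N \<longrightarrow> 0 \<le> m \<longrightarrow> 0 \<le> m' \<longrightarrow>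
        norm_maximal G x \<le> ennreal m \<longrightarrow> norm_maximal G y \<le> ennreal m' \<longrightarrow>
        norm (f x - f y) \<le> C * norm (x - y) * (m + m')"

text \<open>
  The exceptional set consists of the points that are not Lebesgue points of some component or where
  \<open>f\<close> differs from its Borel version.
\<close>

theorem weak_derivative_maximal_function_bound:
  obtains C :: real where "0 < C"
    "\<And>(f :: real^'n::finite \<Rightarrow> real^'m::finite) G. has_weak_derivative f G \<Longrightarrow>
      maximal_Lipschitz C f G"
proof -
  define C1 where "C1 = 2 ^ Suc CARD('n) * unit_ball_vol CARD('n) / bump_mass TYPE('n)"
  have C1: "0 < C1" unfolding C1_def using integral_bump_pos[where 'n='n] by (simp add: unit_ball_vol_pos)
  show ?thesis
  proof
    show "0 < real CARD('m) * C1" using C1 by simp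
    fix f :: "real^'n \<Rightarrow> real^'m" and G assume wd: "has_weak_derivative f G"
    then have loc: "locally_integrable_on f UNIV" "locally_integrable_on G UNIV"
      unfolding has_weak_derivative_def by auto
    obtain fb where fb: "fb \<in> borel_measurable lborel" "AE x in lborel. f x = fb x"
      using completion_ex_borel_measurable_euclidean[OF locally_integrable_on_UNIV_D(1)[OF loc(1)]] by blast
    obtain Gb where Gb: "Gb \<in> borel_measurable lborel" "AE x in lborel. G x = Gb x"
      using completion_ex_borel_measurable_euclidean[OF locally_integrable_on_UNIV_D(1)[OF loc(2)]] by blast
    have W: "weakly_differentiable (\<lambda>x. fb x $ i) (\<lambda>x. Gb x $ i)" for i
      using weakly_differentiable_component[OF wd _ fb(2) _ Gb(2)] fb(1) Gb(1) by simp
    have "AE x in lborel. \<forall>i\<in>UNIV. weakly_differentiable.Lebesgue_point (\<lambda>x. fb x $ i) x"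
      by (intro AE_finite_allI weakly_differentiable.AE_Lebesgue_point_f[OF W]) simp
    with fb(2) have "AE x in lborel. f x = fb x \<and> (\<forall>i. weakly_differentiable.Lebesgue_point (\<lambda>x. fb x $ i) x)"
      by eventually_elim simp
    then obtain N where N: "N \<in> null_sets lborel"
      "\<And>x. x \<notin> N \<Longrightarrow> f x = fb x \<and> (\<forall>i. weakly_differentiable.Lebesgue_point (\<lambda>x. fb x $ i) x)"
      unfolding eventually_ae_filter by auto
    have M_eq: "norm_maximal G = norm_maximal Gb"
    proof (rule maximal_function_cong_AE)
      show "AE z in lborel. ennreal (norm (G z)) = ennreal (norm (Gb z))"
        using Gb(2) by eventually_elim simp
    qed
    have M_le: "maximal_function (\<lambda>z. ennreal (norm (Gb z $ i))) x \<le> ennreal m"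
      if "norm_maximal G x \<le> ennreal m" for i x m
      using that unfolding M_eq
      by (rule order_trans[rotated]) (intro maximal_function_mono ennreal_leI Finite_Cartesian_Product.norm_nth_le)
    show "maximal_Lipschitz (real CARD('m) * C1) f G"
    proof (intro bexI[OF _ N(1)] allI impI)
      fix x y m m' assume xy: "x \<notin> N" "y \<notin> N" and m: "0 \<le> m" "0 \<le> m'"
        and M: "norm_maximal G x \<le> ennreal m"
          "norm_maximal G y \<le> ennreal m'"
      have "norm (f x - f y) \<le> (\<Sum>i\<in>UNIV. \<bar>(f x - f y) $ i\<bar>)" by (rule norm_le_l1_cart)
      also have "\<dots> \<le> (\<Sum>i\<in>(UNIV::'m set). C1 * norm (x - y) * (m + m'))"
      proof (rule sum_mono)
        fix i :: 'm
        have "\<bar>fb x $ i - fb y $ i\<bar> \<le> C1 * norm (x - y) * (m + m')"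
          unfolding C1_def using N(2)[OF xy(1)] N(2)[OF xy(2)]
          by (intro weakly_differentiable.pointwise_difference[OF W] m M_le M) auto
        then show "\<bar>(f x - f y) $ i\<bar> \<le> C1 * norm (x - y) * (m + m')"
          using N(2)[OF xy(1)] N(2)[OF xy(2)] by simp
      qed
      finally show "norm (f x - f y) \<le> real CARD('m) * C1 * norm (x - y) * (m + m')" by simp
    qed
  qed
qed

section \<open>Logarithmic growth and Minkowski's integral inequality\<close>

text \<open>
  The chain rule for \<open>ln (\<epsilon> + |Z|)\<close> along an absolutely continuous curve, as an inequality. On a
  short interval the tangent bound for the logarithm gives the claim with the denominator frozen at
  the left end point; by continuity of \<open>Z\<close> freezing costs only a factor \<open>1 + \<eta>\<close>. The inequality with
  this factor is additive over adjacent intervals, so Bolzano's principle extends it to the whole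
  interval, and \<open>\<eta>\<close> tends to \<open>0\<close>.
\<close>

lemma ln_norm_indefinite_integral_le:
  fixes Z h :: "real \<Rightarrow> 'a::euclidean_space"
  assumes t: "0 \<le> t" and \<epsilon>: "0 < \<epsilon>" and h: "h absolutely_integrable_on {0..t}"
    and Z: "\<And>s. s \<in> {0..t} \<Longrightarrow> Z s = integral {0..s} h"
  shows "ennreal (ln (1 + norm (Z t) / \<epsilon>)) \<le> (\<integral>\<^sup>+s\<in>{0..t}. ennreal (norm (h s) / (\<epsilon> + norm (Z s))) \<partial>lborel)"
proof -
  define A where "A s = 1 / (\<epsilon> + norm (Z s)) * norm (h s)" for s
  have pos: "0 < \<epsilon> + norm (Z s)" for s using \<epsilon> by (simp add: add_pos_nonneg)
  have h_int: "h integrable_on {a..b}" and nh_int: "(\<lambda>s. norm (h s)) integrable_on {a..b}" if "0 \<le> a" "b \<le> t" for a b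
  proof -
    have "h absolutely_integrable_on {a..b}"
      by (rule set_integrable_subset[OF h]) (use that in auto)
    then show "h integrable_on {a..b}" "(\<lambda>s. norm (h s)) integrable_on {a..b}"
      by (auto simp: absolutely_integrable_on_def)
  qed
  have "continuous_on {0..t} (\<lambda>s. integral {0..s} h)"
    using h_int[of 0 t] by (intro indefinite_integral_continuous_1) auto
  then have cont: "continuous_on {0..t} Z"
    using Z by (subst continuous_on_cong[OF refl Z]) auto
  have A_abs: "A absolutely_integrable_on {0..t}"
    unfolding A_def[abs_def]
  proof (rule absolutely_integrable_bounded_measurable_product_real)
    show "(\<lambda>s. 1 / (\<epsilon> + norm (Z s))) \<in> borel_measurable (lebesgue_on {0..t})"
      using cont pos by (intro continuous_imp_measurable_on_sets_lebesgue continuous_intros) (auto simp: less_imp_neq[symmetric] order.strict_implies_not_eq)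
    show "bounded ((\<lambda>s. 1 / (\<epsilon> + norm (Z s))) ` {0..t})"
      unfolding bounded_iff using \<epsilon> pos by (intro exI[of _ "1 / \<epsilon>"]) (auto intro!: frac_le simp: abs_of_pos)
    show "(\<lambda>s. norm (h s)) absolutely_integrable_on {0..t}"
      using absolutely_integrable_norm[OF h] by (simp add: comp_def)
  qed simp
  have A_int: "A integrable_on {a..b}" if "0 \<le> a" "b \<le> t" for a b
  proof -
    have "A absolutely_integrable_on {a..b}"
      by (rule set_integrable_subset[OF A_abs]) (use that in auto)
    then show ?thesis by (auto simp: absolutely_integrable_on_def)
  qed
  have A0: "0 \<le> A s" for s using pos[of s] by (simp add: A_def)
  have main: "ln (\<epsilon> + norm (Z t)) - ln (\<epsilon> + norm (Z 0)) \<le> (1 + \<eta>) * integral {0..t} A" if \<eta>: "0 < \<eta>" for \<eta>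
  proof -
    \<comment> \<open>The guards restrict \<open>P\<close> to subintervals: the intervals around an end point may leave \<open>[0, t]\<close>.\<close>
    define P where "P a b \<longleftrightarrow> (0 \<le> a \<longrightarrow> a \<le> b \<longrightarrow> b \<le> t \<longrightarrow>
      ln (\<epsilon> + norm (Z b)) - ln (\<epsilon> + norm (Z a)) \<le> (1 + \<eta>) * integral {a..b} A)" for a b
    have "P 0 t"
    proof (rule Bolzano[OF t])
      fix a b c assume P: "P a b" "P b c" and ab: "a \<le> b" "b \<le> c"
      show "P a c"
        unfolding P_def
      proof (intro impI)
        assume ac: "0 \<le> a" "a \<le> c" "c \<le> t"
        have "integral {a..b} A + integral {b..c} A = integral {a..c} A"
          using ab ac by (intro Henstock_Kurzweil_Integration.integral_combine A_int) auto
        then have "(1 + \<eta>) * integral {a..c} A = (1 + \<eta>) * integral {a..b} A + (1 + \<eta>) * integral {b..c} A"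
          by (simp add: distrib_left[symmetric])
        then show "ln (\<epsilon> + norm (Z c)) - ln (\<epsilon> + norm (Z a)) \<le> (1 + \<eta>) * integral {a..c} A"
          using P ab ac unfolding P_def by force
      qed
    next
      fix x assume x: "0 \<le> x" "x \<le> t"
      have "0 < \<eta> * \<epsilon> / 2" using \<eta> \<epsilon> by simp
      then obtain d where d: "0 < d" "\<And>s. s \<in> {0..t} \<Longrightarrow> dist s x < d \<Longrightarrow> dist (Z s) (Z x) < \<eta> * \<epsilon> / 2"
        using cont x unfolding continuous_on_iff by (metis atLeastAtMost_iff)
      show "\<exists>d>0. \<forall>a b. a \<le> x \<and> x \<le> b \<and> b - a < d \<longrightarrow> P a b"
      proof (intro exI[of _ d] conjI allI impI d(1))
        fix a b assume ab: "a \<le> x \<and> x \<le> b \<and> b - a < d"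
        show "P a b"
          unfolding P_def
        proof (intro impI)
          assume r: "0 \<le> a" "a \<le> b" "b \<le> t"
          have near: "\<epsilon> + norm (Z s) \<le> (1 + \<eta>) * (\<epsilon> + norm (Z a))" if s: "s \<in> {a..b}" for s
          proof -
            have "dist (Z s) (Z x) < \<eta> * \<epsilon> / 2" "dist (Z a) (Z x) < \<eta> * \<epsilon> / 2"
              using d(2)[of s] d(2)[of a] s r ab by (auto simp: dist_real_def)
            then have "dist (Z s) (Z a) < \<eta> * \<epsilon>"
              using dist_triangle2[of "Z s" "Z a" "Z x"] by linarith
            then have "norm (Z s) \<le> norm (Z a) + \<eta> * \<epsilon>"
              using norm_triangle_sub[of "Z s" "Z a"] by (simp add: dist_norm)
            moreover have "0 \<le> \<eta> * norm (Z a)" using \<eta> by simp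
            ultimately show ?thesis by (simp add: algebra_simps)
          qed
          have "Z b - Z a = integral {a..b} h"
          proof -
            have "integral {0..a} h + integral {a..b} h = integral {0..b} h"
              using r by (intro Henstock_Kurzweil_Integration.integral_combine h_int) auto
            then show ?thesis using Z[of a] Z[of b] r by (simp add: algebra_simps)
          qed
          then have "norm (Z b) - norm (Z a) \<le> norm (integral {a..b} h)"
            by (metis norm_triangle_ineq2)
          also have "\<dots> \<le> integral {a..b} (\<lambda>s. norm (h s))"
            using r by (intro integral_norm_bound_integral h_int nh_int) auto
          finally have zz: "norm (Z b) - norm (Z a) \<le> integral {a..b} (\<lambda>s. norm (h s))" .
          have "ln (\<epsilon> + norm (Z b)) - ln (\<epsilon> + norm (Z a)) \<le> ((\<epsilon> + norm (Z b)) - (\<epsilon> + norm (Z a))) / (\<epsilon> + norm (Z a))"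
            by (rule ln_diff_le) (rule pos)+
          also have "\<dots> \<le> integral {a..b} (\<lambda>s. norm (h s)) / (\<epsilon> + norm (Z a))"
            using zz pos[of a] by (intro divide_right_mono) auto
          also have "\<dots> = integral {a..b} (\<lambda>s. norm (h s) / (\<epsilon> + norm (Z a)))"
            by (simp add: divide_inverse)
          also have "\<dots> \<le> integral {a..b} (\<lambda>s. (1 + \<eta>) * A s)"
          proof (rule integral_le)
            show "(\<lambda>s. norm (h s) / (\<epsilon> + norm (Z a))) integrable_on {a..b}"
              unfolding divide_inverse using r by (intro integrable_on_mult_left nh_int) auto
            show "(\<lambda>s. (1 + \<eta>) * A s) integrable_on {a..b}"
              using r by (intro integrable_on_mult_right A_int) auto
            fix s assume "s \<in> {a..b}"
            from near[OF this] have "1 / (\<epsilon> + norm (Z a)) \<le> (1 + \<eta>) / (\<epsilon> + norm (Z s))"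
              using pos[of a] pos[of s] by (simp add: field_simps)
            from mult_right_mono[OF this, of "norm (h s)"]
            show "norm (h s) / (\<epsilon> + norm (Z a)) \<le> (1 + \<eta>) * A s" by (simp add: A_def)
          qed
          also have "\<dots> = (1 + \<eta>) * integral {a..b} A" by simp
          finally show "ln (\<epsilon> + norm (Z b)) - ln (\<epsilon> + norm (Z a)) \<le> (1 + \<eta>) * integral {a..b} A" .
        qed
      qed
    qed
    then show ?thesis using t by (simp add: P_def)
  qed
  have J0: "0 \<le> integral {0..t} A" by (intro integral_nonneg A_int) (auto simp: A0)
  have Z0: "Z 0 = 0" using Z[of 0] t by simp
  have "ln (1 + norm (Z t) / \<epsilon>) = ln ((\<epsilon> + norm (Z t)) / \<epsilon>)" using \<epsilon> by (simp add: add_divide_distrib)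
  also have "\<dots> = ln (\<epsilon> + norm (Z t)) - ln (\<epsilon> + norm (Z 0))"
    using \<epsilon> pos[of t] by (simp add: ln_div Z0)
  also have "\<dots> \<le> integral {0..t} A"
  proof (rule field_le_epsilon)
    fix e :: real assume e: "0 < e"
    define \<eta> where "\<eta> = e / (integral {0..t} A + 1)"
    have "0 < \<eta>" using e J0 by (simp add: \<eta>_def)
    moreover have "\<eta> * integral {0..t} A \<le> e" using e J0 by (simp add: \<eta>_def field_simps)
    ultimately show "ln (\<epsilon> + norm (Z t)) - ln (\<epsilon> + norm (Z 0)) \<le> integral {0..t} A + e"
      using main[of \<eta>] by (simp add: distrib_right)
  qed
  finally have "ennreal (ln (1 + norm (Z t) / \<epsilon>)) \<le> ennreal (integral {0..t} A)" by (rule ennreal_leI)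
  also have "integral {0..t} A = (LINT s|lebesgue. indicator {0..t} s *\<^sub>R A s)"
    using set_lebesgue_integral_eq_integral(2)[OF A_abs] by (simp add: set_lebesgue_integral_def)
  also have "ennreal \<dots> = (\<integral>\<^sup>+s. ennreal (indicator {0..t} s *\<^sub>R A s) \<partial>lebesgue)"
    using A_abs unfolding set_integrable_def
    by (intro nn_integral_eq_integral[symmetric]) (auto simp: A0)
  also have "\<dots> = (\<integral>\<^sup>+s\<in>{0..t}. ennreal (norm (h s) / (\<epsilon> + norm (Z s))) \<partial>lborel)"
    unfolding nn_integral_completion
    by (intro nn_integral_cong) (auto simp: A_def split: split_indicator)
  finally show ?thesis .
qed

text \<open>
  Young's inequality for \<open>H / w\<close> and \<open>c powr (p - 1)\<close>, multiplied by \<open>p * w\<close>. It is the tangent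
  inequality of the convex function \<open>u \<mapsto> u powr p\<close> at \<open>c\<close>.
\<close>

lemma Young_weighted:
  fixes p c H w :: real
  assumes p: "1 < p" and c: "0 \<le> c" and H: "0 \<le> H" and w: "0 < w"
  shows "p * c powr (p - 1) * H \<le> H powr p * w powr (1 - p) + (p - 1) * c powr p * w"
proof -
  define q where "q = p / (p - 1)"
  have q: "1 < q" "1 / p + 1 / q = 1" "(p - 1) * q = p" using p by (auto simp: q_def field_simps)
  have "(H / w) * c powr (p - 1) \<le> (H / w) powr p / p + (c powr (p - 1)) powr q / q"
    by (rule Youngs_inequality) (use p q H w in auto)
  also have "(c powr (p - 1)) powr q = c powr p" by (simp add: powr_powr q)
  finally have "p * w * ((H / w) * c powr (p - 1)) \<le> p * w * ((H / w) powr p / p + c powr p / q)"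
    using p w by (intro mult_left_mono) auto
  also have "\<dots> = w * (H / w) powr p + p / q * c powr p * w" using p by (simp add: field_simps)
  also have "p / q = p - 1" using p by (simp add: q_def)
  also have "w * (H / w) powr p = H powr p * w powr (1 - p)"
    using w H by (simp add: powr_divide powr_diff)
  finally show ?thesis using w by (simp add: mult_ac)
qed

text \<open>
  The weight \<open>w s\<close> is a strictly positive bound for the \<open>L\<^sup>p\<close> norm of the slice \<open>H s\<close>. Integrating
  \<open>Young_weighted\<close> in \<open>s\<close> is Jensen's inequality for the measure with density \<open>w\<close> and gives
  \<open>S\<^sup>p \<le> W\<^sup>p\<^sup>-\<^sup>1 \<integral> H\<^sup>p w\<^sup>1\<^sup>-\<^sup>p\<close> pointwise; integrating this in \<open>x\<close> leaves
  \<open>W\<^sup>p\<^sup>-\<^sup>1 \<integral> w \<le> W\<^sup>p\<close>.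
\<close>

lemma (in pair_sigma_finite) Minkowski_integral_inequality:
  fixes H :: "'a \<Rightarrow> 'b \<Rightarrow> real" and S :: "'b \<Rightarrow> real" and w :: "'a \<Rightarrow> real"
  assumes H [measurable]: "case_prod H \<in> borel_measurable (M1 \<Otimes>\<^sub>M M2)" and H0: "\<And>s x. 0 \<le> H s x"
    and w [measurable]: "w \<in> borel_measurable M1" and w0: "\<And>s. 0 < w s"
    and A [measurable]: "A \<in> sets M1"
    and W: "0 < W" "(\<integral>\<^sup>+s\<in>A. ennreal (w s) \<partial>M1) \<le> ennreal W"
    and p: "1 < p"
    and H_le: "AE s in M1. s \<in> A \<longrightarrow> (\<integral>\<^sup>+x. ennreal (H s x powr p) \<partial>M2) \<le> ennreal (w s powr p)"
    and S0: "\<And>x. 0 \<le> S x" and S: "AE x in M2. ennreal (S x) \<le> (\<integral>\<^sup>+s\<in>A. ennreal (H s x) \<partial>M1)"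
  shows "(\<integral>\<^sup>+x. ennreal (S x powr p) \<partial>M2) \<le> ennreal (W powr p)"
proof -
  let ?Y = "\<lambda>x. \<integral>\<^sup>+s\<in>A. ennreal (H s x powr p * w s powr (1 - p)) \<partial>M1"
  have "AE x in M2. ennreal (S x powr p) \<le> ennreal (W powr (p - 1)) * ?Y x"
    using S AE_space
  proof eventually_elim
    case (elim x)
    then have [measurable]: "(\<lambda>s. H s x) \<in> borel_measurable M1" by measurable
    \<comment> \<open>The point of tangency: the \<open>w\<close>-average of \<open>H / w\<close> when the bounds on \<open>S\<close> and \<open>W\<close> are attained.\<close>
    define c where "c = S x / W"
    have c: "0 \<le> c" using S0 W by (simp add: c_def)
    have cW: "c * W = S x" using W by (simp add: c_def)
    have "ennreal (p * c powr p * W) = ennreal (p * c powr (p - 1) * S x)"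
      using c by (cases "c = 0") (auto simp: powr_diff cW[symmetric] mult.assoc)
    also have "\<dots> = ennreal (p * c powr (p - 1)) * ennreal (S x)" using p S0 by (intro ennreal_mult) auto
    also have "\<dots> \<le> ennreal (p * c powr (p - 1)) * (\<integral>\<^sup>+s\<in>A. ennreal (H s x) \<partial>M1)"
      using elim(1) by (intro mult_left_mono) auto
    also have "\<dots> = (\<integral>\<^sup>+s. ennreal (p * c powr (p - 1)) * (ennreal (H s x) * indicator A s) \<partial>M1)"
      by (rule nn_integral_cmult[symmetric]) measurable
    also have "\<dots> \<le> (\<integral>\<^sup>+s. ennreal (H s x powr p * w s powr (1 - p)) * indicator A s
        + ennreal ((p - 1) * c powr p) * (ennreal (w s) * indicator A s) \<partial>M1)"
    proof (rule nn_integral_mono)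
      fix s
      have "ennreal (p * c powr (p - 1) * H s x) \<le> ennreal (H s x powr p * w s powr (1 - p) + (p - 1) * c powr p * w s)"
        using Young_weighted[OF p c H0[of s x] w0[of s]] by (rule ennreal_leI)
      then show "ennreal (p * c powr (p - 1)) * (ennreal (H s x) * indicator A s) \<le>
          ennreal (H s x powr p * w s powr (1 - p)) * indicator A s + ennreal ((p - 1) * c powr p) * (ennreal (w s) * indicator A s)"
        using p H0[of s x] less_imp_le[OF w0[of s]] by (auto simp: ennreal_mult ennreal_plus split: split_indicator)
    qed
    also have "\<dots> = ?Y x + ennreal ((p - 1) * c powr p) * (\<integral>\<^sup>+s\<in>A. ennreal (w s) \<partial>M1)"
      by (subst nn_integral_add) (auto simp: nn_integral_cmult)
    also have "\<dots> \<le> ?Y x + ennreal ((p - 1) * c powr p) * ennreal W"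
      by (intro add_left_mono mult_left_mono W) simp
    also have "\<dots> = ?Y x + ennreal ((p - 1) * c powr p * W)"
      using p W by (simp add: ennreal_mult)
    finally have "ennreal (p * c powr p * W) \<le> ?Y x + ennreal ((p - 1) * c powr p * W)" .
    moreover have "ennreal (p * c powr p * W) = ennreal (c powr p * W) + ennreal ((p - 1) * c powr p * W)"
    proof -
      have "p * c powr p * W = c powr p * W + (p - 1) * c powr p * W" by (simp add: algebra_simps)
      then show ?thesis using p W by (simp add: ennreal_plus)
    qed
    ultimately have "ennreal (c powr p * W) + ennreal ((p - 1) * c powr p * W) \<le> ?Y x + ennreal ((p - 1) * c powr p * W)"
      by simp
    then have "ennreal (c powr p * W) \<le> ?Y x"
      unfolding add.commute[of _ "ennreal ((p - 1) * c powr p * W)"] ennreal_add_left_cancel_le by simp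
    then have "ennreal (W powr (p - 1)) * ennreal (c powr p * W) \<le> ennreal (W powr (p - 1)) * ?Y x"
      by (rule mult_left_mono) simp
    moreover have "W powr (p - 1) * (c powr p * W) = S x powr p"
    proof -
      have "W powr (p - 1) * W = W powr p" using W by (simp add: powr_diff)
      then have "W powr (p - 1) * (c powr p * W) = c powr p * W powr p" by (simp add: mult_ac)
      also have "\<dots> = S x powr p" using c W by (simp add: cW[symmetric] powr_mult)
      finally show ?thesis .
    qed
    ultimately show ?case using W by (simp flip: ennreal_mult)
  qed
  then have "(\<integral>\<^sup>+x. ennreal (S x powr p) \<partial>M2) \<le> (\<integral>\<^sup>+x. ennreal (W powr (p - 1)) * ?Y x \<partial>M2)"
    by (rule nn_integral_mono_AE)
  also have "\<dots> = ennreal (W powr (p - 1)) * (\<integral>\<^sup>+x. ?Y x \<partial>M2)"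
    by (rule nn_integral_cmult) measurable
  also have "(\<integral>\<^sup>+x. ?Y x \<partial>M2) = (\<integral>\<^sup>+s. (\<integral>\<^sup>+x. ennreal (H s x powr p * w s powr (1 - p)) * indicator A s \<partial>M2) \<partial>M1)"
    by (rule Fubini') measurable
  also have "\<dots> \<le> (\<integral>\<^sup>+s\<in>A. ennreal (w s) \<partial>M1)"
  proof (rule nn_integral_mono_AE)
    show "AE s in M1. (\<integral>\<^sup>+x. ennreal (H s x powr p * w s powr (1 - p)) * indicator A s \<partial>M2) \<le> ennreal (w s) * indicator A s"
      using H_le AE_space
    proof eventually_elim
      case (elim s)
      then have [measurable]: "(\<lambda>x. H s x) \<in> borel_measurable M2" by measurable
      show ?case
      proof (cases "s \<in> A")
        case True
        have "(\<integral>\<^sup>+x. ennreal (H s x powr p * w s powr (1 - p)) * indicator A s \<partial>M2) =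
            (\<integral>\<^sup>+x. ennreal (w s powr (1 - p)) * ennreal (H s x powr p) \<partial>M2)"
          using True by (simp add: ennreal_mult mult.commute)
        also have "\<dots> = ennreal (w s powr (1 - p)) * (\<integral>\<^sup>+x. ennreal (H s x powr p) \<partial>M2)"
          by (rule nn_integral_cmult) measurable
        also have "\<dots> \<le> ennreal (w s powr (1 - p)) * ennreal (w s powr p)"
          using elim(1) True by (intro mult_left_mono) auto
        also have "\<dots> = ennreal (w s)"
          using w0[of s] by (simp add: powr_add[symmetric] flip: ennreal_mult)
        finally show ?thesis using True by simp
      qed simp
    qed
  qed
  also note W(2)
  finally have "(\<integral>\<^sup>+x. ennreal (S x powr p) \<partial>M2) \<le> ennreal (W powr (p - 1)) * ennreal W"
    by (simp add: mult_left_mono)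
  also have "\<dots> = ennreal (W powr p)"
    using W by (simp add: powr_diff flip: ennreal_mult)
  finally show ?thesis .
qed

section \<open>Measurability of fields and flows\<close>

lemma AE_obtain_null_set:
  assumes "AE x in lborel. P x"
  obtains N where "N \<in> null_sets lborel" "\<And>x. x \<notin> N \<Longrightarrow> P x"
  using assms unfolding eventually_ae_filter by auto

text \<open>
  For each grid time the map has a Borel version in \<open>x\<close>. Sampling time at the grid points
  \<open>\<lfloor>(k + 1) t\<rfloor> / (k + 1)\<close> uses countably many of them and is jointly measurable; the samples converge
  as \<open>k \<rightarrow> \<infinity>\<close> by continuity in time. Points where one of these versions is wrong form a null set that
  does not depend on \<open>t\<close>.
\<close>

lemma time_sampled_borel_version:
  fixes X :: "real \<Rightarrow> 'a::euclidean_space \<Rightarrow> 'b::euclidean_space"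
  assumes meas: "\<And>t. t \<in> {0..T} \<Longrightarrow> X t \<in> borel_measurable lebesgue"
    and cont: "AE x in lebesgue. continuous_on {0..T} (\<lambda>t. X t x)"
  obtains Y Z where "(\<lambda>(t, x). Y t x) \<in> borel_measurable spacetime" "Z \<in> null_sets lborel"
    "\<And>t x. x \<notin> Z \<Longrightarrow> t \<in> {0..T} \<Longrightarrow> Y t x = X t x"
proof -
  have "\<exists>V. V \<in> borel_measurable lborel \<and> (q \<in> {0..T} \<longrightarrow> (AE x in lborel. X q x = V x))" for q
  proof (cases "q \<in> {0..T}")
    case True
    from completion_ex_borel_measurable_euclidean[OF meas[OF this]] show ?thesis by metis
  qed (auto intro: exI[of _ "\<lambda>_. 0"])
  then obtain V where V: "\<And>q. V q \<in> borel_measurable lborel"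
    "\<And>q. q \<in> {0..T} \<Longrightarrow> AE x in lborel. X q x = V q x" by metis
  define q where "q k m = real_of_int m / real (Suc k)" for k m
  define Yk where "Yk k t x = V (q k \<lfloor>real (Suc k) * t\<rfloor>) x" for k t x
  define Y where "Y t x = lim (\<lambda>k. Yk k t x)" for t x
  have [measurable]: "(\<lambda>p. Yk k (fst p) (snd p)) \<in> borel_measurable spacetime" for k
    unfolding Yk_def
  proof (rule measurable_compose_countable'[where I=UNIV and g="\<lambda>p. \<lfloor>real (Suc k) * fst p\<rfloor>" and f="\<lambda>m p. V (q k m) (snd p)"])
    show "(\<lambda>p. V (q k m) (snd p)) \<in> borel_measurable spacetime" for m
      by (rule measurable_compose[OF measurable_snd V(1)])
    show "(\<lambda>p. \<lfloor>real (Suc k) * fst p\<rfloor>) \<in> measurable spacetime (count_space UNIV)"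
      by measurable
  qed auto
  have Y_meas: "(\<lambda>(t, x). Y t x) \<in> borel_measurable spacetime"
    unfolding Y_def case_prod_beta by measurable
  have "AE x in lborel. continuous_on {0..T} (\<lambda>t. X t x)"
    using cont by (simp add: AE_completion_iff)
  moreover have "AE x in lborel. \<forall>k m. q k m \<in> {0..T} \<longrightarrow> X (q k m) x = V (q k m) x"
    unfolding AE_all_countable
  proof (intro allI)
    fix k m
    show "AE x in lborel. q k m \<in> {0..T} \<longrightarrow> X (q k m) x = V (q k m) x"
      using V(2)[of "q k m"] by (cases "q k m \<in> {0..T}") auto
  qed
  ultimately have "AE x in lborel. continuous_on {0..T} (\<lambda>t. X t x) \<and> (\<forall>k m. q k m \<in> {0..T} \<longrightarrow> X (q k m) x = V (q k m) x)"
    by eventually_elim simp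
  then obtain Z where Z: "Z \<in> null_sets lborel" "\<And>x. x \<notin> Z \<Longrightarrow>
      continuous_on {0..T} (\<lambda>t. X t x) \<and> (\<forall>k m. q k m \<in> {0..T} \<longrightarrow> X (q k m) x = V (q k m) x)"
    by (rule AE_obtain_null_set) blast
  show ?thesis
  proof (rule that[OF Y_meas Z(1)])
    fix t x assume x: "x \<notin> Z" and t: "t \<in> {0..T}"
    let ?q = "\<lambda>k. q k \<lfloor>real (Suc k) * t\<rfloor>"
    have qt: "?q k \<le> t" "t - 1 / real (Suc k) \<le> ?q k" for k
    proof -
      have "real_of_int \<lfloor>real (Suc k) * t\<rfloor> \<le> real (Suc k) * t" by simp
      then show "?q k \<le> t" unfolding q_def by (simp add: pos_divide_le_eq mult.commute)
      have "real (Suc k) * t - 1 \<le> real_of_int \<lfloor>real (Suc k) * t\<rfloor>" by linarith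
      then have "(real (Suc k) * t - 1) / real (Suc k) \<le> ?q k" unfolding q_def by (rule divide_right_mono) simp
      then show "t - 1 / real (Suc k) \<le> ?q k" by (simp add: diff_divide_distrib)
    qed
    have q_in: "?q k \<in> {0..T}" for k
    proof -
      have "0 \<le> ?q k" using t unfolding q_def by simp
      then show ?thesis using qt(1)[of k] t by auto
    qed
    have "?q \<longlonglongrightarrow> t"
    proof (rule tendsto_sandwich)
      have "(\<lambda>k. t - 1 / real (Suc k)) \<longlonglongrightarrow> t - 0"
        by (intro tendsto_intros LIMSEQ_Suc lim_1_over_n)
      then show "(\<lambda>k. t - 1 / real (Suc k)) \<longlonglongrightarrow> t" by simp
    qed (use qt in auto)
    moreover have "continuous_on {0..T} (\<lambda>t. X t x)" using Z(2)[OF x] by simp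
    ultimately have "(\<lambda>k. X (?q k) x) \<longlonglongrightarrow> X t x"
      using t q_in by (intro continuous_on_tendsto_compose[of "{0..T}" "\<lambda>t. X t x"]) auto
    moreover have "X (?q k) x = Yk k t x" for k
      using Z(2)[OF x] q_in unfolding Yk_def by blast
    ultimately show "Y t x = X t x" unfolding Y_def by (simp add: limI)
  qed
qed

lemma integral_solution_continuous:
  assumes "integral_solution T b x \<gamma>"
  shows "continuous_on {0..T} \<gamma>"
proof -
  have "(\<lambda>s. b s (\<gamma> s)) integrable_on {0..T}" and eq: "\<And>t. t \<in> {0..T} \<Longrightarrow> \<gamma> t = x + integral {0..t} (\<lambda>s. b s (\<gamma> s))"
    using assms unfolding integral_solution_def by (auto simp: absolutely_integrable_on_def)
  then have "continuous_on {0..T} (\<lambda>t. x + integral {0..t} (\<lambda>s. b s (\<gamma> s)))"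
    by (intro continuous_intros indefinite_integral_continuous_1)
  then show ?thesis by (subst continuous_on_cong[OF refl eq])
qed

lemma integral_solution_displacement:
  assumes sol: "integral_solution T b x \<gamma>" and t: "t \<in> {0..T}" and M: "0 \<le> M"
    and bd: "AE s in lborel. s \<in> {0..T} \<longrightarrow> norm (b s (\<gamma> s)) \<le> M"
  shows "norm (\<gamma> t - x) \<le> M * t"
proof -
  let ?h = "\<lambda>s. b s (\<gamma> s)"
  have "?h absolutely_integrable_on {0..t}"
    by (rule set_integrable_subset[of _ "{0..T}"]) (use sol t in \<open>auto simp: integral_solution_def\<close>)
  then have int: "?h integrable_on {0..t}" "(\<lambda>s. norm (?h s)) absolutely_integrable_on {0..t}"
    by (auto simp: comp_def dest: absolutely_integrable_norm set_lebesgue_integral_eq_integral(1))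
  have "norm (\<gamma> t - x) = norm (integral {0..t} ?h)" using sol t by (simp add: integral_solution_def)
  also have "\<dots> \<le> integral {0..t} (\<lambda>s. norm (?h s))"
    using int by (intro integral_norm_bound_integral) (auto simp: absolutely_integrable_on_def)
  also have "\<dots> = (LINT s|lebesgue. indicator {0..t} s *\<^sub>R norm (?h s))"
    using set_lebesgue_integral_eq_integral(2)[OF int(2)] by (simp add: set_lebesgue_integral_def)
  also have "\<dots> \<le> (LINT s|lebesgue. indicator {0..t} s *\<^sub>R M)"
  proof (rule integral_mono_AE)
    show "integrable lebesgue (\<lambda>s. indicator {0..t} s *\<^sub>R norm (?h s))"
      using int(2) by (simp add: set_integrable_def)
    show "integrable lebesgue (\<lambda>s. indicator {0..t} s *\<^sub>R M)"
      by (rule integrableI_bounded_set_indicator[where B="\<bar>M\<bar>"]) (use t in auto)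
    show "AE s in lebesgue. indicator {0..t} s *\<^sub>R norm (?h s) \<le> indicator {0..t} s *\<^sub>R M"
      using AE_completion[OF bd] by eventually_elim (use t in \<open>auto split: split_indicator\<close>)
  qed
  also have "\<dots> = M * t" using t by simp
  finally show ?thesis .
qed

lemma compressible_null_preimage:
  assumes X: "compressibility_constant T X L" and t: "t \<in> {0..T}" and N: "N \<in> null_sets lborel"
  shows "AE x in lborel. X t x \<notin> N"
proof -
  have "N \<in> sets borel" using N by auto
  moreover have "emeasure lebesgue N = 0" using null_sets_completionI[OF N] by (rule null_setsD1)
  ultimately have "X t -` N \<in> sets lebesgue" "emeasure lebesgue (X t -` N) \<le> ennreal L * 0"
    using X t unfolding compressibility_constant_def by metis+
  then have "X t -` N \<in> null_sets lebesgue" by (auto simp: null_sets_def)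
  then have "AE x in lebesgue. x \<notin> X t -` N" by (rule AE_not_in)
  then show ?thesis by (simp add: AE_completion_iff)
qed

lemma compressible_measurable:
  assumes X: "compressibility_constant T X L" and t: "t \<in> {0..T}"
  shows "X t \<in> borel_measurable lebesgue"
  using X t unfolding compressibility_constant_def by (auto intro: measurableI)

text \<open>
  Compressibility says that the image of Lebesgue measure under \<open>X t\<close> is at most \<open>L\<close> times Lebesgue
  measure.
\<close>

lemma compressible_nn_integral_le:
  assumes X: "compressibility_constant T X L" and t: "t \<in> {0..T}" and g: "g \<in> borel_measurable borel"
  shows "(\<integral>\<^sup>+x. g (X t x) \<partial>lborel) \<le> ennreal L * (\<integral>\<^sup>+x. g x \<partial>lborel)"
proof -
  note Xm [measurable] = compressible_measurable[OF X t]
  have "(\<integral>\<^sup>+x. g (X t x) \<partial>lborel) = (\<integral>\<^sup>+x. g (X t x) \<partial>lebesgue)"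
    by (rule nn_integral_completion[symmetric])
  also have "\<dots> = (\<integral>\<^sup>+x. g x \<partial>distr lebesgue borel (X t))"
    by (rule nn_integral_distr[symmetric]) (use g in auto)
  also have "\<dots> \<le> (\<integral>\<^sup>+x. g x \<partial>scale_measure (ennreal L) lborel)"
  proof (rule nn_integral_mono_measure)
    show "distr lebesgue borel (X t) \<le> scale_measure (ennreal L) lborel"
    proof (subst le_measure)
      show "\<forall>A\<in>sets (distr lebesgue borel (X t)). emeasure (distr lebesgue borel (X t)) A \<le> emeasure (scale_measure (ennreal L) lborel) A"
      proof
        fix A assume "A \<in> sets (distr lebesgue borel (X t))"
        then have A: "A \<in> sets borel" by simp
        have "emeasure (distr lebesgue borel (X t)) A = emeasure lebesgue (X t -` A)"
          by (simp add: emeasure_distr[OF Xm A])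
        also have "\<dots> \<le> ennreal L * emeasure lebesgue A"
          using X t A unfolding compressibility_constant_def by blast
        also have "\<dots> = emeasure (scale_measure (ennreal L) lborel) A"
          using A by simp
        finally show "emeasure (distr lebesgue borel (X t)) A \<le> emeasure (scale_measure (ennreal L) lborel) A" .
      qed
    qed simp
  qed simp
  also have "\<dots> = ennreal L * (\<integral>\<^sup>+x. g x \<partial>lborel)"
    by (rule nn_integral_scale_measure) (use g in simp)
  finally show ?thesis .
qed

lemma jointly_measurable_borel_version:
  fixes f :: "real \<Rightarrow> 'a::euclidean_space \<Rightarrow> 'b::euclidean_space"
  assumes "jointly_measurable T f"
  obtains g N where "(\<lambda>(t, x). g t x) \<in> borel_measurable spacetime" "N \<in> null_sets spacetime"
    "\<And>t x. t \<in> {0..T} \<Longrightarrow> (t, x) \<notin> N \<Longrightarrow> f t x = g t x"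
proof -
  let ?S = "{0..T} \<times> (UNIV :: 'a set)"
  have S: "?S \<in> sets lebesgue" by (intro sets_completionI_sets) (auto intro!: borel_closed closed_Times)
  let ?f = "\<lambda>p. if p \<in> ?S then (case p of (t, x) \<Rightarrow> f t x) else 0"
  have "?f \<in> borel_measurable lebesgue"
    using assms unfolding jointly_measurable_def borel_measurable_if[OF S] .
  from completion_ex_borel_measurable_euclidean[OF this] obtain g where
    g: "g \<in> borel_measurable lborel" "AE p in lborel. ?f p = g p" by blast
  from g(2) obtain N where N: "N \<in> null_sets lborel" "\<And>p. p \<notin> N \<Longrightarrow> ?f p = g p"
    by (rule AE_obtain_null_set) blast
  show ?thesis
  proof
    show "(\<lambda>(t, x). g (t, x)) \<in> borel_measurable spacetime" using g(1) by (simp add: lborel_prod)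
    show "N \<in> null_sets spacetime" using N(1) by (simp add: lborel_prod)
    show "f t x = g (t, x)" if "t \<in> {0..T}" "(t, x) \<notin> N" for t x
      using N(2)[OF that(2)] that(1) by simp
  qed
qed

lemma Linf_norm_bound:
  fixes f :: "real \<Rightarrow> 'a::euclidean_space \<Rightarrow> 'b::euclidean_space"
  assumes "Linf_norm T f = ennreal M" "0 \<le> M"
  obtains N where "N \<in> null_sets spacetime"
    "\<And>t x. t \<in> {0..T} \<Longrightarrow> (t, x) \<notin> N \<Longrightarrow> norm (f t x) \<le> M"
proof -
  let ?S = "{0..T} \<times> (UNIV :: 'a set)"
  have S: "?S \<in> sets lebesgue" by (intro sets_completionI_sets) (auto intro!: borel_closed closed_Times)
  have "AE p in lebesgue_on ?S. (case p of (t, x) \<Rightarrow> ennreal (norm (f t x))) \<le> ennreal M"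
    using esssup_AE[of "\<lambda>(t, x). ennreal (norm (f t x))" "lebesgue_on ?S"] assms(1) unfolding Linf_norm_def by simp
  then have "AE p in lebesgue. p \<in> ?S \<longrightarrow> (case p of (t, x) \<Rightarrow> ennreal (norm (f t x))) \<le> ennreal M"
    using S by (subst (asm) AE_restrict_space_iff) auto
  then have "AE p in lborel. p \<in> ?S \<longrightarrow> (case p of (t, x) \<Rightarrow> ennreal (norm (f t x))) \<le> ennreal M"
    by (simp add: AE_completion_iff)
  then obtain N where N: "N \<in> null_sets lborel" "\<And>p. p \<notin> N \<Longrightarrow> p \<in> ?S \<longrightarrow> (case p of (t, x) \<Rightarrow> ennreal (norm (f t x))) \<le> ennreal M"
    by (rule AE_obtain_null_set) blast
  show ?thesis
  proof
    show "N \<in> null_sets spacetime" using N(1) by (simp add: lborel_prod)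
    show "norm (f t x) \<le> M" if "t \<in> {0..T}" "(t, x) \<notin> N" for t x
      using N(2)[OF that(2)] that(1) assms(2) by (simp add: ennreal_le_iff)
  qed
qed

lemma AE_slice_null:
  assumes N: "N \<in> null_sets spacetime"
  shows "AE t in lborel. {x. (t, x) \<in> N} \<in> null_sets lborel"
proof -
  have [measurable]: "N \<in> sets spacetime" using N by auto
  have "AE p in spacetime. p \<notin> N" using N by (rule AE_not_in)
  from lborel_pair.AE_pair[OF this] show ?thesis
  proof eventually_elim
    case (elim t)
    have "{x. (t, x) \<in> N} = Pair t -` N" by auto
    moreover have "Pair t -` N \<in> sets lborel" by (rule sets_Pair1) fact
    ultimately have "{x. (t, x) \<in> N} \<in> sets lborel" by simp
    from AE_iff_null_sets[OF this] elim show ?case by simp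
  qed
qed

text \<open>
  For almost every fixed time this follows from compressibility; Fubini's theorem turns it into a
  statement about almost every trajectory. It makes the values of a field along trajectories
  independent of the representative.
\<close>

lemma compressible_flow_avoids_null:
  fixes X :: "real \<Rightarrow> real^'n::finite \<Rightarrow> real^'n"
  assumes X: "compressibility_constant T X L" and N: "N \<in> null_sets spacetime"
    and Y [measurable]: "(\<lambda>(t, x). Y t x) \<in> borel_measurable spacetime" and Z: "Z \<in> null_sets lborel"
    and XY: "\<And>t x. x \<notin> Z \<Longrightarrow> t \<in> {0..T} \<Longrightarrow> Y t x = X t x"
  shows "AE x in lborel. AE t in lborel. t \<in> {0..T} \<longrightarrow> (t, X t x) \<notin> N"
proof -
  have [measurable]: "N \<in> sets spacetime" using N by auto
  have Zae: "AE x in lborel. x \<notin> Z" using Z by (rule AE_not_in)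
  have "AE t in lborel. AE x in lborel. t \<in> {0..T} \<longrightarrow> (t, Y t x) \<notin> N"
    using AE_slice_null[OF N]
  proof eventually_elim
    case (elim t)
    show ?case
    proof (cases "t \<in> {0..T}")
      case True
      from compressible_null_preimage[OF X True elim] Zae show ?thesis
        by eventually_elim (use XY True in auto)
    next
      case False
      then show ?thesis by (intro AE_I2) auto
    qed
  qed
  moreover have "{p \<in> space spacetime. fst p \<in> {0..T} \<longrightarrow> (fst p, Y (fst p) (snd p)) \<notin> N} \<in> sets spacetime"
  proof -
    have "(\<lambda>p. (fst p, Y (fst p) (snd p))) \<in> measurable spacetime spacetime"
      using Y unfolding case_prod_beta by measurable
    from measurable_sets[OF this null_setsD2[OF N]]
    have 1: "(\<lambda>p. (fst p, Y (fst p) (snd p))) -` N \<inter> space spacetime \<in> sets spacetime" .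
    have 2: "{0..T} \<times> UNIV \<in> sets (lborel \<Otimes>\<^sub>M (lborel :: (real^'n) measure))"
      by (rule pair_measureI) auto
    have 3: "{p \<in> space spacetime. fst p \<in> {0..T} \<longrightarrow> (fst p, Y (fst p) (snd p)) \<notin> N} =
        space spacetime - ({0..T} \<times> UNIV) \<inter> ((\<lambda>p. (fst p, Y (fst p) (snd p))) -` N \<inter> space spacetime)"
      by auto
    show ?thesis unfolding 3 by (rule sets.Diff[OF sets.top sets.Int[OF 2 1]])
  qed
  ultimately have "AE x in lborel. AE t in lborel. t \<in> {0..T} \<longrightarrow> (t, Y t x) \<notin> N"
    by (subst (asm) lborel_pair.AE_commute) simp_all
  with Zae show ?thesis
  proof eventually_elim
    case (elim x)
    from elim(2) show ?case by eventually_elim (use XY elim(1) in auto)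
  qed
qed

lemma eLp_norm_le:
  assumes "(\<integral>\<^sup>+x\<in>S. ennreal (norm (f x) powr p) \<partial>lborel) \<le> ennreal (c powr p)" "0 \<le> c" "0 < p"
  shows "eLp_norm p S f \<le> ennreal c"
proof -
  let ?I = "\<integral>\<^sup>+x\<in>S. ennreal (norm (f x) powr p) \<partial>lebesgue"
  have I: "?I \<le> ennreal (c powr p)" using assms(1) by (simp add: nn_integral_completion)
  then have "?I \<noteq> \<infinity>" by (auto simp: top_unique)
  moreover have "enn2real ?I powr (1 / p) \<le> c"
  proof -
    have "enn2real ?I \<le> c powr p" using enn2real_mono[OF I] by simp
    then have "enn2real ?I powr (1 / p) \<le> (c powr p) powr (1 / p)" using assms by (intro powr_mono2) auto
    also have "\<dots> = c" using assms by (simp add: powr_powr)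
    finally show ?thesis .
  qed
  ultimately show ?thesis unfolding eLp_norm_def Let_def by (simp add: ennreal_leI)
qed

text \<open>
  Finiteness of the mixed norm makes almost every slice norm finite. The real function \<open>a\<close> is a
  measurable version of the slice norm.
\<close>

lemma mixed_norm_slices:
  fixes f g :: "real \<Rightarrow> 'a::euclidean_space \<Rightarrow> 'b::euclidean_space"
  assumes g [measurable]: "(\<lambda>(t, x). g t x) \<in> borel_measurable spacetime" and S [measurable]: "S \<in> sets borel"
    and eq: "AE t in lborel. t \<in> {0..T} \<longrightarrow> (AE x in lborel. f t x = g t x)"
    and c: "L1_Lp_norm T p S f \<le> ennreal c" and p: "0 < p"
  obtains a where "a \<in> borel_measurable borel" "\<And>t. 0 \<le> a t"
    "(\<integral>\<^sup>+t\<in>{0..T}. ennreal (a t) \<partial>lborel) \<le> ennreal c"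
    "AE t in lborel. t \<in> {0..T} \<longrightarrow> (\<integral>\<^sup>+x\<in>S. ennreal (norm (g t x) powr p) \<partial>lborel) = ennreal (a t powr p)"
proof -
  define I where "I t = (\<integral>\<^sup>+x\<in>S. ennreal (norm (g t x) powr p) \<partial>lborel)" for t
  define a where "a t = enn2real (I t) powr (1 / p)" for t
  define e where "e t = (if I t = \<infinity> then \<infinity> else ennreal (a t))" for t
  have I_m [measurable]: "I \<in> borel_measurable borel"
  proof -
    have "(\<lambda>t. \<integral>\<^sup>+x. ennreal (norm (g t x) powr p) * indicator S x \<partial>lborel) \<in> borel_measurable lborel"
      using g by (intro lborel.borel_measurable_nn_integral) (simp add: case_prod_beta, measurable)
    then show ?thesis unfolding I_def by simp
  qed
  have a_m [measurable]: "a \<in> borel_measurable borel" unfolding a_def by measurable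
  have [measurable]: "e \<in> borel_measurable borel" unfolding e_def by measurable
  have "AE t in lborel. eLp_norm p S (f t) * indicator {0..T} t = e t * indicator {0..T} t"
    using eq
  proof eventually_elim
    case (elim t)
    show ?case
    proof (cases "t \<in> {0..T}")
      case True
      then have "AE x in lborel. f t x = g t x" using elim by simp
      then have "(\<integral>\<^sup>+x\<in>S. ennreal (norm (f t x) powr p) \<partial>lborel) = I t"
        unfolding I_def by (intro nn_integral_cong_AE) (auto elim: eventually_mono)
      then show ?thesis unfolding eLp_norm_def e_def a_def Let_def by (simp add: nn_integral_completion)
    qed simp
  qed
  then have "(\<integral>\<^sup>+t. eLp_norm p S (f t) * indicator {0..T} t \<partial>lborel) = (\<integral>\<^sup>+t. e t * indicator {0..T} t \<partial>lborel)"
    by (rule nn_integral_cong_AE)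
  then have e_le: "(\<integral>\<^sup>+t. e t * indicator {0..T} t \<partial>lborel) \<le> ennreal c"
    using c unfolding L1_Lp_norm_def by (simp add: nn_integral_completion)
  then have "AE t in lborel. e t * indicator {0..T} t \<noteq> \<infinity>"
    by (intro nn_integral_PInf_AE) (auto simp: top_unique)
  then have "AE t in lborel. t \<in> {0..T} \<longrightarrow> I t = ennreal (a t powr p)"
  proof eventually_elim
    case (elim t)
    show ?case
    proof
      assume "t \<in> {0..T}"
      then have "I t \<noteq> \<infinity>" using elim by (auto simp: e_def)
      then show "I t = ennreal (a t powr p)"
        using p unfolding a_def by (simp add: powr_powr less_top)
    qed
  qed
  moreover have "(\<integral>\<^sup>+t\<in>{0..T}. ennreal (a t) \<partial>lborel) \<le> ennreal c"
    using e_le by (rule order_trans[rotated]) (intro nn_integral_mono mult_right_mono, auto simp: e_def)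
  ultimately show ?thesis
    using that[of a] a_m unfolding I_def by (auto simp: a_def)
qed

section \<open>Quantitative stability of flows\<close>

lemma powr_superadditive:
  fixes u v p :: real
  assumes "1 \<le> p" "0 \<le> u" "0 \<le> v"
  shows "u powr p + v powr p \<le> (u + v) powr p"
proof -
  have eq: "z powr p = z * z powr (p - 1)" if "0 \<le> z" for z :: real
    using that by (cases "z = 0") (simp_all add: powr_diff)
  have "u * u powr (p - 1) + v * v powr (p - 1) \<le> u * (u + v) powr (p - 1) + v * (u + v) powr (p - 1)"
    using assms by (intro add_mono mult_left_mono powr_mono2) auto
  then show ?thesis
    using assms by (simp add: eq[of u] eq[of v] eq[of "u + v"] distrib_right)
qed

lemma powr_sum3_le:
  fixes x y z p :: real
  assumes p: "0 \<le> p" and "0 \<le> x" "0 \<le> y" "0 \<le> z"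
  shows "(x + y + z) powr p \<le> 3 powr p * (x powr p + y powr p + z powr p)"
proof -
  define m where "m = max x (max y z)"
  have "(x + y + z) powr p \<le> (3 * m) powr p"
    using assms by (intro powr_mono2) (auto simp: m_def)
  also have "\<dots> = 3 powr p * m powr p" using assms by (simp add: powr_mult m_def)
  also have "\<dots> \<le> 3 powr p * (x powr p + y powr p + z powr p)"
    by (intro mult_left_mono) (auto simp: m_def max_def)
  finally show ?thesis .
qed

text \<open>
  If the logarithm is at most \<open>|ln \<epsilon>| / 2\<close>, then \<open>z \<le> \<surd>\<epsilon> \<le> 2 / |ln \<epsilon>|\<close>. Otherwise
  \<open>z \<le> Q\<close>, and the factor \<open>2 ln (1 + z / \<epsilon>) / |ln \<epsilon>|\<close> is at least \<open>1\<close>.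
\<close>

lemma powr_le_log_powr:
  fixes z Q \<epsilon> p :: real
  assumes \<epsilon>: "0 < \<epsilon>" "\<epsilon> < 1" and z: "0 \<le> z" "z \<le> Q" and p: "0 \<le> p"
  shows "z powr p \<le> (2 / \<bar>ln \<epsilon>\<bar>) powr p + (2 * Q / \<bar>ln \<epsilon>\<bar>) powr p * ln (1 + z / \<epsilon>) powr p"
proof -
  define l where "l = \<bar>ln \<epsilon>\<bar>"
  have l: "0 < l" "\<epsilon> = exp (- l)" using \<epsilon> by (simp_all add: l_def)
  have S0: "0 \<le> ln (1 + z / \<epsilon>)" using z \<epsilon> by simp
  have Q0: "0 \<le> Q" using z by linarith
  show ?thesis
  proof (cases "ln (1 + z / \<epsilon>) \<le> l / 2")
    case True
    have "0 < 1 + z / \<epsilon>" using z \<epsilon> by (simp add: add_pos_nonneg)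
    then have "1 + z / \<epsilon> = exp (ln (1 + z / \<epsilon>))" by simp
    also have "\<dots> \<le> exp (l / 2)" using True by simp
    finally have "1 + z / \<epsilon> \<le> exp (l / 2)" .
    then have "z / \<epsilon> \<le> exp (l / 2)" by simp
    then have "z \<le> exp (l / 2) * \<epsilon>" using \<epsilon> by (simp add: pos_divide_le_eq)
    also have "\<dots> = exp (- (l / 2))" unfolding l(2) by (simp flip: exp_add)
    also have "\<dots> \<le> 2 / l"
    proof -
      have "l / 2 \<le> exp (l / 2)" using exp_ge_add_one_self[of "l / 2"] by linarith
      then show ?thesis using l(1) by (simp add: exp_minus field_simps)
    qed
    finally have "z powr p \<le> (2 / l) powr p" using z p by (intro powr_mono2) auto
    then show ?thesis unfolding l_def[symmetric] by (simp add: add_increasing2)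
  next
    case False
    then have "1 \<le> 2 * ln (1 + z / \<epsilon>) / l" using l(1) by (simp add: field_simps)
    then have "Q * 1 \<le> Q * (2 * ln (1 + z / \<epsilon>) / l)" using Q0 by (rule mult_left_mono)
    with z(2) have "z \<le> (2 * Q / l) * ln (1 + z / \<epsilon>)" by (simp add: mult_ac)
    then have "z powr p \<le> ((2 * Q / l) * ln (1 + z / \<epsilon>)) powr p" using z p by (intro powr_mono2) auto
    also have "\<dots> = (2 * Q / l) powr p * ln (1 + z / \<epsilon>) powr p"
      by (rule powr_mult)
    finally show ?thesis unfolding l_def[symmetric] by (simp add: add_increasing)
  qed
qed

text \<open>
  The constant of \<open>maximal_function_strong_type\<close> in dimension \<open>CARD('n)\<close>.
\<close>

abbreviation maximal_constant :: "'n::finite itself \<Rightarrow> real \<Rightarrow> real" where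
  "maximal_constant _ p \<equiv> 2 powr p * p * 5 ^ CARD('n) / (p - 1)"

text \<open>
  The estimate at a fixed time: \<open>\<Phi>\<close> and \<open>\<Phi>'\<close> are the two flow maps, \<open>B\<close> is the first field and
  \<open>G\<close> its derivative, and \<open>Bb\<close>, \<open>Bb'\<close>, \<open>Gb\<close> are Borel versions. Inserting \<open>B(\<Phi>')\<close> splits the quotient
  into an increment of \<open>B\<close>, in which the distance cancels against the denominator, and the difference
  of the fields along \<open>\<Phi>'\<close> divided by \<open>\<epsilon>\<close>. The difference is known to be small only on the ball of
  radius \<open>R\<close>, into which \<open>\<Phi>'\<close> maps almost all of the ball of radius \<open>r\<close>.
\<close>

lemma slice_estimate:
  fixes B Bb Bb' :: "real^'n::finite \<Rightarrow> real^'n" and G Gb :: "real^'n \<Rightarrow> real^'n^'n" and \<Phi> \<Phi>' :: "real^'n \<Rightarrow> real^'n"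
  assumes p: "1 < p" and \<epsilon>: "0 < \<epsilon>" and Cs: "0 < Cs" and L: "0 < L" "0 < L'"
    and N1: "N1 \<in> null_sets lborel" and pointwise: "\<And>x y m m'. x \<notin> N1 \<Longrightarrow> y \<notin> N1 \<Longrightarrow> 0 \<le> m \<Longrightarrow> 0 \<le> m' \<Longrightarrow>
        norm_maximal G x \<le> ennreal m \<Longrightarrow>
        norm_maximal G y \<le> ennreal m' \<Longrightarrow>
        norm (B x - B y) \<le> Cs * norm (x - y) * (m + m')"
    and Bb [measurable]: "Bb \<in> borel_measurable borel" and B_eq: "AE x in lborel. B x = Bb x"
    and Bb' [measurable]: "Bb' \<in> borel_measurable borel"
    and Gb [measurable]: "Gb \<in> borel_measurable borel" and G_eq: "AE x in lborel. G x = Gb x"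
    and a: "0 \<le> a" "(\<integral>\<^sup>+x. ennreal (norm (Gb x) powr p) \<partial>lborel) = ennreal (a powr p)"
    and c: "0 \<le> c" "(\<integral>\<^sup>+x\<in>ball 0 R. ennreal (norm (Bb x - Bb' x) powr p) \<partial>lborel) = ennreal (c powr p)"
    and \<Phi> [measurable]: "\<Phi> \<in> borel_measurable lebesgue" "\<Phi>' \<in> borel_measurable lebesgue"
    and \<Phi>_null: "\<And>N. N \<in> null_sets lborel \<Longrightarrow> AE x in lborel. \<Phi> x \<notin> N"
      "\<And>N. N \<in> null_sets lborel \<Longrightarrow> AE x in lborel. \<Phi>' x \<notin> N"
    and \<Phi>_push: "\<And>g. g \<in> borel_measurable borel \<Longrightarrow> (\<integral>\<^sup>+x. g (\<Phi> x) \<partial>lborel) \<le> ennreal L * (\<integral>\<^sup>+x. g x \<partial>lborel)"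
      "\<And>g. g \<in> borel_measurable borel \<Longrightarrow> (\<integral>\<^sup>+x. g (\<Phi>' x) \<partial>lborel) \<le> ennreal L' * (\<integral>\<^sup>+x. g x \<partial>lborel)"
    and ball: "AE x in lborel. x \<in> ball 0 r \<longrightarrow> \<Phi>' x \<in> ball 0 R"
  shows "(\<integral>\<^sup>+x\<in>ball 0 r. ennreal ((norm (Bb (\<Phi> x) - Bb' (\<Phi>' x)) / (\<epsilon> + norm (\<Phi> x - \<Phi>' x))) powr p) \<partial>lborel)
     \<le> ennreal ((3 * (Cs * ((L + L') * maximal_constant TYPE('n) p) powr (1 / p) * a + L' powr (1 / p) * c / \<epsilon>)) powr p)"
proof -
  let ?Cm = "maximal_constant TYPE('n) p"
  have Cm: "0 < ?Cm" using p by simp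
  define M where "M = norm_maximal Gb"
  have [measurable]: "M \<in> borel_measurable borel" unfolding M_def by measurable
  have M_eq: "norm_maximal G = M"
    unfolding M_def
  proof (rule maximal_function_cong_AE)
    show "AE z in lborel. ennreal (norm (G z)) = ennreal (norm (Gb z))"
      using G_eq by eventually_elim simp
  qed
  define m where "m z = enn2real (M z)" for z
  have [measurable]: "m \<in> borel_measurable borel" unfolding m_def by measurable
  have m0: "0 \<le> m z" for z by (simp add: m_def)
  have fin: "(\<integral>\<^sup>+x. ennreal (norm (Gb x) powr p) \<partial>lborel) < \<infinity>" unfolding a by simp
  have M_fin: "AE z in lborel. M z < \<infinity>"
    unfolding M_def by (rule maximal_function_strong_type(1)[OF _ _ p fin]) auto
  have M_int: "(\<integral>\<^sup>+z. ennreal (m z powr p) \<partial>lborel) \<le> ennreal ?Cm * ennreal (a powr p)"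
    using maximal_function_strong_type(2)[OF _ _ p fin] unfolding m_def M_def a by simp
  have "AE z in lborel. z \<notin> N1 \<and> B z = Bb z \<and> M z < \<infinity>"
    using AE_not_in[OF N1] B_eq M_fin by eventually_elim simp
  then obtain N where N: "N \<in> null_sets lborel" "\<And>z. z \<notin> N \<Longrightarrow> z \<notin> N1 \<and> B z = Bb z \<and> M z < \<infinity>"
    by (rule AE_obtain_null_set) blast
  let ?q = "\<lambda>x. norm (Bb (\<Phi> x) - Bb' (\<Phi>' x)) / (\<epsilon> + norm (\<Phi> x - \<Phi>' x))"
  let ?d = "\<lambda>z. norm (Bb z - Bb' z)"
  let ?k = "ennreal (3 powr p * Cs powr p)" and ?e = "ennreal (3 powr p * (1 / \<epsilon>) powr p)"
  have "AE x in lborel. ennreal (?q x powr p) * indicator (ball 0 r) x \<le>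
      ?k * ennreal (m (\<Phi> x) powr p) + ?k * ennreal (m (\<Phi>' x) powr p) + ?e * (ennreal (?d (\<Phi>' x) powr p) * indicator (ball 0 R) (\<Phi>' x))"
    using \<Phi>_null(1)[OF N(1)] \<Phi>_null(2)[OF N(1)] ball
  proof eventually_elim
    case (elim x)
    show ?case
    proof (cases "x \<in> ball 0 r")
      case True
      have n1: "B (\<Phi> x) = Bb (\<Phi> x)" "B (\<Phi>' x) = Bb (\<Phi>' x)" "\<Phi> x \<notin> N1" "\<Phi>' x \<notin> N1"
        "M (\<Phi> x) \<le> ennreal (m (\<Phi> x))" "M (\<Phi>' x) \<le> ennreal (m (\<Phi>' x))"
        using N(2)[OF elim(1)] N(2)[OF elim(2)] by (auto simp: m_def)
      let ?z = "norm (\<Phi> x - \<Phi>' x)"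
      have "norm (Bb (\<Phi> x) - Bb (\<Phi>' x)) \<le> Cs * ?z * (m (\<Phi> x) + m (\<Phi>' x))"
        using pointwise[OF n1(3,4) m0 m0, unfolded M_eq, OF n1(5,6)] n1(1,2) by simp
      moreover have "norm (Bb (\<Phi> x) - Bb' (\<Phi>' x)) \<le> norm (Bb (\<Phi> x) - Bb (\<Phi>' x)) + ?d (\<Phi>' x)"
        using norm_triangle_ineq[of "Bb (\<Phi> x) - Bb (\<Phi>' x)" "Bb (\<Phi>' x) - Bb' (\<Phi>' x)"] by simp
      ultimately have "norm (Bb (\<Phi> x) - Bb' (\<Phi>' x)) \<le> Cs * ?z * (m (\<Phi> x) + m (\<Phi>' x)) + ?d (\<Phi>' x)" by linarith
      also have "\<dots> \<le> (Cs * m (\<Phi> x) + Cs * m (\<Phi>' x) + 1 / \<epsilon> * ?d (\<Phi>' x)) * (\<epsilon> + ?z)"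
      proof -
        have "0 \<le> \<epsilon> * (Cs * m (\<Phi> x) + Cs * m (\<Phi>' x)) + 1 / \<epsilon> * ?d (\<Phi>' x) * ?z"
          using \<epsilon> Cs m0 by (intro add_nonneg_nonneg mult_nonneg_nonneg) auto
        moreover have "(Cs * m (\<Phi> x) + Cs * m (\<Phi>' x) + 1 / \<epsilon> * ?d (\<Phi>' x)) * (\<epsilon> + ?z) =
            Cs * ?z * (m (\<Phi> x) + m (\<Phi>' x)) + ?d (\<Phi>' x) +
            (\<epsilon> * (Cs * m (\<Phi> x) + Cs * m (\<Phi>' x)) + 1 / \<epsilon> * ?d (\<Phi>' x) * ?z)"
          using \<epsilon> by (simp add: field_simps)
        ultimately show ?thesis by linarith
      qed
      finally have "?q x \<le> Cs * m (\<Phi> x) + Cs * m (\<Phi>' x) + 1 / \<epsilon> * ?d (\<Phi>' x)"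
        using \<epsilon> by (subst pos_divide_le_eq) (auto intro: add_pos_nonneg)
      then have "?q x powr p \<le> (Cs * m (\<Phi> x) + Cs * m (\<Phi>' x) + 1 / \<epsilon> * ?d (\<Phi>' x)) powr p"
        using \<epsilon> p by (intro powr_mono2) auto
      also have "\<dots> \<le> 3 powr p * ((Cs * m (\<Phi> x)) powr p + (Cs * m (\<Phi>' x)) powr p + (1 / \<epsilon> * ?d (\<Phi>' x)) powr p)"
        using p Cs m0 \<epsilon> by (intro powr_sum3_le) auto
      also have "\<dots> = 3 powr p * Cs powr p * m (\<Phi> x) powr p + 3 powr p * Cs powr p * m (\<Phi>' x) powr p
          + 3 powr p * (1 / \<epsilon>) powr p * ?d (\<Phi>' x) powr p"
        using Cs m0 \<epsilon> by (simp add: powr_mult powr_divide distrib_left mult.assoc)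
      finally have "ennreal (?q x powr p) \<le> ennreal (3 powr p * Cs powr p * m (\<Phi> x) powr p + 3 powr p * Cs powr p * m (\<Phi>' x) powr p
          + 3 powr p * (1 / \<epsilon>) powr p * ?d (\<Phi>' x) powr p)" by (rule ennreal_leI)
      also have "\<dots> = ?k * ennreal (m (\<Phi> x) powr p) + ?k * ennreal (m (\<Phi>' x) powr p) + ?e * ennreal (?d (\<Phi>' x) powr p)"
        by (simp add: ennreal_plus ennreal_mult)
      finally show ?thesis using True elim(3) by simp
    qed simp
  qed
  then have "(\<integral>\<^sup>+x\<in>ball 0 r. ennreal (?q x powr p) \<partial>lborel) \<le>
      (\<integral>\<^sup>+x. ?k * ennreal (m (\<Phi> x) powr p) + ?k * ennreal (m (\<Phi>' x) powr p) + ?e * (ennreal (?d (\<Phi>' x) powr p) * indicator (ball 0 R) (\<Phi>' x)) \<partial>lborel)"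
    by (rule nn_integral_mono_AE)
  also have "\<dots> = (\<integral>\<^sup>+x. ?k * ennreal (m (\<Phi> x) powr p) + ?k * ennreal (m (\<Phi>' x) powr p) + ?e * (ennreal (?d (\<Phi>' x) powr p) * indicator (ball 0 R) (\<Phi>' x)) \<partial>lebesgue)"
    by (rule nn_integral_completion[symmetric])
  also have "\<dots> = ?k * (\<integral>\<^sup>+x. ennreal (m (\<Phi> x) powr p) \<partial>lebesgue) + ?k * (\<integral>\<^sup>+x. ennreal (m (\<Phi>' x) powr p) \<partial>lebesgue)
      + ?e * (\<integral>\<^sup>+x. ennreal (?d (\<Phi>' x) powr p) * indicator (ball 0 R) (\<Phi>' x) \<partial>lebesgue)"
  proof -
    have [measurable]: "(\<lambda>x. m (\<Phi> x)) \<in> borel_measurable lebesgue" "(\<lambda>x. m (\<Phi>' x)) \<in> borel_measurable lebesgue"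
      "(\<lambda>x. ?d (\<Phi>' x)) \<in> borel_measurable lebesgue" "(\<lambda>x. indicator (ball 0 R) (\<Phi>' x) :: ennreal) \<in> borel_measurable lebesgue"
      by measurable
    show ?thesis by (simp add: nn_integral_add nn_integral_cmult)
  qed
  also have "\<dots> \<le> ?k * (ennreal L * (ennreal ?Cm * ennreal (a powr p))) + ?k * (ennreal L' * (ennreal ?Cm * ennreal (a powr p)))
      + ?e * (ennreal L' * ennreal (c powr p))"
  proof (intro add_mono mult_left_mono)
    have "(\<integral>\<^sup>+x. ennreal (m (\<Phi> x) powr p) \<partial>lebesgue) \<le> ennreal L * (\<integral>\<^sup>+x. ennreal (m x powr p) \<partial>lborel)"
      unfolding nn_integral_completion by (rule \<Phi>_push(1)) measurable
    also have "\<dots> \<le> ennreal L * (ennreal ?Cm * ennreal (a powr p))" using M_int by (rule mult_left_mono) simp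
    finally show "(\<integral>\<^sup>+x. ennreal (m (\<Phi> x) powr p) \<partial>lebesgue) \<le> ennreal L * (ennreal ?Cm * ennreal (a powr p))" .
    have "(\<integral>\<^sup>+x. ennreal (m (\<Phi>' x) powr p) \<partial>lebesgue) \<le> ennreal L' * (\<integral>\<^sup>+x. ennreal (m x powr p) \<partial>lborel)"
      unfolding nn_integral_completion by (rule \<Phi>_push(2)) measurable
    also have "\<dots> \<le> ennreal L' * (ennreal ?Cm * ennreal (a powr p))" using M_int by (rule mult_left_mono) simp
    finally show "(\<integral>\<^sup>+x. ennreal (m (\<Phi>' x) powr p) \<partial>lebesgue) \<le> ennreal L' * (ennreal ?Cm * ennreal (a powr p))" .
    show "(\<integral>\<^sup>+x. ennreal (?d (\<Phi>' x) powr p) * indicator (ball 0 R) (\<Phi>' x) \<partial>lebesgue) \<le> ennreal L' * ennreal (c powr p)"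
      unfolding nn_integral_completion c(2)[symmetric]
      by (rule \<Phi>_push(2)[of "\<lambda>z. ennreal (?d z powr p) * indicator (ball 0 R) z"]) measurable
  qed simp_all
  also have "\<dots> = ennreal (3 powr p * Cs powr p * ((L + L') * ?Cm) * a powr p + 3 powr p * (1 / \<epsilon>) powr p * L' * c powr p)"
  proof -
    have "3 powr p * Cs powr p * ((L + L') * ?Cm) * a powr p + 3 powr p * (1 / \<epsilon>) powr p * L' * c powr p =
      3 powr p * Cs powr p * (L * (?Cm * a powr p)) + 3 powr p * Cs powr p * (L' * (?Cm * a powr p)) + 3 powr p * (1 / \<epsilon>) powr p * (L' * c powr p)"
      by (simp only: distrib_left distrib_right mult.assoc)
    moreover have "0 \<le> ?Cm" using Cm by linarith
    ultimately show ?thesis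
      using L by (simp only: ennreal_plus ennreal_mult mult_nonneg_nonneg add_nonneg_nonneg powr_ge_zero less_imp_le)
  qed
  also have "\<dots> \<le> ennreal ((3 * (Cs * ((L + L') * ?Cm) powr (1 / p) * a + L' powr (1 / p) * c / \<epsilon>)) powr p)"
  proof (rule ennreal_leI)
    let ?u = "3 * (Cs * ((L + L') * ?Cm) powr (1 / p) * a)" and ?v = "3 * (L' powr (1 / p) * c / \<epsilon>)"
    have LC: "0 \<le> (L + L') * ?Cm" using L Cm by (intro mult_nonneg_nonneg) linarith+
    have "(3 * (Cs * A powr (1 / p) * a)) powr p = 3 powr p * Cs powr p * A * a powr p" if "0 \<le> A" for A
      using that p by (simp add: powr_mult powr_powr)
    from this[OF LC] have "?u powr p = 3 powr p * Cs powr p * ((L + L') * ?Cm) * a powr p" .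
    moreover have "?v powr p = 3 powr p * (1 / \<epsilon>) powr p * L' * c powr p"
      using L c \<epsilon> p by (simp add: powr_mult powr_divide powr_powr)
    moreover have "?u powr p + ?v powr p \<le> (?u + ?v) powr p"
      using p Cs L a c \<epsilon> by (intro powr_superadditive) auto
    ultimately show "3 powr p * Cs powr p * ((L + L') * ?Cm) * a powr p + 3 powr p * (1 / \<epsilon>) powr p * L' * c powr p \<le>
        (3 * (Cs * ((L + L') * ?Cm) powr (1 / p) * a + L' powr (1 / p) * c / \<epsilon>)) powr p"
      by (simp only: distrib_left)
  qed
  finally show ?thesis .
qed

lemma AE_slice_eq:
  assumes N: "N \<in> null_sets spacetime" and eq: "\<And>t x. t \<in> {0..T} \<Longrightarrow> (t, x) \<notin> N \<Longrightarrow> f t x = g t x"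
  shows "AE t in lborel. t \<in> {0..T} \<longrightarrow> (AE x in lborel. f t x = g t x)"
  using AE_slice_null[OF N]
proof eventually_elim
  case (elim t)
  from AE_not_in[OF this] have "AE x in lborel. (t, x) \<notin> N" by simp
  then show ?case using eq by (auto elim!: eventually_mono)
qed

lemma flow_displacement_le:
  fixes X :: "real \<Rightarrow> real^'n::finite \<Rightarrow> real^'n"
  assumes X: "compressibility_constant T X L"
    and sol: "AE x in lborel. integral_solution T b x (\<lambda>t. X t x)"
    and Y: "(\<lambda>(t, x). Y t x) \<in> borel_measurable spacetime" and Z: "Z \<in> null_sets lborel"
    and XY: "\<And>t x. x \<notin> Z \<Longrightarrow> t \<in> {0..T} \<Longrightarrow> Y t x = X t x"
    and M: "Linf_norm T b = ennreal M" "0 \<le> M"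
  shows "AE x in lborel. \<forall>t\<in>{0..T}. norm (X t x - x) \<le> M * t"
proof -
  obtain N where N: "N \<in> null_sets spacetime" "\<And>t x. t \<in> {0..T} \<Longrightarrow> (t, x) \<notin> N \<Longrightarrow> norm (b t x) \<le> M"
    using Linf_norm_bound[OF M] by blast
  have "AE x in lborel. AE t in lborel. t \<in> {0..T} \<longrightarrow> (t, X t x) \<notin> N"
    by (rule compressible_flow_avoids_null[OF X N(1) Y Z XY])
  with sol show ?thesis
  proof eventually_elim
    case (elim x)
    from elim(2) have "AE t in lborel. t \<in> {0..T} \<longrightarrow> norm (b t (X t x)) \<le> M"
      by eventually_elim (use N(2) in auto)
    with integral_solution_displacement[OF elim(1) _ M(2)] show ?case by blast
  qed
qed

text \<open>
  The difference of the two trajectories is the indefinite integral of the difference of the fields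
  along them.
\<close>

lemma log_difference_le_integral:
  fixes b b' :: "real \<Rightarrow> real^'n::finite \<Rightarrow> real^'n"
  assumes sol: "integral_solution T b x \<gamma>" "integral_solution T b' x \<gamma>'" and t: "0 \<le> t" "t \<le> \<tau>" "\<tau> \<le> T" and \<epsilon>: "0 < \<epsilon>"
  shows "ennreal (ln (1 + norm (\<gamma> t - \<gamma>' t) / \<epsilon>)) \<le>
    (\<integral>\<^sup>+s\<in>{0..\<tau>}. ennreal (norm (b s (\<gamma> s) - b' s (\<gamma>' s)) / (\<epsilon> + norm (\<gamma> s - \<gamma>' s))) \<partial>lborel)"
proof -
  let ?h = "\<lambda>s. b s (\<gamma> s) - b' s (\<gamma>' s)"
  have abs: "(\<lambda>s. b s (\<gamma> s)) absolutely_integrable_on {0..u}" "(\<lambda>s. b' s (\<gamma>' s)) absolutely_integrable_on {0..u}" if "u \<le> T" for u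
    using sol that unfolding integral_solution_def
    by (auto intro: set_integrable_subset[where A="{0..T}"])
  have h: "?h absolutely_integrable_on {0..t}"
    using t by (intro set_integral_diff(1) abs) auto
  have "ennreal (ln (1 + norm (\<gamma> t - \<gamma>' t) / \<epsilon>)) \<le>
      (\<integral>\<^sup>+s\<in>{0..t}. ennreal (norm (?h s) / (\<epsilon> + norm (\<gamma> s - \<gamma>' s))) \<partial>lborel)"
  proof (rule ln_norm_indefinite_integral_le[OF t(1) \<epsilon> h])
    fix s assume s: "s \<in> {0..t}"
    have "integral {0..s} ?h = integral {0..s} (\<lambda>s. b s (\<gamma> s)) - integral {0..s} (\<lambda>s. b' s (\<gamma>' s))"
      using s t by (intro Henstock_Kurzweil_Integration.integral_diff set_lebesgue_integral_eq_integral(1) abs) auto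
    then show "\<gamma> s - \<gamma>' s = integral {0..s} ?h"
      using sol s t unfolding integral_solution_def by simp
  qed
  also have "\<dots> \<le> (\<integral>\<^sup>+s\<in>{0..\<tau>}. ennreal (norm (?h s) / (\<epsilon> + norm (\<gamma> s - \<gamma>' s))) \<partial>lborel)"
    using t by (intro nn_integral_mono mult_left_mono indicator_leI) auto
  finally show ?thesis .
qed

text \<open>
  Here \<open>W\<close> bounds the \<open>L\<^sup>p\<close> norm over the ball of \<open>ln (1 + |X - X'| / \<epsilon>)\<close>: the slice estimate integrated
  over \<open>[0, \<tau>]\<close> contributes multiples of \<open>K\<close> and of \<open>\<delta> / \<epsilon> \<le> 1\<close>. All time-dependent objects are replaced by
  Borel versions (\<open>Y\<close>, \<open>Y'\<close>, \<open>bb\<close>, \<open>bb'\<close>, \<open>Db\<close>), while the pointwise Lipschitz estimate, whose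
  exceptional set depends on time without any joint measurability, is used for one time at a time.
\<close>

lemma stability_at_scale:
  fixes b b' :: "real \<Rightarrow> real^'n::finite \<Rightarrow> real^'n" and D :: "real \<Rightarrow> real^'n \<Rightarrow> real^'n^'n"
    and X X' :: "real \<Rightarrow> real^'n \<Rightarrow> real^'n"
  assumes p: "1 < p" and r: "0 < r" and M: "0 \<le> M" "0 \<le> M'" and L: "0 < L" "0 < L'" and K: "0 \<le> K"
    and Cs: "0 < Cs" "\<And>(f :: real^'n \<Rightarrow> real^'n) G. has_weak_derivative f G \<Longrightarrow>
      maximal_Lipschitz Cs f G"
    and T: "\<tau> \<le> T" and bW: "b \<in> L1_W1p T p" "b' \<in> L1_W1p T p"
    and bM: "Linf_norm T b = ennreal M" "Linf_norm T b' = ennreal M'"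
    and D: "spatial_weak_derivative T b D" "L1_Lp_norm T p UNIV D = ennreal K"
    and X: "regular_Lagrangian_flow T b X" "compressibility_constant T X L"
    and X': "regular_Lagrangian_flow T b' X'" "compressibility_constant T X' L'"
    and \<delta>: "L1_Lp_norm \<tau> p (ball 0 (r + T * M')) (\<lambda>t x. b t x - b' t x) \<le> ennreal \<epsilon>"
    and \<epsilon>: "0 < \<epsilon>" "\<epsilon> < 1" and t: "t \<in> {0..\<tau>}"
  defines "W \<equiv> 3 * (Cs * ((L + L') * maximal_constant TYPE('n) p) powr (1 / p) * K + L' powr (1 / p)) + \<tau> + 1"
  shows "eLp_norm p (ball 0 r) (\<lambda>x. X t x - X' t x) \<le>
    ennreal ((2 powr p * measure lborel (ball (0::real^'n) r) + (2 * (\<tau> * (M + M')) * W) powr p) powr (1 / p) / \<bar>ln \<epsilon>\<bar>)"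
proof -
  define R where "R = r + T * M'"
  define k1 where "k1 = Cs * ((L + L') * maximal_constant TYPE('n) p) powr (1 / p)"
  define k2 where "k2 = L' powr (1 / p)"
  have k: "0 \<le> k1" "0 \<le> k2" using Cs(1) by (auto simp: k1_def k2_def)
  have \<tau>: "0 \<le> \<tau>" using t by simp
  have W: "W = 3 * (k1 * K + k2) + \<tau> + 1" by (simp add: W_def k1_def k2_def)
  have W0: "0 < W" unfolding W using k K \<tau> by (simp add: add_nonneg_pos)
  have sol: "AE x in lborel. integral_solution T b x (\<lambda>t. X t x)" "AE x in lborel. integral_solution T b' x (\<lambda>t. X' t x)"
    using X(1) X'(1) unfolding regular_Lagrangian_flow_def by (simp_all add: AE_completion_iff)
  have "AE x in lebesgue. continuous_on {0..T} (\<lambda>t. X t x)"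
    using AE_completion[OF sol(1)] by eventually_elim (rule integral_solution_continuous)
  then obtain Y Z where Y [measurable]: "(\<lambda>(t, x). Y t x) \<in> borel_measurable spacetime" and Z: "Z \<in> null_sets lborel"
    and XY: "\<And>t x. x \<notin> Z \<Longrightarrow> t \<in> {0..T} \<Longrightarrow> Y t x = X t x"
    using time_sampled_borel_version[of T X] compressible_measurable[OF X(2)] by blast
  have "AE x in lebesgue. continuous_on {0..T} (\<lambda>t. X' t x)"
    using AE_completion[OF sol(2)] by eventually_elim (rule integral_solution_continuous)
  then obtain Y' Z' where Y' [measurable]: "(\<lambda>(t, x). Y' t x) \<in> borel_measurable spacetime" and Z': "Z' \<in> null_sets lborel"
    and XY': "\<And>t x. x \<notin> Z' \<Longrightarrow> t \<in> {0..T} \<Longrightarrow> Y' t x = X' t x"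
    using time_sampled_borel_version[of T X'] compressible_measurable[OF X'(2)] by blast
  have Z_ae: "AE x in lborel. x \<notin> Z" "AE x in lborel. x \<notin> Z'" using Z Z' by (auto intro: AE_not_in)
  have jm: "jointly_measurable T b" "jointly_measurable T b'" "jointly_measurable T D"
    using bW D(1) by (auto simp: L1_W1p_def L1_Lp_def spatial_weak_derivative_def)
  obtain bb Nb where bb [measurable]: "(\<lambda>(t, x). bb t x) \<in> borel_measurable spacetime" and Nb: "Nb \<in> null_sets spacetime"
    and b_eq: "\<And>t x. t \<in> {0..T} \<Longrightarrow> (t, x) \<notin> Nb \<Longrightarrow> b t x = bb t x"
    by (rule jointly_measurable_borel_version[OF jm(1)]) blast
  obtain bb' Nb' where bb' [measurable]: "(\<lambda>(t, x). bb' t x) \<in> borel_measurable spacetime" and Nb': "Nb' \<in> null_sets spacetime"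
    and b'_eq: "\<And>t x. t \<in> {0..T} \<Longrightarrow> (t, x) \<notin> Nb' \<Longrightarrow> b' t x = bb' t x"
    by (rule jointly_measurable_borel_version[OF jm(2)]) blast
  obtain Db ND where Db [measurable]: "(\<lambda>(t, x). Db t x) \<in> borel_measurable spacetime" and ND: "ND \<in> null_sets spacetime"
    and D_eq: "\<And>t x. t \<in> {0..T} \<Longrightarrow> (t, x) \<notin> ND \<Longrightarrow> D t x = Db t x"
    by (rule jointly_measurable_borel_version[OF jm(3)]) blast
  have b_slice: "AE t in lborel. t \<in> {0..T} \<longrightarrow> (AE x in lborel. b t x = bb t x)"
    by (rule AE_slice_eq[OF Nb b_eq])
  have b'_slice: "AE t in lborel. t \<in> {0..T} \<longrightarrow> (AE x in lborel. b' t x = bb' t x)"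
    by (rule AE_slice_eq[OF Nb' b'_eq])
  have D_slice: "AE t in lborel. t \<in> {0..T} \<longrightarrow> (AE x in lborel. D t x = Db t x)"
    by (rule AE_slice_eq[OF ND D_eq])
  have b_good: "AE x in lborel. AE t in lborel. t \<in> {0..T} \<longrightarrow> (t, X t x) \<notin> Nb"
    by (rule compressible_flow_avoids_null[OF X(2) Nb Y Z XY])
  have b'_good: "AE x in lborel. AE t in lborel. t \<in> {0..T} \<longrightarrow> (t, X' t x) \<notin> Nb'"
    by (rule compressible_flow_avoids_null[OF X'(2) Nb' Y' Z' XY'])
  have wd: "AE s in lborel. s \<in> {0..T} \<longrightarrow> has_weak_derivative (b s) (D s)"
    using D(1) unfolding spatial_weak_derivative_def
    by (subst (asm) AE_restrict_space_iff) (simp_all add: AE_completion_iff)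
  obtain a where a [measurable]: "a \<in> borel_measurable borel" and a0: "\<And>t. 0 \<le> a t"
    and a_int: "(\<integral>\<^sup>+t\<in>{0..T}. ennreal (a t) \<partial>lborel) \<le> ennreal K"
    and a_slice: "AE t in lborel. t \<in> {0..T} \<longrightarrow> (\<integral>\<^sup>+x\<in>UNIV. ennreal (norm (Db t x) powr p) \<partial>lborel) = ennreal (a t powr p)"
    by (rule mixed_norm_slices[OF Db _ D_slice, of UNIV p K]) (use D(2) p in auto)
  have dbb: "(\<lambda>(t, x). bb t x - bb' t x) \<in> borel_measurable spacetime"
    using bb bb' unfolding case_prod_beta by measurable
  have db_slice: "AE s in lborel. s \<in> {0..\<tau>} \<longrightarrow> (AE x in lborel. b s x - b' s x = bb s x - bb' s x)"
    using b_slice b'_slice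
  proof eventually_elim
    case (elim s)
    show ?case
    proof
      assume "s \<in> {0..\<tau>}"
      then have "AE x in lborel. b s x = bb s x" "AE x in lborel. b' s x = bb' s x" using elim T by auto
      then show "AE x in lborel. b s x - b' s x = bb s x - bb' s x" by eventually_elim simp
    qed
  qed
  obtain c where c [measurable]: "c \<in> borel_measurable borel" and c0: "\<And>t. 0 \<le> c t"
    and c_int: "(\<integral>\<^sup>+t\<in>{0..\<tau>}. ennreal (c t) \<partial>lborel) \<le> ennreal \<epsilon>"
    and c_slice: "AE t in lborel. t \<in> {0..\<tau>} \<longrightarrow> (\<integral>\<^sup>+x\<in>ball 0 R. ennreal (norm (bb t x - bb' t x) powr p) \<partial>lborel) = ennreal (c t powr p)"
    by (rule mixed_norm_slices[OF dbb _ db_slice, of "ball 0 R" p \<epsilon>]) (use \<delta> p in \<open>auto simp: R_def\<close>)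
  have disp: "AE x in lborel. \<forall>t\<in>{0..T}. norm (X t x - x) \<le> M * t"
    by (rule flow_displacement_le[OF X(2) sol(1) Y Z XY bM(1) M(1)])
  have disp': "AE x in lborel. \<forall>t\<in>{0..T}. norm (X' t x - x) \<le> M' * t"
    by (rule flow_displacement_le[OF X'(2) sol(2) Y' Z' XY' bM(2) M(2)])
  define H where "H s x = indicator (ball 0 r) x * (norm (bb s (Y s x) - bb' s (Y' s x)) / (\<epsilon> + norm (Y s x - Y' s x)))" for s x
  define S where "S x = indicator (ball 0 r) x * ln (1 + norm (X t x - X' t x) / \<epsilon>)" for x
  \<comment> \<open>The summand \<open>1\<close> makes the weight positive, as Minkowski's inequality above requires.
     Its integral accounts for \<open>\<tau>\<close> in \<open>W\<close>.\<close>
  define w where "w s = 3 * (k1 * a s + k2 * c s / \<epsilon>) + 1" for s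
  have S_int: "(\<integral>\<^sup>+x. ennreal (S x powr p) \<partial>lborel) \<le> ennreal (W powr p)"
  proof (rule lborel_pair.Minkowski_integral_inequality[where H=H and w=w and A="{0..\<tau>}"])
    have m1: "(\<lambda>q. (fst q, Y (fst q) (snd q))) \<in> measurable spacetime spacetime"
      "(\<lambda>q. (fst q, Y' (fst q) (snd q))) \<in> measurable spacetime spacetime"
      using Y Y' unfolding case_prod_beta by measurable
    have [measurable]: "(\<lambda>q. bb (fst q) (Y (fst q) (snd q))) \<in> borel_measurable spacetime"
      "(\<lambda>q. bb' (fst q) (Y' (fst q) (snd q))) \<in> borel_measurable spacetime"
      using measurable_compose[OF m1(1) bb] measurable_compose[OF m1(2) bb'] by simp_all
    have [measurable]: "(\<lambda>q. Y (fst q) (snd q)) \<in> borel_measurable spacetime"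
      "(\<lambda>q. Y' (fst q) (snd q)) \<in> borel_measurable spacetime"
      using Y Y' by (simp_all add: case_prod_beta)
    show "case_prod H \<in> borel_measurable spacetime"
      unfolding H_def case_prod_beta by measurable
    show "0 \<le> H s x" for s x using \<epsilon> by (simp add: H_def)
    show "w \<in> borel_measurable lborel" unfolding w_def by measurable
    show "0 < w s" for s
    proof -
      have "0 \<le> k1 * a s + k2 * c s / \<epsilon>" using k a0 c0 \<epsilon> by (intro add_nonneg_nonneg mult_nonneg_nonneg divide_nonneg_pos) auto
      then show ?thesis unfolding w_def by (intro add_nonneg_pos mult_nonneg_nonneg) auto
    qed
    show "(\<integral>\<^sup>+s\<in>{0..\<tau>}. ennreal (w s) \<partial>lborel) \<le> ennreal W"
    proof -
      have "(\<integral>\<^sup>+s\<in>{0..\<tau>}. ennreal (w s) \<partial>lborel) =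
        (\<integral>\<^sup>+s. ennreal (3 * k1) * (ennreal (a s) * indicator {0..\<tau>} s) + ennreal (3 * k2 / \<epsilon>) * (ennreal (c s) * indicator {0..\<tau>} s) + indicator {0..\<tau>} s \<partial>lborel)"
      proof (rule nn_integral_cong)
        fix s
        have "w s = 3 * k1 * a s + 3 * k2 / \<epsilon> * c s + 1" by (simp add: w_def algebra_simps)
        then have "ennreal (w s) = ennreal (3 * k1) * ennreal (a s) + ennreal (3 * k2 / \<epsilon>) * ennreal (c s) + 1"
          using k a0[of s] c0[of s] \<epsilon>
          by (simp only: ennreal_plus ennreal_mult ennreal_1 mult_nonneg_nonneg divide_nonneg_pos add_nonneg_nonneg zero_le_numeral zero_le_one)
        then show "ennreal (w s) * indicator {0..\<tau>} s = ennreal (3 * k1) * (ennreal (a s) * indicator {0..\<tau>} s)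
            + ennreal (3 * k2 / \<epsilon>) * (ennreal (c s) * indicator {0..\<tau>} s) + indicator {0..\<tau>} s"
          by (simp split: split_indicator)
      qed
      also have "\<dots> = ennreal (3 * k1) * (\<integral>\<^sup>+s\<in>{0..\<tau>}. ennreal (a s) \<partial>lborel) + ennreal (3 * k2 / \<epsilon>) * (\<integral>\<^sup>+s\<in>{0..\<tau>}. ennreal (c s) \<partial>lborel) + ennreal \<tau>"
        using \<tau> by (simp add: nn_integral_add nn_integral_cmult)
      also have "\<dots> \<le> ennreal (3 * k1) * ennreal K + ennreal (3 * k2 / \<epsilon>) * ennreal \<epsilon> + ennreal \<tau>"
      proof (intro add_mono mult_left_mono c_int order_refl)
        have "(\<integral>\<^sup>+s\<in>{0..\<tau>}. ennreal (a s) \<partial>lborel) \<le> (\<integral>\<^sup>+s\<in>{0..T}. ennreal (a s) \<partial>lborel)"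
          using T by (intro nn_integral_mono mult_left_mono indicator_leI) auto
        also note a_int
        finally show "(\<integral>\<^sup>+s\<in>{0..\<tau>}. ennreal (a s) \<partial>lborel) \<le> ennreal K" .
      qed simp_all
      also have "\<dots> = ennreal (3 * k1 * K + 3 * k2 / \<epsilon> * \<epsilon> + \<tau>)"
        using k K \<epsilon> \<tau>
        by (simp only: ennreal_plus ennreal_mult mult_nonneg_nonneg divide_nonneg_pos add_nonneg_nonneg zero_le_numeral less_imp_le)
      also have "\<dots> \<le> ennreal W"
        unfolding W using \<epsilon> by (intro ennreal_leI) (simp add: algebra_simps)
      finally show ?thesis .
    qed
    show "AE s in lborel. s \<in> {0..\<tau>} \<longrightarrow> (\<integral>\<^sup>+x. ennreal (H s x powr p) \<partial>lborel) \<le> ennreal (w s powr p)"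
      using wd b_slice D_slice a_slice c_slice
    proof eventually_elim
      case (elim s)
      show ?case
      proof
        assume s: "s \<in> {0..\<tau>}"
        then have sT: "s \<in> {0..T}" using T by auto
        obtain N where N: "N \<in> null_sets lborel" "\<And>x y m m'. x \<notin> N \<Longrightarrow> y \<notin> N \<Longrightarrow> 0 \<le> m \<Longrightarrow> 0 \<le> m' \<Longrightarrow>
            norm_maximal (D s) x \<le> ennreal m \<Longrightarrow>
            norm_maximal (D s) y \<le> ennreal m' \<Longrightarrow>
            norm (b s x - b s y) \<le> Cs * norm (x - y) * (m + m')"
          using Cs(2)[of "b s" "D s"] elim(1) sT by meson
        have ball: "AE x in lborel. x \<in> ball 0 r \<longrightarrow> X' s x \<in> ball 0 R"
          using disp'
        proof eventually_elim
          case (elim x)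
          have "norm (X' s x - x) \<le> M' * s" using elim sT by blast
          also have "\<dots> \<le> T * M'" using sT M by (subst mult.commute[of T]) (intro mult_left_mono, auto)
          finally show ?case using norm_triangle_sub[of "X' s x" x] by (simp add: R_def)
        qed
        have sl: "bb s \<in> borel_measurable borel" "bb' s \<in> borel_measurable borel" "Db s \<in> borel_measurable borel"
          using measurable_Pair2[OF bb, of s] measurable_Pair2[OF bb', of s] measurable_Pair2[OF Db, of s] by simp_all
        have est: "(\<integral>\<^sup>+x\<in>ball 0 r. ennreal ((norm (bb s (X s x) - bb' s (X' s x)) / (\<epsilon> + norm (X s x - X' s x))) powr p) \<partial>lborel)
            \<le> ennreal ((3 * (Cs * ((L + L') * maximal_constant TYPE('n) p) powr (1 / p) * a s + L' powr (1 / p) * c s / \<epsilon>)) powr p)"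
        proof (rule slice_estimate[OF p \<epsilon>(1) Cs(1) L N(1) _ sl(1) _ sl(2,3) _ a0 _ c0])
          show "norm (b s x - b s y) \<le> Cs * norm (x - y) * (m + m')"
            if "x \<notin> N" "y \<notin> N" "0 \<le> m" "0 \<le> m'"
              "norm_maximal (D s) x \<le> ennreal m"
              "norm_maximal (D s) y \<le> ennreal m'" for x y m m'
            using that by (rule N(2))
          show "AE x in lborel. b s x = bb s x" using elim(2) sT by blast
          show "AE x in lborel. D s x = Db s x" using elim(3) sT by blast
          show "(\<integral>\<^sup>+x. ennreal (norm (Db s x) powr p) \<partial>lborel) = ennreal (a s powr p)" using elim(4) sT by simp
          show "(\<integral>\<^sup>+x\<in>ball 0 R. ennreal (norm (bb s x - bb' s x) powr p) \<partial>lborel) = ennreal (c s powr p)" using elim(5) s by blast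
          show "X s \<in> borel_measurable lebesgue" "X' s \<in> borel_measurable lebesgue"
            using compressible_measurable[OF X(2) sT] compressible_measurable[OF X'(2) sT] .
          show "AE x in lborel. X s x \<notin> N" "AE x in lborel. X' s x \<notin> N" if "N \<in> null_sets lborel" for N
            using compressible_null_preimage[OF X(2) sT that] compressible_null_preimage[OF X'(2) sT that] .
          show "(\<integral>\<^sup>+x. g (X s x) \<partial>lborel) \<le> ennreal L * (\<integral>\<^sup>+x. g x \<partial>lborel)"
            "(\<integral>\<^sup>+x. g (X' s x) \<partial>lborel) \<le> ennreal L' * (\<integral>\<^sup>+x. g x \<partial>lborel)" if "g \<in> borel_measurable borel" for g
            using compressible_nn_integral_le[OF X(2) sT that] compressible_nn_integral_le[OF X'(2) sT that] .
        qed (rule ball)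
        have "(\<integral>\<^sup>+x. ennreal (H s x powr p) \<partial>lborel) =
            (\<integral>\<^sup>+x\<in>ball 0 r. ennreal ((norm (bb s (X s x) - bb' s (X' s x)) / (\<epsilon> + norm (X s x - X' s x))) powr p) \<partial>lborel)"
        proof (rule nn_integral_cong_AE)
          show "AE x in lborel. ennreal (H s x powr p) =
              ennreal ((norm (bb s (X s x) - bb' s (X' s x)) / (\<epsilon> + norm (X s x - X' s x))) powr p) * indicator (ball 0 r) x"
            using Z_ae by eventually_elim (auto simp: H_def XY[OF _ sT] XY'[OF _ sT] split: split_indicator)
        qed
        also note est
        also have "ennreal ((3 * (Cs * ((L + L') * maximal_constant TYPE('n) p) powr (1 / p) * a s + L' powr (1 / p) * c s / \<epsilon>)) powr p)
            \<le> ennreal (w s powr p)"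
        proof (intro ennreal_leI powr_mono2)
          show "0 \<le> 3 * (Cs * ((L + L') * maximal_constant TYPE('n) p) powr (1 / p) * a s + L' powr (1 / p) * c s / \<epsilon>)"
            unfolding k1_def[symmetric] k2_def[symmetric] using k a0[of s] c0[of s] \<epsilon> by simp
        qed (use p in \<open>simp_all add: w_def k1_def k2_def\<close>)
        finally show "(\<integral>\<^sup>+x. ennreal (H s x powr p) \<partial>lborel) \<le> ennreal (w s powr p)" .
      qed
    qed
    show "0 \<le> S x" for x using \<epsilon> by (simp add: S_def)
    show "AE x in lborel. ennreal (S x) \<le> (\<integral>\<^sup>+s\<in>{0..\<tau>}. ennreal (H s x) \<partial>lborel)"
      using sol Z_ae b_good b'_good
    proof eventually_elim
      case (elim x)
      show ?case
      proof (cases "x \<in> ball 0 r")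
        case True
        have "ennreal (S x) \<le> (\<integral>\<^sup>+s\<in>{0..\<tau>}. ennreal (norm (b s (X s x) - b' s (X' s x)) / (\<epsilon> + norm (X s x - X' s x))) \<partial>lborel)"
          using log_difference_le_integral[OF elim(1,2) _ _ T \<epsilon>(1), of t] t True by (simp add: S_def)
        also have "\<dots> = (\<integral>\<^sup>+s\<in>{0..\<tau>}. ennreal (H s x) \<partial>lborel)"
        proof (rule nn_integral_cong_AE)
          show "AE s in lborel. ennreal (norm (b s (X s x) - b' s (X' s x)) / (\<epsilon> + norm (X s x - X' s x))) * indicator {0..\<tau>} s =
              ennreal (H s x) * indicator {0..\<tau>} s"
            using elim(5,6)
          proof eventually_elim
            case (elim s)
            show ?case
            proof (cases "s \<in> {0..\<tau>}")
              case in_range: True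
              then have sT: "s \<in> {0..T}" using T by auto
              have "b s (X s x) = bb s (X s x)" "b' s (X' s x) = bb' s (X' s x)"
                using elim sT b_eq b'_eq by blast+
              then show ?thesis
                using True XY[OF \<open>x \<notin> Z\<close> sT] XY'[OF \<open>x \<notin> Z'\<close> sT] by (simp add: H_def)
            qed simp
          qed
        qed
        finally show ?thesis .
      qed (simp add: S_def)
    qed
  qed (use W0 p in auto)
  define l where "l = \<bar>ln \<epsilon>\<bar>"
  have l: "0 < l" using \<epsilon> by (simp add: l_def)
  \<comment> \<open>From almost every starting point, the two trajectories are at most \<open>Q\<close> apart up to time \<open>\<tau>\<close>.\<close>
  define Q where "Q = \<tau> * (M + M')"
  have Q0: "0 \<le> Q" using \<tau> M by (simp add: Q_def)
  define V where "V = measure lborel (ball (0::real^'n) r)"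
  define C0 where "C0 = 2 powr p * V + (2 * Q * W) powr p"
  have C0: "0 \<le> C0" by (simp add: C0_def V_def)
  have tT: "t \<in> {0..T}" using t T by auto
  have "(\<integral>\<^sup>+x\<in>ball 0 r. ennreal (norm (X t x - X' t x) powr p) \<partial>lborel) \<le>
      (\<integral>\<^sup>+x. ennreal ((2 / l) powr p) * indicator (ball 0 r) x + ennreal ((2 * Q / l) powr p) * ennreal (S x powr p) \<partial>lborel)"
  proof (rule nn_integral_mono_AE)
    show "AE x in lborel. ennreal (norm (X t x - X' t x) powr p) * indicator (ball 0 r) x \<le>
        ennreal ((2 / l) powr p) * indicator (ball 0 r) x + ennreal ((2 * Q / l) powr p) * ennreal (S x powr p)"
      using disp disp'
    proof eventually_elim
      case (elim x)
      show ?case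
      proof (cases "x \<in> ball 0 r")
        case True
        have "norm (X t x - X' t x) \<le> norm (X t x - x) + norm (X' t x - x)"
          using norm_triangle_ineq4[of "X t x - x" "X' t x - x"] by simp
        also have "\<dots> \<le> M * t + M' * t" using elim tT by (intro add_mono) auto
        also have "\<dots> \<le> Q"
        proof -
          have "(M + M') * t \<le> (M + M') * \<tau>" using t M by (intro mult_left_mono) auto
          then show ?thesis by (simp add: Q_def algebra_simps)
        qed
        finally have "norm (X t x - X' t x) \<le> Q" .
        then have "norm (X t x - X' t x) powr p \<le> (2 / l) powr p + (2 * Q / l) powr p * S x powr p"
          using powr_le_log_powr[OF \<epsilon>, of "norm (X t x - X' t x)" Q p] p True by (simp add: S_def l_def)
        then have "ennreal (norm (X t x - X' t x) powr p) \<le> ennreal ((2 / l) powr p + (2 * Q / l) powr p * S x powr p)"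
          by (rule ennreal_leI)
        then show ?thesis using True by (simp add: ennreal_plus ennreal_mult)
      qed simp
    qed
  qed
  also have "\<dots> \<le> ennreal ((2 / l) powr p) * ennreal V + ennreal ((2 * Q / l) powr p) * ennreal (W powr p)"
  proof -
    have [measurable]: "X t \<in> borel_measurable lebesgue" "X' t \<in> borel_measurable lebesgue"
      using compressible_measurable[OF X(2) tT] compressible_measurable[OF X'(2) tT] .
    have [measurable]: "(\<lambda>x. indicator (ball 0 r) x :: real) \<in> borel_measurable (lebesgue :: (real^'n) measure)"
      "(\<lambda>x. indicator (ball 0 r) x :: ennreal) \<in> borel_measurable (lebesgue :: (real^'n) measure)"
      by (simp_all add: measurable_completion)
    have [measurable]: "S \<in> borel_measurable lebesgue" unfolding S_def by measurable
    have "(\<integral>\<^sup>+x. ennreal ((2 / l) powr p) * indicator (ball 0 r) x + ennreal ((2 * Q / l) powr p) * ennreal (S x powr p) \<partial>lborel) =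
        (\<integral>\<^sup>+x. ennreal ((2 / l) powr p) * indicator (ball 0 r) x + ennreal ((2 * Q / l) powr p) * ennreal (S x powr p) \<partial>lebesgue)"
      by (rule nn_integral_completion[symmetric])
    also have "\<dots> = (\<integral>\<^sup>+x. ennreal ((2 / l) powr p) * indicator (ball (0::real^'n) r) x \<partial>lebesgue) + (\<integral>\<^sup>+x. ennreal ((2 * Q / l) powr p) * ennreal (S x powr p) \<partial>lebesgue)"
      by (rule nn_integral_add) measurable
    also have "(\<integral>\<^sup>+x. ennreal ((2 * Q / l) powr p) * ennreal (S x powr p) \<partial>lebesgue) = ennreal ((2 * Q / l) powr p) * (\<integral>\<^sup>+x. ennreal (S x powr p) \<partial>lebesgue)"
      by (rule nn_integral_cmult) measurable
    also have "(\<integral>\<^sup>+x. ennreal ((2 / l) powr p) * indicator (ball (0::real^'n) r) x \<partial>lebesgue) = ennreal ((2 / l) powr p) * emeasure lborel (ball (0::real^'n) r)"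
      unfolding nn_integral_completion by (rule nn_integral_cmult_indicator) simp
    also have "emeasure lborel (ball (0::real^'n) r) = ennreal V"
      unfolding V_def by (rule emeasure_eq_ennreal_measure) (use emeasure_ball_pos_finite(2)[OF r] in auto)
    finally show ?thesis
      using S_int by (simp only: nn_integral_completion) (intro add_left_mono mult_left_mono, auto)
  qed
  also have "\<dots> = ennreal ((2 / l) powr p * V + (2 * Q / l) powr p * W powr p)"
    by (simp add: ennreal_plus ennreal_mult V_def)
  also have "(2 / l) powr p * V + (2 * Q / l) powr p * W powr p = (C0 powr (1 / p) / l) powr p"
  proof -
    have "(C0 powr (1 / p) / l) powr p = C0 / l powr p"
      using C0 p l by (simp add: powr_divide powr_powr)
    also have "\<dots> = (2 / l) powr p * V + (2 * Q / l) powr p * W powr p"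
      using l Q0 W0 by (simp add: C0_def powr_divide powr_mult add_divide_distrib)
    finally show ?thesis by simp
  qed
  finally have "eLp_norm p (ball 0 r) (\<lambda>x. X t x - X' t x) \<le> ennreal (C0 powr (1 / p) / l)"
    using p l by (intro eLp_norm_le) auto
  then show ?thesis unfolding C0_def V_def Q_def l_def .
qed

theorem proposition2p1:
  fixes p \<tau> r M M' L L' K :: real
  assumes "1 < p" and "0 \<le> \<tau>" and "0 < r"
    and "0 \<le> M" and "0 \<le> M'" and "0 < L" and "0 < L'" and "0 \<le> K"
  shows "\<exists>C>0. \<exists>\<delta>\<^sub>0\<in>{0<..<1}.
    \<forall>(T::real) (b::real \<Rightarrow> real^'n::finite \<Rightarrow> real^'n) (b'::real \<Rightarrow> real^'n \<Rightarrow> real^'n)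
      (D::real \<Rightarrow> real^'n \<Rightarrow> real^'n^'n)
      (X::real \<Rightarrow> real^'n \<Rightarrow> real^'n) (X'::real \<Rightarrow> real^'n \<Rightarrow> real^'n) (R::real) (\<delta>::ennreal).
      0 < T \<longrightarrow> \<tau> \<le> T \<longrightarrow>
      b \<in> L1_W1p T p \<longrightarrow> b' \<in> L1_W1p T p \<longrightarrow>
      Linf_norm T b = ennreal M \<longrightarrow> Linf_norm T b' = ennreal M' \<longrightarrow>
      spatial_weak_derivative T b D \<longrightarrow> L1_Lp_norm T p UNIV D = ennreal K \<longrightarrow>
      regular_Lagrangian_flow T b X \<longrightarrow> compressibility_constant T X L \<longrightarrow>
      regular_Lagrangian_flow T b' X' \<longrightarrow> compressibility_constant T X' L' \<longrightarrow>
      R = r + T * M' \<longrightarrow>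
      \<delta> = L1_Lp_norm \<tau> p (ball 0 R) (\<lambda>t x. b t x - b' t x) \<longrightarrow>
      \<delta> \<le> ennreal \<delta>\<^sub>0 \<longrightarrow>
      (SUP t\<in>{0..\<tau>}. eLp_norm p (ball 0 r) (\<lambda>x. X t x - X' t x))
        \<le> (if \<delta> = 0 then 0 else ennreal (C / \<bar>ln (enn2real \<delta>)\<bar>))"
proof -
  obtain Cs where Cs: "0 < Cs" "\<And>(f :: real^'n \<Rightarrow> real^'n) G. has_weak_derivative f G \<Longrightarrow>
      maximal_Lipschitz Cs f G"
    using weak_derivative_maximal_function_bound[where 'n='n and 'm='n] by blast
  define W where "W = 3 * (Cs * ((L + L') * maximal_constant TYPE('n) p) powr (1 / p) * K + L' powr (1 / p)) + \<tau> + 1"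
  define C where "C = (2 powr p * measure lborel (ball (0::real^'n) r) + (2 * (\<tau> * (M + M')) * W) powr p) powr (1 / p)"
  have V: "0 < measure lborel (ball (0::real^'n) r)"
    using assms(3) content_ball_pos[of r "0::real^'n"] by simp
  have C: "0 < C"
  proof -
    have "0 < 2 powr p * measure lborel (ball (0::real^'n) r) + (2 * (\<tau> * (M + M')) * W) powr p"
      using V by (intro add_pos_nonneg mult_pos_pos) auto
    then show ?thesis unfolding C_def by (subst powr_gt_zero) linarith
  qed
  show ?thesis
  \<comment> \<open>Any \<open>\<delta>\<^sub>0 < 1\<close> serves, since the estimate holds at all scales below \<open>1\<close>.\<close>
  proof (rule exI[of _ C], intro conjI C bexI[of _ "1 / 2"] allI impI)
    fix T :: real and b b' :: "real \<Rightarrow> real^'n \<Rightarrow> real^'n" and D :: "real \<Rightarrow> real^'n \<Rightarrow> real^'n^'n"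
      and X X' :: "real \<Rightarrow> real^'n \<Rightarrow> real^'n" and R :: real and \<delta> :: ennreal
    assume hyps: "0 < T" "\<tau> \<le> T" "b \<in> L1_W1p T p" "b' \<in> L1_W1p T p"
      "Linf_norm T b = ennreal M" "Linf_norm T b' = ennreal M'"
      "spatial_weak_derivative T b D" "L1_Lp_norm T p UNIV D = ennreal K"
      "regular_Lagrangian_flow T b X" "compressibility_constant T X L"
      "regular_Lagrangian_flow T b' X'" "compressibility_constant T X' L'"
      and R: "R = r + T * M'" and \<delta>: "\<delta> = L1_Lp_norm \<tau> p (ball 0 R) (\<lambda>t x. b t x - b' t x)"
      and small: "\<delta> \<le> ennreal (1 / 2)"
    have est: "eLp_norm p (ball 0 r) (\<lambda>x. X t x - X' t x) \<le> ennreal (C / \<bar>ln \<epsilon>\<bar>)"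
      if "\<delta> \<le> ennreal \<epsilon>" "0 < \<epsilon>" "\<epsilon> < 1" "t \<in> {0..\<tau>}" for \<epsilon> t
      unfolding C_def W_def
      by (rule stability_at_scale[OF assms(1,3-8) Cs hyps(2-)]) (use that in \<open>simp_all add: \<delta> R\<close>)
    show "(SUP t\<in>{0..\<tau>}. eLp_norm p (ball 0 r) (\<lambda>x. X t x - X' t x))
        \<le> (if \<delta> = 0 then 0 else ennreal (C / \<bar>ln (enn2real \<delta>)\<bar>))"
    proof (rule SUP_least)
      fix t assume t: "t \<in> {0..\<tau>}"
      show "eLp_norm p (ball 0 r) (\<lambda>x. X t x - X' t x) \<le> (if \<delta> = 0 then 0 else ennreal (C / \<bar>ln (enn2real \<delta>)\<bar>))"
      proof (cases "\<delta> = 0")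
        case False
        have fin: "\<delta> < top" by (rule le_less_trans[OF small ennreal_less_top])
        then have eq: "\<delta> = ennreal (enn2real \<delta>)" by simp
        have "0 < enn2real \<delta>" using False fin by (simp add: enn2real_positive_iff zero_less_iff_neq_zero)
        moreover have "enn2real \<delta> \<le> 1 / 2"
          using ord_eq_le_trans[OF eq[symmetric] small] by (subst (asm) ennreal_le_iff) simp_all
        ultimately have "eLp_norm p (ball 0 r) (\<lambda>x. X t x - X' t x) \<le> ennreal (C / \<bar>ln (enn2real \<delta>)\<bar>)"
          using eq t by (intro est) auto
        then show ?thesis using False by simp
      next
        case True
        \<comment> \<open>Now every scale is admissible; \<open>\<epsilon> = exp (-(k + 1))\<close> gives the bound \<open>C / (k + 1)\<close>.\<close>
        have "eLp_norm p (ball 0 r) (\<lambda>x. X t x - X' t x) \<le> ennreal (C / real (Suc k))" for k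
          using est[of "exp (- real (Suc k))" t] True t by (simp add: add.commute)
        moreover have "(\<lambda>k. ennreal (C / real (Suc k))) \<longlonglongrightarrow> ennreal 0"
          by (intro tendsto_ennrealI) (rule LIMSEQ_Suc[OF lim_const_over_n])
        ultimately have "eLp_norm p (ball 0 r) (\<lambda>x. X t x - X' t x) \<le> ennreal 0"
          by (intro tendsto_lowerbound[of _ _ sequentially]) auto
        then show ?thesis using True by simp
      qed
    qed
  qed simp
qed

end
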